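(* Let $H(q,p)$ be a Hamiltonian on $T^*Q$ with $Q=\mathbb{R}^n$ such that $H$ and $\frac{\partial H}{\partial p}$ are Lipschitz continuous in both variables. Let $r\ge 0$ be an integer, and let $(b_i,c_i)_{i=1}^m$ be the weights and nodes of a quadrature rule of order $s$. Let $H_d^{+}(q_0,p_1;h)$ and $H_d^{-}(q_1,p_0;h)$ be the Type II (right) and Type III (left) Taylor discrete Hamiltonians constructed from the $r$-order and $(r+1)$-order Taylor methods and this quadrature rule (see context). Then $H_d^{\pm}$ approximates the exact discrete Hamiltonian $H_d^{\pm,E}$ with order of accuracy at least $\min(r+1,s)$, that is, as $h\to 0$, $$H_d^{+}(q_0,p_1;h)=H_d^{+,E}(q_0,p_1;h)+\mathcal{O}\big(h^{\min(r+1,s)+1}\big),$$ $$H_d^{-}(q_1,p_0;h)=H_d^{-,E}(q_1,p_0;h)+\mathcal{O}\big(h^{\min(r+1,s)+1}\big).$$ Moreover, the associated discrete Hamiltonian maps $\tilde F_{H_d^{\pm}}:(q_0,p_0)\mapsto(q_1,p_1)$, viewed as one-step methods for Hamilton's equations of $H$, also have order of accuracy at least $\min(r+1,s)$.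
   Context: Hamilton's equations are $\dot q=\frac{\partial H}{\partial p}$, $\dot p=-\frac{\partial H}{\partial q}$, written $\dot z=\varphi(z)$ with $z=(q,p)$. $H$ is assumed to be of class $C^k$ with $k$ sufficiently large (depending on $r$ and $s$) for the Taylor methods to be defined and the quadrature order to apply. Write $\pi_Q:(q,p)\mapsto q$ and $\pi_{T^*Q}:(q,p)\mapsto p$. Taylor method. For an integer $\rho\ge0$, the $\rho$-order Taylor method is $\Psi_h^{(\rho)}(z_0)=z_0+\sum_{k=1}^{\rho}\frac{h^k}{k!}\varphi^{(k-1)}(z_0)$, where $\varphi^{(k-1)}$ is the $(k-1)$-th time derivative of $\varphi(z(t))$ along solutions of $\dot z=\varphi(z)$, expressed as a function of $z$. Quadrature of order $s$. For every sufficiently smooth $F$, $\int_0^hF(t)\,dt=h\sum_{i=1}^m b_iF(c_ih)+\mathcal{O}(h^{s+1})$. Exact discrete Hamiltonians. $$H_d^{+,E}(q_0,p_1;h)=p_1^\top q_1-\int_0^h\big[p(t)^\top\dot q(t)-H(q(t),p(t))\big]dt,$$ where $(q,p)$ solves Hamilton's equations with $q(0)=q_0$, $p(h)=p_1$, and $q_1=q(h)$; and $$H_d^{-,E}(q_1,p_0;h)=-p_0^\top q_0-\int_0^h\big[p(t)^\top\dot q(t)-H(q(t),p(t))\big]dt,$$ where $(q,p)$ solves Hamilton's equations with $q(h)=q_1$, $p(0)=p_0$, and $q_0=q(0)$. Type II Taylor discrete Hamiltonian. Let $\tilde p_0$ be the solution of $p_1=\pi_{T^*Q}\circ\Psi_h^{(r)}(q_0,\tilde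 p_0)$; set $(q_{c_i},p_{c_i})=\Psi_{c_ih}^{(r)}(q_0,\tilde p_0)$, $\tilde q_1=\pi_Q\circ\Psi_h^{(r+1)}(q_0,\tilde p_0)$, $\dot q_{c_i}=\frac{\partial H}{\partial p}(q_{c_i},p_{c_i})$, and $$H_d^+(q_0,p_1;h)=p_1^\top\tilde q_1-h\sum_{i=1}^m b_i\big[p_{c_i}^\top\dot q_{c_i}-H(q_{c_i},p_{c_i})\big].$$ Type III Taylor discrete Hamiltonian. Let $\tilde q_0$ be the solution of $q_1=\pi_Q\circ\Psi_h^{(r+1)}(\tilde q_0,p_0)$; set $(q_{c_i},p_{c_i})=\Psi_{c_ih}^{(r)}(\tilde q_0,p_0)$, $\dot q_{c_i}=\frac{\partial H}{\partial p}(q_{c_i},p_{c_i})$, and $$H_d^-(q_1,p_0;h)=-p_0^\top\tilde q_0-h\sum_{i=1}^m b_i\big[p_{c_i}^\top\dot q_{c_i}-H(q_{c_i},p_{c_i})\big].$$ For small $h$, "the solution" $\tilde p_0$ (resp. $\tilde q_0$), and likewise the solution of each boundary-value problem, is the locally unique one which tends to $p_1$ (resp. $q_1$) as $h\to0$. Discrete Hamiltonian maps. $\tilde F_{H_d^+}:(q_0,p_0)\mapsto(q_1,p_1)$ is defined implicitly, for small $h$ (near the identity), by $p_0=D_1H_d^+(q_0,p_1)$, $q_1=D_2H_d^+(q_0,p_1)$; $\tilde F_{H_d^-}$ is defined implicitly by $p_1=-D_1H_d^-(q_1,p_0)$, $q_0=-D_2H_d^-(q_1,p_0)$. Here $D_i$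 is the partial derivative in the $i$-th argument. A one-step method has order of accuracy $k$ if it differs from the exact time-$h$ flow map by $\mathcal{O}(h^{k+1})$. *)

theory Defs
  imports "HOL-Analysis.Analysis" "HOL-Library.Landau_Symbols"
begin

section \<open>Smoothness and Hamilton's equations\<close>

text \<open>
  On a finite-dimensional space, being \<open>C\<^sup>k\<close> can be tested on directional derivatives; unlike
  a recursion on the Frechet derivative itself this does not change the type of \<open>f\<close>.
\<close>

primrec Ck :: "nat \<Rightarrow> ('a::euclidean_space \<Rightarrow> 'b::real_normed_vector) \<Rightarrow> bool" where
  "Ck 0 f \<longleftrightarrow> continuous_on UNIV f"
| "Ck (Suc k) f \<longleftrightarrow>
     (\<forall>x. f differentiable at x) \<and> (\<forall>v. Ck k (\<lambda>x. frechet_derivative f (at x) v))"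

definition gradient :: "('a::real_inner \<Rightarrow> real) \<Rightarrow> 'a \<Rightarrow> 'a" where
  "gradient f x = (THE D. GDERIV f x :> D)"

text \<open>The phase space over \<open>'q\<close> is \<open>'q \<times> 'q\<close>, a point being \<open>z = (q, p)\<close>.\<close>

definition dH_dq :: "('q::euclidean_space \<times> 'q \<Rightarrow> real) \<Rightarrow> 'q \<times> 'q \<Rightarrow> 'q" where
  "dH_dq H z = gradient (\<lambda>q. H (q, snd z)) (fst z)"

definition dH_dp :: "('q::euclidean_space \<times> 'q \<Rightarrow> real) \<Rightarrow> 'q \<times> 'q \<Rightarrow> 'q" where
  "dH_dp H z = gradient (\<lambda>p. H (fst z, p)) (snd z)"

definition ham_vf :: "('q::euclidean_space \<times> 'q \<Rightarrow> real) \<Rightarrow> 'q \<times> 'q \<Rightarrow> 'q \<times> 'q" where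
  "ham_vf H z = (dH_dp H z, - dH_dq H z)"

text \<open>
  \<open>flow X z\<^sub>0\<close> is the solution curve of \<open>z' = X z\<close> with \<open>z 0 = z\<^sub>0\<close>, on the whole real line. A
  Hamiltonian vector field of a Lipschitz \<open>C\<^sup>2\<close> function is bounded and \<open>C\<^sup>1\<close>, so for it
  this curve exists and is unique.
\<close>

definition flow :: "('a::real_normed_vector \<Rightarrow> 'a) \<Rightarrow> 'a \<Rightarrow> real \<Rightarrow> 'a" where
  "flow X z0 = (THE z. z 0 = z0 \<and> (\<forall>t. (z has_vector_derivative X (z t)) (at t)))"


section \<open>Taylor methods and quadrature\<close>

text \<open>The \<open>k\<close>-th time derivative of \<open>X\<close> along solutions, as a function of the state.\<close>

definition time_deriv :: "('a::real_normed_vector \<Rightarrow> 'a) \<Rightarrow> nat \<Rightarrow> 'a \<Rightarrow> 'a" where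
  "time_deriv X k z0 =
     ((\<lambda>g t. vector_derivative g (at t)) ^^ k) (\<lambda>t. X (flow X z0 t)) 0"

definition taylor :: "('a::real_normed_vector \<Rightarrow> 'a) \<Rightarrow> nat \<Rightarrow> real \<Rightarrow> 'a \<Rightarrow> 'a" where
  "taylor X \<rho> h z0 = z0 + (\<Sum>k=1..\<rho>. (h ^ k / fact k) *\<^sub>R time_deriv X (k - 1) z0)"

definition quadrature_order ::
  "nat \<Rightarrow> (nat \<Rightarrow> real) \<Rightarrow> (nat \<Rightarrow> real) \<Rightarrow> nat \<Rightarrow> bool" where
  "quadrature_order m b c s \<longleftrightarrow>
     (\<exists>k. \<forall>F :: real \<Rightarrow> real. Ck k F \<longrightarrow>
        (\<lambda>h. integral {0..h} F - h * (\<Sum>i=1..m. b i * F (c i * h)))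
          \<in> O[at_right 0](\<lambda>h. h ^ (s + 1)))"


section \<open>Locally unique solutions of equations depending on the step size\<close>

text \<open>
  \<open>S h a y\<close> says that \<open>y\<close> solves an equation with step size \<open>h\<close> and data \<open>a\<close>. The function
  \<open>local_solution S x\<^sub>0\<close> picks the locally unique solution that tends to \<open>x\<^sub>0 a\<close> as \<open>h\<close> tends
  to \<open>0\<close>. The range of step sizes and the radius of uniqueness are uniform for data near a given
  point (otherwise, for a fixed \<open>h\<close>, one could not differentiate in the data). This determines
  \<open>local_solution S x\<^sub>0 h a'\<close> for \<open>(h, a')\<close> near \<open>(0, a)\<close>, for each \<open>a\<close>; its values for
  large \<open>h\<close> are irrelevant.
\<close>

definition is_local_solution ::
  "(real \<Rightarrow> 'a::topological_space \<Rightarrow> 'b::metric_space \<Rightarrow> bool) \<Rightarrow> ('a \<Rightarrow> 'b) \<Rightarrow>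
   (real \<Rightarrow> 'a \<Rightarrow> 'b) \<Rightarrow> bool" where
  "is_local_solution S x0 x \<longleftrightarrow>
     (\<forall>a. ((\<lambda>h. x h a) \<longlongrightarrow> x0 a) (at_right 0) \<and>
          (\<exists>\<delta>>0. \<forall>\<^sub>F (h, a') in at_right 0 \<times>\<^sub>F nhds a.
             \<forall>y. (dist y (x0 a') < \<delta> \<and> S h a' y) \<longleftrightarrow> y = x h a'))"

definition local_solution ::
  "(real \<Rightarrow> 'a::topological_space \<Rightarrow> 'b::metric_space \<Rightarrow> bool) \<Rightarrow> ('a \<Rightarrow> 'b) \<Rightarrow>
   real \<Rightarrow> 'a \<Rightarrow> 'b" where
  "local_solution S x0 = (SOME x. is_local_solution S x0 x)"


section \<open>Exact discrete Hamiltonians\<close>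

definition action ::
  "('q::euclidean_space \<times> 'q \<Rightarrow> real) \<Rightarrow> real \<Rightarrow> (real \<Rightarrow> 'q \<times> 'q) \<Rightarrow> real" where
  "action H h z =
     integral {0..h} (\<lambda>t. snd (z t) \<bullet> vector_derivative (\<lambda>\<tau>. fst (z \<tau>)) (at t) - H (z t))"

text \<open>
  A solution of a boundary value problem on \<open>[0, h]\<close> is the solution curve through its unknown
  initial momentum (data \<open>(q\<^sub>0, p\<^sub>1)\<close>), respectively initial position (data \<open>(q\<^sub>1, p\<^sub>0)\<close>).
\<close>

definition exact_p0 ::
  "('q::euclidean_space \<times> 'q \<Rightarrow> real) \<Rightarrow> real \<Rightarrow> 'q \<times> 'q \<Rightarrow> 'q" where
  "exact_p0 H = local_solution
     (\<lambda>h (q0, p1) p0. snd (flow (ham_vf H) (q0, p0) h) = p1) (\<lambda>(q0, p1). p1)"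

definition exact_q0 ::
  "('q::euclidean_space \<times> 'q \<Rightarrow> real) \<Rightarrow> real \<Rightarrow> 'q \<times> 'q \<Rightarrow> 'q" where
  "exact_q0 H = local_solution
     (\<lambda>h (q1, p0) q0. fst (flow (ham_vf H) (q0, p0) h) = q1) (\<lambda>(q1, p0). q1)"

definition exact_Hd_plus ::
  "('q::euclidean_space \<times> 'q \<Rightarrow> real) \<Rightarrow> real \<Rightarrow> 'q \<Rightarrow> 'q \<Rightarrow> real" where
  "exact_Hd_plus H h q0 p1 =
     (let z = flow (ham_vf H) (q0, exact_p0 H h (q0, p1))
      in p1 \<bullet> fst (z h) - action H h z)"

definition exact_Hd_minus ::
  "('q::euclidean_space \<times> 'q \<Rightarrow> real) \<Rightarrow> real \<Rightarrow> 'q \<Rightarrow> 'q \<Rightarrow> real" where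
  "exact_Hd_minus H h q1 p0 =
     (let z = flow (ham_vf H) (exact_q0 H h (q1, p0), p0)
      in - (p0 \<bullet> fst (z 0)) - action H h z)"


section \<open>Taylor discrete Hamiltonians\<close>

definition taylor_p0 ::
  "('q::euclidean_space \<times> 'q \<Rightarrow> real) \<Rightarrow> nat \<Rightarrow> real \<Rightarrow> 'q \<times> 'q \<Rightarrow> 'q" where
  "taylor_p0 H r = local_solution
     (\<lambda>h (q0, p1) p0. p1 = snd (taylor (ham_vf H) r h (q0, p0))) (\<lambda>(q0, p1). p1)"

definition taylor_q0 ::
  "('q::euclidean_space \<times> 'q \<Rightarrow> real) \<Rightarrow> nat \<Rightarrow> real \<Rightarrow> 'q \<times> 'q \<Rightarrow> 'q" where
  "taylor_q0 H r = local_solution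
     (\<lambda>h (q1, p0) q0. q1 = fst (taylor (ham_vf H) (r + 1) h (q0, p0))) (\<lambda>(q1, p0). q1)"

definition quadrature_action ::
  "('q::euclidean_space \<times> 'q \<Rightarrow> real) \<Rightarrow> nat \<Rightarrow> nat \<Rightarrow> (nat \<Rightarrow> real) \<Rightarrow> (nat \<Rightarrow> real) \<Rightarrow>
   real \<Rightarrow> 'q \<times> 'q \<Rightarrow> real" where
  "quadrature_action H r m b c h z0 =
     h * (\<Sum>i=1..m. b i * (let z = taylor (ham_vf H) r (c i * h) z0
                            in snd z \<bullet> dH_dp H z - H z))"

definition taylor_Hd_plus ::
  "('q::euclidean_space \<times> 'q \<Rightarrow> real) \<Rightarrow> nat \<Rightarrow> nat \<Rightarrow> (nat \<Rightarrow> real) \<Rightarrow> (nat \<Rightarrow> real) \<Rightarrow>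
   real \<Rightarrow> 'q \<Rightarrow> 'q \<Rightarrow> real" where
  "taylor_Hd_plus H r m b c h q0 p1 =
     (let z0 = (q0, taylor_p0 H r h (q0, p1))
      in p1 \<bullet> fst (taylor (ham_vf H) (r + 1) h z0) - quadrature_action H r m b c h z0)"

definition taylor_Hd_minus ::
  "('q::euclidean_space \<times> 'q \<Rightarrow> real) \<Rightarrow> nat \<Rightarrow> nat \<Rightarrow> (nat \<Rightarrow> real) \<Rightarrow> (nat \<Rightarrow> real) \<Rightarrow>
   real \<Rightarrow> 'q \<Rightarrow> 'q \<Rightarrow> real" where
  "taylor_Hd_minus H r m b c h q1 p0 =
     (let z0 = (taylor_q0 H r h (q1, p0), p0)
      in - (p0 \<bullet> fst z0) - quadrature_action H r m b c h z0)"


section \<open>Discrete Hamiltonian maps and order of accuracy\<close>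

text \<open>
  The defining equations are \<open>p\<^sub>0 = D\<^sub>1 H\<^sub>d\<^sup>+(q\<^sub>0, p\<^sub>1)\<close>, \<open>q\<^sub>1 = D\<^sub>2 H\<^sub>d\<^sup>+(q\<^sub>0, p\<^sub>1)\<close> and
  \<open>p\<^sub>1 = - D\<^sub>1 H\<^sub>d\<^sup>-(q\<^sub>1, p\<^sub>0)\<close>, \<open>q\<^sub>0 = - D\<^sub>2 H\<^sub>d\<^sup>-(q\<^sub>1, p\<^sub>0)\<close>; they include the existence of the
  partial derivatives.
\<close>

definition discrete_map_plus ::
  "(real \<Rightarrow> 'q \<Rightarrow> 'q \<Rightarrow> real) \<Rightarrow> real \<Rightarrow> 'q::euclidean_space \<times> 'q \<Rightarrow> 'q \<times> 'q" where
  "discrete_map_plus Hd = local_solution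
     (\<lambda>h (q0, p0) (q1, p1).
        GDERIV (\<lambda>q. Hd h q p1) q0 :> p0 \<and> GDERIV (\<lambda>p. Hd h q0 p) p1 :> q1)
     (\<lambda>z. z)"

definition discrete_map_minus ::
  "(real \<Rightarrow> 'q \<Rightarrow> 'q \<Rightarrow> real) \<Rightarrow> real \<Rightarrow> 'q::euclidean_space \<times> 'q \<Rightarrow> 'q \<times> 'q" where
  "discrete_map_minus Hd = local_solution
     (\<lambda>h (q0, p0) (q1, p1).
        GDERIV (\<lambda>q. Hd h q p0) q1 :> - p1 \<and> GDERIV (\<lambda>p. Hd h q1 p) p0 :> - q0)
     (\<lambda>z. z)"

text \<open>
  The error constants are locally uniform: \<open>(h, a')\<close> tends to \<open>(0, a)\<close> with \<open>h > 0\<close>, so that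
  the bound \<open>C * h ^ (k + 1)\<close> holds for all small \<open>h > 0\<close> and all \<open>a'\<close> in a neighbourhood of
  \<open>a\<close>, for each \<open>a\<close>.
\<close>

definition discrete_hamiltonian_order ::
  "nat \<Rightarrow> (real \<Rightarrow> 'q::euclidean_space \<Rightarrow> 'q \<Rightarrow> real) \<Rightarrow> (real \<Rightarrow> 'q \<Rightarrow> 'q \<Rightarrow> real) \<Rightarrow> bool"
  where
  "discrete_hamiltonian_order k Hd HdE \<longleftrightarrow>
     (\<forall>a. (\<lambda>(h, (q, p)). Hd h q p - HdE h q p)
            \<in> O[at_right 0 \<times>\<^sub>F nhds a](\<lambda>(h, _). h ^ (k + 1)))"

definition one_step_order ::
  "nat \<Rightarrow> (real \<Rightarrow> 'a \<Rightarrow> 'a) \<Rightarrow> ('a::real_normed_vector \<Rightarrow> 'a) \<Rightarrow> bool" where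
  "one_step_order k F X \<longleftrightarrow>
     (\<forall>a. (\<lambda>(h, z). norm (F h z - flow X z h))
            \<in> O[at_right 0 \<times>\<^sub>F nhds a](\<lambda>(h, _). h ^ (k + 1)))"

end

theory Submission
  imports Defs
begin

text \<open>
  The Taylor and the exact discrete Hamiltonian are both of the form
  \<open>\<plusminus> p \<bullet> q + h K (w, z)\<close>, where \<open>w\<close> is the mixed data and \<open>z\<close>, the initial state of the
  trajectory, solves a near-identity equation \<open>z + h V z = w\<close>. Everything is estimated in the
  Lipschitz seminorm on balls: a Taylor remainder along the flow is
  \<open>O(h\<^sup>N)\<close> together with its Lipschitz constant in the initial state, and this property passes
  through \<open>C\<^sup>1\<^sup>,\<^sup>1\<close> maps, near-identity equations and quadrature (which is exact on
  polynomials of degree \<open>< s\<close>). Hence the difference of the two discrete Hamiltonians is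
  \<open>O(h\<^sup>k\<^sup>+\<^sup>1)\<close> with Lipschitz constant \<open>O(h\<^sup>k\<^sup>+\<^sup>1)\<close>, so their gradients, where they exist, differ by
  \<open>O(h\<^sup>k\<^sup>+\<^sup>1)\<close> as well. The gradient of the exact one is read off from the first variation of the
  action, which needs only that the flow is Lipschitz in the initial state, not that it is
  differentiable. The defining equations of the discrete map are again near the identity, and the
  exact flow solves them up to a residual \<open>O(h\<^sup>k\<^sup>+\<^sup>1)\<close>.
\<close>

section \<open>Functions of class \<open>C\<^sup>k\<close>\<close>

text \<open>Two obstacles shape the estimates. The constant hidden in
  \<open>quadrature_order\<close> depends on the integrand, so applying it along each trajectory
  would give no uniformity in the initial state; it is used on monomials only, where it yields the
  moment identities of the rule. And \<open>local_solution\<close> is an arbitrary choice among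
  functions that agree near \<open>h = 0\<close>, so statements are made on a ball for all small
  \<open>h\<close>, with the range of \<open>h\<close> depending on the ball. The powers of
  \<open>h\<close> are counted as follows. A Taylor step of order \<open>\<rho>\<close>, divided by
  \<open>h\<close>, leaves an increment with error \<open>h ^ \<rho>\<close>. In the equation for
  the initial state the increment carries a factor \<open>h\<close>, so order \<open>r\<close>
  determines this state up to \<open>h ^ (r + 1)\<close>. The boundary term contains the position
  increment directly, which must therefore be accurate to \<open>h ^ (r + 1)\<close>: hence the
  method of order \<open>r + 1\<close> for the position. The factor \<open>h\<close> in front of
  \<open>K\<close> supplies the last power.\<close>

lemma Ck_imp_continuous: "Ck k f \<Longrightarrow> continuous_on UNIV f"
  by (cases k) (auto simp: continuous_on_eq_continuous_within
      intro: differentiable_imp_continuous_within)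

lemma Ck_Suc_has_derivative:
  "Ck (Suc k) f \<Longrightarrow> (f has_derivative frechet_derivative f (at x)) (at x)"
  using frechet_derivative_works by fastforce

text \<open>The derivative is unique, so an explicit formula for it may stand in for
  \<open>frechet_derivative\<close>. The closure proofs by induction on the order pass through this
  rule.\<close>

lemma Ck_SucI:
  assumes "\<And>x. (f has_derivative f' x) (at x)" and "\<And>v. Ck k (\<lambda>x. f' x v)"
  shows "Ck (Suc k) f"
proof -
  have "frechet_derivative f (at x) = f' x" for x
    using assms(1) frechet_derivative_at by metis
  then show ?thesis
    using assms by (auto simp: differentiable_def)
qed

lemma Ck_mono: "Ck k f \<Longrightarrow> j \<le> k \<Longrightarrow> Ck j f"
proof (induction k arbitrary: f j)
  case (Suc k)
  show ?case
  proof (cases j)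
    case 0
    then show ?thesis using Ck_imp_continuous[OF Suc.prems(1)] by simp
  next
    case (Suc i)
    then show ?thesis using Suc.prems Suc.IH by (auto)
  qed
qed simp

lemma Ck_const: "Ck k (\<lambda>x. c)"
proof (induction k arbitrary: c)
  case (Suc k)
  show ?case by (rule Ck_SucI[where f' = "\<lambda>_ _. 0"]) (auto simp: Suc)
qed simp

lemma Ck_bounded_linear:
  assumes "bounded_linear g" "Ck k f"
  shows "Ck k (\<lambda>x. g (f x))"
  using assms(2)
proof (induction k arbitrary: f)
  case 0
  then show ?case using bounded_linear.continuous_on[OF assms(1)] by auto
next
  case (Suc k)
  show ?case
  proof (rule Ck_SucI)
    show "((\<lambda>x. g (f x)) has_derivative (\<lambda>v. g (frechet_derivative f (at x) v))) (at x)" for x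
      by (intro bounded_linear.has_derivative[OF assms(1)] Ck_Suc_has_derivative[OF Suc.prems])
    show "Ck k (\<lambda>x. g (frechet_derivative f (at x) v))" for v
      using Suc by simp
  qed
qed

lemma Ck_linear: "bounded_linear g \<Longrightarrow> Ck k g"
proof (induction k)
  case 0
  then show ?case using linear_continuous_on by auto
next
  case (Suc k)
  show ?case
    by (rule Ck_SucI[where f' = "\<lambda>_. g"]) (use Suc in \<open>auto simp: Ck_const bounded_linear_imp_has_derivative\<close>)
qed

lemma Ck_add:
  assumes "Ck k f" "Ck k g"
  shows "Ck k (\<lambda>x. f x + g x)"
  using assms
proof (induction k arbitrary: f g)
  case 0
  then show ?case by (auto intro: continuous_intros)
next
  case (Suc k)
  show ?case
  proof (rule Ck_SucI)
    show "((\<lambda>x. f x + g x) has_derivative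
        (\<lambda>v. frechet_derivative f (at x) v + frechet_derivative g (at x) v)) (at x)" for x
      by (intro has_derivative_add Ck_Suc_has_derivative[OF Suc.prems(1)]
          Ck_Suc_has_derivative[OF Suc.prems(2)])
    show "Ck k (\<lambda>x. frechet_derivative f (at x) v + frechet_derivative g (at x) v)" for v
      using Suc by simp
  qed
qed

lemma Ck_sum: "(\<And>i. i \<in> I \<Longrightarrow> Ck k (f i)) \<Longrightarrow> Ck k (\<lambda>x. \<Sum>i\<in>I. f i x)"
  by (induction I rule: infinite_finite_induct) (simp_all add: Ck_const Ck_add)

lemma Ck_bilinear:
  assumes "bounded_bilinear B" "Ck k f" "Ck k g"
  shows "Ck k (\<lambda>x. B (f x) (g x))"
  using assms(2,3)
proof (induction k arbitrary: f g)
  case 0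
  then show ?case using bounded_bilinear.continuous_on[OF assms(1)] by auto
next
  case (Suc k)
  show ?case
  proof (rule Ck_SucI)
    show "((\<lambda>x. B (f x) (g x)) has_derivative
        (\<lambda>v. B (f x) (frechet_derivative g (at x) v) + B (frechet_derivative f (at x) v) (g x))) (at x)" for x
      by (intro bounded_bilinear.FDERIV[OF assms(1)] Ck_Suc_has_derivative[OF Suc.prems(1)]
          Ck_Suc_has_derivative[OF Suc.prems(2)])
    show "Ck k (\<lambda>x. B (f x) (frechet_derivative g (at x) v) + B (frechet_derivative f (at x) v) (g x))" for v
      using Suc.prems Ck_mono[OF Suc.prems(1), of k] Ck_mono[OF Suc.prems(2), of k]
      by (intro Ck_add Suc.IH) simp_all
  qed
qed

lemmas Ck_scaleR = Ck_bilinear[OF bounded_bilinear_scaleR]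
lemmas Ck_inner = Ck_bilinear[OF bounded_bilinear_inner]
lemmas Ck_mult = Ck_bilinear[OF bounded_bilinear_mult]

lemma linear_Basis_expansion:
  fixes g :: "'a::euclidean_space \<Rightarrow> 'b::real_vector"
  assumes "linear g"
  shows "g v = (\<Sum>i\<in>Basis. (v \<bullet> i) *\<^sub>R g i)"
proof -
  have "g v = g (\<Sum>i\<in>Basis. (v \<bullet> i) *\<^sub>R i)" by (simp add: euclidean_representation)
  also have "\<dots> = (\<Sum>i\<in>Basis. (v \<bullet> i) *\<^sub>R g i)"
    using assms by (simp add: linear_sum linear_cmul)
  finally show ?thesis .
qed

text \<open>\<open>Ck\<close> speaks of derivatives in fixed directions only. A direction that moves
  with the point is expanded in the basis, which leaves a finite sum of products. The chain rule and
  the Lie derivative both need this.\<close>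

lemma Ck_frechet_derivative_apply:
  fixes f :: "'a::euclidean_space \<Rightarrow> 'b::real_normed_vector"
  assumes f: "\<And>x. f differentiable at x" and u: "Ck k u"
    and g: "\<And>v. Ck k (\<lambda>x. frechet_derivative f (at (g x)) v)"
  shows "Ck k (\<lambda>x. frechet_derivative f (at (g x)) (u x))"
proof -
  have "frechet_derivative f (at (g x)) (u x) =
      (\<Sum>i\<in>Basis. (u x \<bullet> i) *\<^sub>R frechet_derivative f (at (g x)) i)" for x
    by (rule linear_Basis_expansion[OF linear_frechet_derivative[OF f]])
  moreover have "Ck k (\<lambda>x. \<Sum>i\<in>Basis. (u x \<bullet> i) *\<^sub>R frechet_derivative f (at (g x)) i)"
    by (intro Ck_sum Ck_scaleR Ck_inner Ck_const g u)
  ultimately show ?thesis by simp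
qed

text \<open>The induction varies \<open>f\<close> alone: the chain rule produces directional
  derivatives of \<open>f\<close> composed with the same \<open>g\<close>.\<close>

lemma Ck_compose:
  fixes f :: "'b::euclidean_space \<Rightarrow> 'c::real_normed_vector" and g :: "'a::euclidean_space \<Rightarrow> 'b"
  assumes "Ck k f" "Ck k g"
  shows "Ck k (\<lambda>x. f (g x))"
  using assms
proof (induction k arbitrary: f)
  case 0
  then show ?case using continuous_on_compose2[of UNIV f UNIV g] by auto
next
  case (Suc k)
  have g: "Ck k g" using Ck_mono[OF Suc.prems(2)] by simp
  show ?case
  proof (rule Ck_SucI)
    show "((\<lambda>x. f (g x)) has_derivative
        (\<lambda>v. frechet_derivative f (at (g x)) (frechet_derivative g (at x) v))) (at x)" for x
      using has_derivative_compose[OF Ck_Suc_has_derivative[OF Suc.prems(2)]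
          Ck_Suc_has_derivative[OF Suc.prems(1)]] .
    show "Ck k (\<lambda>x. frechet_derivative f (at (g x)) (frechet_derivative g (at x) v))" for v
    proof (rule Ck_frechet_derivative_apply)
      show "f differentiable at x" for x using Suc.prems(1) by simp
      show "Ck k (\<lambda>x. frechet_derivative g (at x) v)" using Suc.prems(2) by simp
      show "Ck k (\<lambda>x. frechet_derivative f (at (g x)) v)" for v
        by (rule Suc.IH) (use Suc.prems(1) g in simp_all)
    qed
  qed
qed

lemma Ck_Pair: "Ck k f \<Longrightarrow> Ck k g \<Longrightarrow> Ck k (\<lambda>x. (f x, g x))"
proof -
  assume "Ck k f" "Ck k g"
  moreover have "bounded_linear (\<lambda>a. (a, 0))" "bounded_linear (\<lambda>a. (0, a))"
    by (auto intro!: bounded_linear_Pair bounded_linear_ident bounded_linear_zero)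
  ultimately have "Ck k (\<lambda>x. (f x, 0) + (0, g x))"
    by (intro Ck_add) (auto intro: Ck_bounded_linear)
  then show ?thesis by simp
qed

lemma Ck_uminus: "Ck k f \<Longrightarrow> Ck k (\<lambda>x. - f x)"
  by (rule Ck_bounded_linear[OF bounded_linear_minus[OF bounded_linear_ident]])

lemma Ck_diff: "Ck k f \<Longrightarrow> Ck k g \<Longrightarrow> Ck k (\<lambda>x. f x - g x)"
  using Ck_add[of k f "\<lambda>x. - g x"] by (simp add: Ck_uminus)

lemma Ck_id: "Ck k (\<lambda>x. x)"
  by (rule Ck_linear[OF bounded_linear_ident])

lemma Ck_power: "Ck k f \<Longrightarrow> Ck k (\<lambda>x. (f x :: real) ^ j)"
  by (induction j) (simp_all add: Ck_const Ck_mult)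

lemmas Ck_fst = Ck_bounded_linear[OF bounded_linear_fst]
lemmas Ck_snd = Ck_bounded_linear[OF bounded_linear_snd]

section \<open>Lie derivative\<close>

text \<open>This is the derivative of \<open>G\<close> along solutions of \<open>X\<close>, written
  without the flow. Its iterates are therefore visibly smooth in the state, whereas smoothness of
  the flow in the initial state is never established.\<close>

definition lie :: "('a::euclidean_space \<Rightarrow> 'a) \<Rightarrow> ('a \<Rightarrow> 'b::real_normed_vector) \<Rightarrow> 'a \<Rightarrow> 'b" where
  "lie X G z = frechet_derivative G (at z) (X z)"

lemma Ck_lie: "Ck (Suc k) G \<Longrightarrow> Ck k X \<Longrightarrow> Ck k (lie X G)"
  unfolding lie_def[abs_def]
  by (rule Ck_frechet_derivative_apply) simp_all

lemma Ck_lie_funpow: "Ck (j + k) G \<Longrightarrow> Ck (j + k) X \<Longrightarrow> Ck k ((lie X ^^ j) G)"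
proof (induction j arbitrary: k)
  case (Suc j)
  then have "Ck (Suc k) ((lie X ^^ j) G)" by (intro Suc.IH) auto
  moreover have "Ck k X" using Suc.prems(2) Ck_mono by (metis le_add2)
  ultimately show ?case by (simp add: Ck_lie)
qed simp

section \<open>Uniform first-order bounds\<close>

text \<open>One number bounds the function, its derivative and the Lipschitz constant of the
  derivative, so that only one constant has to be tracked per ball. Operator norms are spelled out
  pointwise in \<open>v\<close>.\<close>

definition C11 :: "real \<Rightarrow> 'a::real_normed_vector set \<Rightarrow> ('a \<Rightarrow> 'b::real_normed_vector) \<Rightarrow> bool" where
  "C11 B S f \<longleftrightarrow> (\<forall>x\<in>S. norm (f x) \<le> B) \<and>
     (\<exists>f'. \<forall>x\<in>S. (f has_derivative f' x) (at x) \<and> (\<forall>v. norm (f' x v) \<le> B * norm v) \<and>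
        (\<forall>y\<in>S. \<forall>v. norm (f' x v - f' y v) \<le> B * norm (x - y) * norm v))"

lemma C11_mono: "C11 B S f \<Longrightarrow> B \<le> B' \<Longrightarrow> T \<subseteq> S \<Longrightarrow> C11 B' T f"
  unfolding C11_def
  by (smt (verit) mult_right_mono norm_ge_zero order_trans subset_iff)

lemma has_derivative_imp_lipschitz_bound:
  fixes f :: "'a::real_normed_vector \<Rightarrow> 'b::real_normed_vector"
  assumes "convex S" "\<And>x. x \<in> S \<Longrightarrow> (f has_derivative f' x) (at x)"
    and "\<And>x v. x \<in> S \<Longrightarrow> norm (f' x v) \<le> B * norm v" "x \<in> S" "y \<in> S"
  shows "norm (f x - f y) \<le> B * norm (x - y)"
proof (cases "x = y")
  case False
  have "0 \<le> B * norm (x - y)"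
    using assms(3)[OF assms(4), of "x - y"] norm_ge_zero order_trans by blast
  then have "0 \<le> B" using False by (simp add: zero_le_mult_iff)
  show ?thesis
  proof (rule differentiable_bound[OF assms(1) _ _ assms(4,5)])
  show "(f has_derivative f' x) (at x within S)" if "x \<in> S" for x
    using assms(2)[OF that] by (rule has_derivative_at_withinI)
  show "onorm (f' x) \<le> B" if "x \<in> S" for x
    using assms(3)[OF that] \<open>0 \<le> B\<close> by (intro onorm_bound) auto
  qed
qed simp

lemma C11_bound: "C11 B S f \<Longrightarrow> x \<in> S \<Longrightarrow> norm (f x) \<le> B"
  by (simp add: C11_def)

lemma C11_lipschitz:
  "C11 B S f \<Longrightarrow> convex S \<Longrightarrow> x \<in> S \<Longrightarrow> y \<in> S \<Longrightarrow> norm (f x - f y) \<le> B * norm (x - y)"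
  unfolding C11_def using has_derivative_imp_lipschitz_bound by metis

lemma C11_nonneg: "C11 B S f \<Longrightarrow> x \<in> S \<Longrightarrow> 0 \<le> B"
  using C11_bound norm_ge_zero order_trans by metis

text \<open>\<open>C\<^sup>1\<^sup>,\<^sup>1\<close> is what it takes to preserve closeness in the Lipschitz seminorm.\<close>

lemma C11_double_difference:
  fixes f :: "'a::real_normed_vector \<Rightarrow> 'b::real_normed_vector"
  assumes f: "C11 B S f" and S: "convex S" and in_S: "x \<in> S" "x' \<in> S" "y \<in> S" "y' \<in> S"
  shows "norm ((f x - f x') - (f y - f y')) \<le>
    B * norm ((x - x') - (y - y')) + B * (norm (x - y) + norm (x' - y')) * norm (y - y')"
proof -
  obtain f' where f': "\<And>x. x \<in> S \<Longrightarrow> (f has_derivative f' x) (at x)"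
    "\<And>x v. x \<in> S \<Longrightarrow> norm (f' x v) \<le> B * norm v"
    "\<And>x y v. x \<in> S \<Longrightarrow> y \<in> S \<Longrightarrow> norm (f' x v - f' y v) \<le> B * norm (x - y) * norm v"
    using f unfolding C11_def by blast
  have B: "0 \<le> B" using C11_nonneg[OF f in_S(1)] .
  \<comment> \<open>Both segments are run through with the same parameter, and the mean value
    inequality is applied to \<open>f (X t) - f (Y t)\<close> on \<open>[0, 1]\<close>. This keeps
    the two increments together instead of bounding each of them.\<close>
  define X where "X t = x' + t *\<^sub>R (x - x')" for t :: real
  define Y where "Y t = y' + t *\<^sub>R (y - y')" for t :: real
  have XS: "X t \<in> S" if "t \<in> {0..1}" for t
  proof -
    have "X t = (1 - t) *\<^sub>R x' + t *\<^sub>R x" by (simp add: X_def algebra_simps)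
    then show ?thesis using convexD_alt[OF S in_S(2,1), of t] that by simp
  qed
  have YS: "Y t \<in> S" if "t \<in> {0..1}" for t
  proof -
    have "Y t = (1 - t) *\<^sub>R y' + t *\<^sub>R y" by (simp add: Y_def algebra_simps)
    then show ?thesis using convexD_alt[OF S in_S(4,3), of t] that by simp
  qed
  define C where "C = B * norm ((x - x') - (y - y')) + B * (norm (x - y) + norm (x' - y')) * norm (y - y')"
  define g where "g t = f (X t) - f (Y t)" for t
  define g' where "g' t = (\<lambda>s. f' (X t) (s *\<^sub>R (x - x')) - f' (Y t) (s *\<^sub>R (y - y')))" for t :: real
  have dX: "(X has_derivative (\<lambda>s. s *\<^sub>R (x - x'))) (at t)" for t
    unfolding X_def by (auto intro!: derivative_eq_intros)
  have dY: "(Y has_derivative (\<lambda>s. s *\<^sub>R (y - y'))) (at t)" for t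
    unfolding Y_def by (auto intro!: derivative_eq_intros)
  have dg: "(g has_derivative g' t) (at t)" if "t \<in> {0..1}" for t
    unfolding g_def g'_def
    by (intro has_derivative_diff has_derivative_compose[OF dX f'(1)[OF XS[OF that]]]
        has_derivative_compose[OF dY f'(1)[OF YS[OF that]]])
  have bound: "norm (g' t s) \<le> C * norm s" if t: "t \<in> {0..1}" for t s
  proof -
    have lin: "linear (f' (X t))" "linear (f' (Y t))"
      using f'(1)[OF XS[OF t]] f'(1)[OF YS[OF t]] by (auto dest: has_derivative_linear)
    \<comment> \<open>The derivative at \<open>X t\<close> acts on the difference of the directions,
      and the change of the derivative from \<open>X t\<close> to \<open>Y t\<close> acts on the
      common direction; these are the two terms of \<open>C\<close>.\<close>
    have "g' t s = f' (X t) (s *\<^sub>R ((x - x') - (y - y'))) + (f' (X t) (s *\<^sub>R (y - y')) - f' (Y t) (s *\<^sub>R (y - y')))"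
      unfolding g'_def using lin by (simp add: linear_diff linear_cmul scaleR_diff_right)
    then have "norm (g' t s) \<le> B * norm (s *\<^sub>R ((x - x') - (y - y')))
        + B * norm (X t - Y t) * norm (s *\<^sub>R (y - y'))"
      using f'(2)[OF XS[OF t]] f'(3)[OF XS[OF t] YS[OF t]] norm_triangle_le add_mono by metis
    also have "norm (X t - Y t) \<le> norm (x - y) + norm (x' - y')"
    proof -
      have "X t - Y t = (1 - t) *\<^sub>R (x' - y') + t *\<^sub>R (x - y)"
        by (simp add: X_def Y_def algebra_simps)
      then have "norm (X t - Y t) \<le> (1 - t) * norm (x' - y') + t * norm (x - y)"
        using t norm_triangle_ineq[of "(1 - t) *\<^sub>R (x' - y')" "t *\<^sub>R (x - y)"] by simp
      also have "\<dots> \<le> 1 * norm (x' - y') + 1 * norm (x - y)"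
        using t by (intro add_mono mult_right_mono) auto
      finally show ?thesis by simp
    qed
    finally have "norm (g' t s) \<le> B * norm (s *\<^sub>R ((x - x') - (y - y')))
        + B * (norm (x - y) + norm (x' - y')) * norm (s *\<^sub>R (y - y'))"
      using B by (simp add: mult_left_mono mult_right_mono)
    also have "\<dots> = C * norm s" by (simp add: C_def distrib_left distrib_right mult_ac)
    finally show ?thesis .
  qed
  have "norm (g 1 - g 0) \<le> C * norm (1 - 0 :: real)"
    by (rule has_derivative_imp_lipschitz_bound[where S = "{0..1}" and f' = g'])
      (use dg bound in auto)
  then show ?thesis by (simp add: g_def X_def Y_def C_def algebra_simps)
qed

text \<open>Mean value inequality for \<open>f\<close> minus its linear part at \<open>x\<close>: on
  the segment the derivative of this difference is at most \<open>B * norm (y - x)\<close>. The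
  sharp constant would be half as large.\<close>

lemma C11_taylor_bound:
  assumes f: "C11 B S f" "convex S" "x \<in> S" "y \<in> S" and f': "(f has_derivative f') (at x)"
  shows "norm (f y - f x - f' (y - x)) \<le> B * norm (y - x) * norm (y - x)"
proof -
  obtain g where g: "\<And>x. x \<in> S \<Longrightarrow> (f has_derivative g x) (at x)"
    "\<And>x y v. x \<in> S \<Longrightarrow> y \<in> S \<Longrightarrow> norm (g x v - g y v) \<le> B * norm (x - y) * norm v"
    using f(1) unfolding C11_def by blast
  have gx: "g x = f'" using has_derivative_unique[OF g(1)[OF f(3)] f'] .
  have seg: "closed_segment x y \<subseteq> S" using closed_segment_subset[OF f(3,4,2)] .
  have B: "0 \<le> B" using C11_nonneg[OF f(1,3)] .
  have lin: "bounded_linear f'" using f' by (rule has_derivative_bounded_linear)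
  have "norm ((f y - f' y) - (f x - f' x)) \<le> (B * norm (y - x)) * norm (y - x)"
  proof (rule has_derivative_imp_lipschitz_bound[where S = "closed_segment x y" and f' = "\<lambda>u v. g u v - f' v"])
    fix u assume u: "u \<in> closed_segment x y"
    then show "((\<lambda>u. f u - f' u) has_derivative (\<lambda>v. g u v - f' v)) (at u)"
      using seg by (intro has_derivative_diff g(1) bounded_linear_imp_has_derivative lin) auto
    fix v
    have "norm (g u v - g x v) \<le> B * norm (u - x) * norm v" using g(2) u seg f(3) by blast
    also have "\<dots> \<le> B * norm (y - x) * norm v"
      using B segment_bound(1)[OF u] by (intro mult_right_mono mult_left_mono) auto
    finally show "norm (g u v - f' v) \<le> B * norm (y - x) * norm v" by (simp add: gx)
  qed auto
  moreover have "f y - f x - f' (y - x) = (f y - f' y) - (f x - f' x)"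
    by (simp add: linear_diff[OF bounded_linear.linear[OF lin]])
  ultimately show ?thesis by (simp only:)
qed

text \<open>The exact discrete Hamiltonians are differentiated by this rule, since the chain rule
  would call for the derivative of the flow in its initial state.\<close>

lemma has_derivativeI_quadratic:
  assumes "open S" "x \<in> S" "bounded_linear f'"
    and "\<And>y. y \<in> S \<Longrightarrow> norm (f y - f x - f' (y - x)) \<le> C * norm (y - x) ^ 2"
  shows "(f has_derivative f') (at x)"
  unfolding has_derivative_at_alt
proof (intro conjI allI impI)
  fix e :: real assume e: "0 < e"
  obtain r where r: "r > 0" "ball x r \<subseteq> S" using assms(1,2) openE by blast
  \<comment> \<open>\<open>\<bar>C\<bar> + 1\<close> is positive for every real \<open>C\<close>, so
    no sign has to be assumed.\<close>
  define d where "d = min r (e / (\<bar>C\<bar> + 1))"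
  show "\<exists>d>0. \<forall>y. norm (y - x) < d \<longrightarrow> norm (f y - f x - f' (y - x)) \<le> e * norm (y - x)"
  proof (intro exI[of _ d] conjI allI impI)
    show "0 < d" using r e by (simp add: d_def)
    fix y assume y: "norm (y - x) < d"
    then have "y \<in> S" using r(2) by (auto simp: d_def dist_norm norm_minus_commute subset_iff)
    then have "norm (f y - f x - f' (y - x)) \<le> C * norm (y - x) ^ 2" by (rule assms(4))
    also have "\<dots> \<le> (\<bar>C\<bar> + 1) * norm (y - x) ^ 2" by (intro mult_right_mono) auto
    also have "\<dots> = ((\<bar>C\<bar> + 1) * norm (y - x)) * norm (y - x)" by (simp add: power2_eq_square)
    also have "\<dots> \<le> e * norm (y - x)"
    proof (rule mult_right_mono)
      have "norm (y - x) < e / (\<bar>C\<bar> + 1)" using y by (simp add: d_def)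
      then show "(\<bar>C\<bar> + 1) * norm (y - x) \<le> e" by (simp add: pos_less_divide_eq mult.commute)
    qed simp
    finally show "norm (f y - f x - f' (y - x)) \<le> e * norm (y - x)" .
  qed
qed (rule assms(3))

text \<open>\<open>A\<close> bounds the values, \<open>A * B\<close> the derivative, and
  \<open>A * B + A * B\<^sup>2\<close> is the Lipschitz constant of the derivative: the inner
  derivative changes by itself (one factor \<open>B\<close>), the outer one changes with
  \<open>g\<close> and is applied to the inner one (two factors).\<close>

lemma C11_compose:
  fixes f :: "'b::real_normed_vector \<Rightarrow> 'c::real_normed_vector"
    and g :: "'a::real_normed_vector \<Rightarrow> 'b"
  assumes f: "C11 A T f" and g: "C11 B S g" and "g ` S \<subseteq> T" "convex S" "0 \<le> A" "0 \<le> B"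
  shows "C11 (A + A * B + A * B\<^sup>2) S (\<lambda>x. f (g x))"
proof -
  obtain f' where f': "\<And>x. x \<in> T \<Longrightarrow> (f has_derivative f' x) (at x)"
    "\<And>x v. x \<in> T \<Longrightarrow> norm (f' x v) \<le> A * norm v"
    "\<And>x y v. x \<in> T \<Longrightarrow> y \<in> T \<Longrightarrow> norm (f' x v - f' y v) \<le> A * norm (x - y) * norm v"
    using f unfolding C11_def by blast
  obtain g' where g': "\<And>x. x \<in> S \<Longrightarrow> (g has_derivative g' x) (at x)"
    "\<And>x v. x \<in> S \<Longrightarrow> norm (g' x v) \<le> B * norm v"
    "\<And>x y v. x \<in> S \<Longrightarrow> y \<in> S \<Longrightarrow> norm (g' x v - g' y v) \<le> B * norm (x - y) * norm v"
    using g unfolding C11_def by blast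
  have gT: "g x \<in> T" if "x \<in> S" for x using assms(3) that by blast
  have lip: "norm (g x - g y) \<le> B * norm (x - y)" if "x \<in> S" "y \<in> S" for x y
    using C11_lipschitz[OF g \<open>convex S\<close> that] .
  define h where "h x = (\<lambda>v. f' (g x) (g' x v))" for x
  have "((\<lambda>x. f (g x)) has_derivative h x) (at x)" if "x \<in> S" for x
    unfolding h_def by (rule has_derivative_compose[OF g'(1) f'(1)]) (use that gT in auto)
  moreover have "norm (f (g x)) \<le> A + A * B + A * B\<^sup>2" if "x \<in> S" for x
  proof -
    have "norm (f (g x)) \<le> A" using C11_bound[OF f gT[OF that]] .
    moreover have "0 \<le> A * B" "0 \<le> A * B\<^sup>2" using assms by auto
    ultimately show ?thesis by linarith
  qed
  moreover have "norm (h x v) \<le> (A + A * B + A * B\<^sup>2) * norm v" if "x \<in> S" for x v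
  proof -
    have "norm (h x v) \<le> A * norm (g' x v)" unfolding h_def using f'(2) gT that by blast
    also have "\<dots> \<le> A * (B * norm v)" using g'(2)[OF that] assms by (intro mult_left_mono) auto
    also have "\<dots> \<le> (A + A * B + A * B\<^sup>2) * norm v"
      using assms by (simp add: algebra_simps)
    finally show ?thesis .
  qed
  moreover have "norm (h x v - h y v) \<le> (A + A * B + A * B\<^sup>2) * norm (x - y) * norm v"
    if "x \<in> S" "y \<in> S" for x y v
  proof -
    have "linear (f' (g x))" using f'(1)[OF gT[OF that(1)]] by (rule has_derivative_linear)
    then have "h x v - h y v = f' (g x) (g' x v - g' y v) + (f' (g x) (g' y v) - f' (g y) (g' y v))"
      by (simp add: h_def linear_diff)
    then have "norm (h x v - h y v) \<le> A * norm (g' x v - g' y v) + A * norm (g x - g y) * norm (g' y v)"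
      using f'(2)[OF gT[OF that(1)]] f'(3)[OF gT[OF that(1)] gT[OF that(2)]] norm_triangle_le add_mono
      by metis
    also have "\<dots> \<le> A * (B * norm (x - y) * norm v) + A * (B * norm (x - y)) * (B * norm v)"
      using assms lip[OF that] g'(2)[OF that(2)] g'(3)[OF that]
      by (intro add_mono mult_mono mult_left_mono) auto
    also have "\<dots> \<le> (A + A * B + A * B\<^sup>2) * norm (x - y) * norm v"
      using assms by (simp add: algebra_simps power2_eq_square)
    finally show ?thesis .
  qed
  ultimately show ?thesis unfolding C11_def by blast
qed

lemma C11_Pair:
  assumes f: "C11 A S f" and g: "C11 B S g"
  shows "C11 (A + B) S (\<lambda>x. (f x, g x))"
proof -
  obtain f' where f': "\<And>x. x \<in> S \<Longrightarrow> (f has_derivative f' x) (at x)"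
    "\<And>x v. x \<in> S \<Longrightarrow> norm (f' x v) \<le> A * norm v"
    "\<And>x y v. x \<in> S \<Longrightarrow> y \<in> S \<Longrightarrow> norm (f' x v - f' y v) \<le> A * norm (x - y) * norm v"
    using f unfolding C11_def by blast
  obtain g' where g': "\<And>x. x \<in> S \<Longrightarrow> (g has_derivative g' x) (at x)"
    "\<And>x v. x \<in> S \<Longrightarrow> norm (g' x v) \<le> B * norm v"
    "\<And>x y v. x \<in> S \<Longrightarrow> y \<in> S \<Longrightarrow> norm (g' x v - g' y v) \<le> B * norm (x - y) * norm v"
    using g unfolding C11_def by blast
  have pair: "norm (a, b) \<le> \<alpha> + \<beta>" if "norm a \<le> \<alpha>" "norm b \<le> \<beta>" for a :: 'b and b :: 'c and \<alpha> \<beta>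
    using norm_Pair_le[of a b] that by linarith
  have "((\<lambda>x. (f x, g x)) has_derivative (\<lambda>v. (f' x v, g' x v))) (at x)" if "x \<in> S" for x
    using f'(1)[OF that] g'(1)[OF that] by (rule has_derivative_Pair)
  moreover have "norm (f x, g x) \<le> A + B" if "x \<in> S" for x
    by (intro pair C11_bound[OF f that] C11_bound[OF g that])
  moreover have "norm (f' x v, g' x v) \<le> (A + B) * norm v" if "x \<in> S" for x v
    unfolding distrib_right by (intro pair f' g' that)
  moreover have "norm ((f' x v, g' x v) - (f' y v, g' y v)) \<le> (A + B) * norm (x - y) * norm v"
    if "x \<in> S" "y \<in> S" for x y v
    unfolding distrib_right diff_Pair by (intro pair f' g' that)
  ultimately show ?thesis
    unfolding C11_def by (intro conjI ballI exI[of _ "\<lambda>x v. (f' x v, g' x v)"]) blast+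
qed

lemma norm_fst_le_norm: "norm (fst z) \<le> norm z" and norm_snd_le_norm: "norm (snd z) \<le> norm z"
  using norm_fst_le[of "fst z" "snd z"] norm_snd_le[of "snd z" "fst z"] by simp_all

lemma linear_bound_Basis:
  fixes g :: "'a::euclidean_space \<Rightarrow> 'b::real_normed_vector"
  assumes "linear g" "\<And>i. i \<in> Basis \<Longrightarrow> norm (g i) \<le> B"
  shows "norm (g v) \<le> real DIM('a) * B * norm v"
proof -
  have "norm (g v) \<le> (\<Sum>i\<in>Basis. norm ((v \<bullet> i) *\<^sub>R g i))"
    unfolding linear_Basis_expansion[OF assms(1), of v] by (rule norm_sum)
  also have "\<dots> \<le> (\<Sum>i\<in>(Basis :: 'a set). norm v * B)"
  proof (rule sum_mono)
    fix i :: 'a assume "i \<in> Basis"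
    then show "norm ((v \<bullet> i) *\<^sub>R g i) \<le> norm v * B"
      using assms(2)[of i] Basis_le_norm[of i v] by (simp add: mult_mono)
  qed
  finally show ?thesis by (simp add: mult_ac)
qed

lemma continuous_bounded_on_cball:
  fixes f :: "'a::heine_borel \<Rightarrow> 'b::real_normed_vector"
  assumes "continuous_on UNIV f"
  shows "\<exists>B\<ge>0. \<forall>x\<in>cball a R. norm (f x) \<le> B"
proof -
  have "compact (f ` cball a R)"
    using assms by (intro compact_continuous_image continuous_on_subset[OF assms]) auto
  then obtain B where "\<forall>x\<in>f ` cball a R. norm x \<le> B"
    using bounded_iff compact_imp_bounded by blast
  then show ?thesis by (intro exI[of _ "max B 0"]) (auto simp: le_max_iff_disj)
qed

text \<open>Compactness bounds each directional derivative separately; linearity and the finite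
  basis make the bound uniform in the direction.\<close>

lemma Ck_1_bounds:
  fixes f :: "'a::euclidean_space \<Rightarrow> 'b::real_normed_vector"
  assumes "Ck 1 f"
  shows "\<exists>B\<ge>0. \<forall>x\<in>cball a R. norm (f x) \<le> B \<and>
      (\<forall>v. norm (frechet_derivative f (at x) v) \<le> B * norm v) \<and>
      (\<forall>y\<in>cball a R. norm (f x - f y) \<le> B * norm (x - y))"
proof -
  have f: "Ck (Suc 0) f" using assms by simp
  have "\<exists>B\<ge>0. \<forall>x\<in>cball a R. norm (frechet_derivative f (at x) v) \<le> B" for v
    using assms by (intro continuous_bounded_on_cball) simp
  then obtain B where B: "\<And>v. 0 \<le> B v" "\<And>v x. x \<in> cball a R \<Longrightarrow> norm (frechet_derivative f (at x) v) \<le> B v"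
    by metis
  obtain B0 where B0: "0 \<le> B0" "\<And>x. x \<in> cball a R \<Longrightarrow> norm (f x) \<le> B0"
    using continuous_bounded_on_cball[OF Ck_imp_continuous[OF assms]] by meson
  define C where "C = DIM('a) * sum B Basis"
  have C: "0 \<le> C" unfolding C_def by (auto intro!: mult_nonneg_nonneg sum_nonneg B)
  have d: "norm (frechet_derivative f (at x) v) \<le> C * norm v" if "x \<in> cball a R" for x v
    unfolding C_def
  proof (rule linear_bound_Basis[where g = "frechet_derivative f (at x)"])
    show "linear (frechet_derivative f (at x))"
      using Ck_Suc_has_derivative[OF f] by (rule has_derivative_linear)
    show "norm (frechet_derivative f (at x) i) \<le> sum B Basis" if "i \<in> Basis" for i
      using B(2)[OF \<open>x \<in> cball a R\<close>, of i] member_le_sum[OF that, of B] B(1) by fastforce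
  qed
  have "norm (f x - f y) \<le> C * norm (x - y)" if "x \<in> cball a R" "y \<in> cball a R" for x y
    by (rule has_derivative_imp_lipschitz_bound[where S = "cball a R", OF _ Ck_Suc_has_derivative[OF f] d])
      (use that in auto)
  then show ?thesis
    using B0 C d by (intro exI[of _ "B0 + C"]) (auto simp: distrib_right add_increasing add_increasing2)
qed

text \<open>The first-order bounds, applied to each directional derivative of \<open>f\<close>, give
  its Lipschitz constant; summing over the basis again removes the dependence on the
  direction.\<close>

lemma Ck_2_imp_C11:
  fixes f :: "'a::euclidean_space \<Rightarrow> 'b::real_normed_vector"
  assumes "Ck 2 f"
  shows "\<exists>B\<ge>0. C11 B (cball a R) f"
proof -
  have f: "Ck (Suc 0) f" using Ck_mono[OF assms, of "Suc 0"] by (simp del: Ck.simps)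
  have "\<exists>B\<ge>0. \<forall>x\<in>cball a R. \<forall>y\<in>cball a R.
      norm (frechet_derivative f (at x) v - frechet_derivative f (at y) v) \<le> B * norm (x - y)" for v
    using Ck_1_bounds[of "\<lambda>x. frechet_derivative f (at x) v" a R] assms
    by (fastforce simp: numeral_2_eq_2)
  then obtain B where B: "\<And>v. 0 \<le> B v" "\<And>v x y. x \<in> cball a R \<Longrightarrow> y \<in> cball a R \<Longrightarrow>
      norm (frechet_derivative f (at x) v - frechet_derivative f (at y) v) \<le> B v * norm (x - y)"
    by metis
  obtain B0 where B0: "0 \<le> B0" "\<And>x. x \<in> cball a R \<Longrightarrow> norm (f x) \<le> B0"
     "\<And>x v. x \<in> cball a R \<Longrightarrow> norm (frechet_derivative f (at x) v) \<le> B0 * norm v"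
    using Ck_1_bounds[of f a R] f by (auto simp del: Ck.simps)
  define C where "C = DIM('a) * sum B Basis"
  have C: "0 \<le> C" unfolding C_def by (auto intro!: mult_nonneg_nonneg sum_nonneg B)
  have d: "norm (frechet_derivative f (at x) v - frechet_derivative f (at y) v) \<le> C * norm (x - y) * norm v"
    if "x \<in> cball a R" "y \<in> cball a R" for x y v
  proof -
    have "norm (frechet_derivative f (at x) v - frechet_derivative f (at y) v)
        \<le> DIM('a) * (sum B Basis * norm (x - y)) * norm v"
    proof (rule linear_bound_Basis)
      show "linear (\<lambda>v. frechet_derivative f (at x) v - frechet_derivative f (at y) v)"
        using Ck_Suc_has_derivative[OF f] by (intro linear_compose_sub has_derivative_linear)
      show "norm (frechet_derivative f (at x) i - frechet_derivative f (at y) i) \<le> sum B Basis * norm (x - y)"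
        if "i \<in> Basis" for i
      proof -
        have "B i \<le> sum B Basis" by (intro member_le_sum that B) auto
        then show ?thesis using B(2)[OF \<open>x \<in> cball a R\<close> \<open>y \<in> cball a R\<close>, of i]
          by (meson mult_right_mono norm_ge_zero order_trans)
      qed
    qed
    then show ?thesis by (simp add: C_def mult_ac)
  qed
  have le: "B0 * t \<le> (B0 + C) * t" "C * t \<le> (B0 + C) * t" if "0 \<le> t" for t
    using that B0 C by (auto intro!: mult_right_mono)
  have "C11 (B0 + C) (cball a R) f"
    unfolding C11_def
  proof (intro conjI ballI exI[of _ "\<lambda>x. frechet_derivative f (at x)"] allI)
    fix x v assume x: "x \<in> cball a R"
    show "norm (f x) \<le> B0 + C" using B0(2)[OF x] C by simp
    show "(f has_derivative frechet_derivative f (at x)) (at x)"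
      by (rule Ck_Suc_has_derivative[OF f])
    show "norm (frechet_derivative f (at x) v) \<le> (B0 + C) * norm v"
      using B0(3)[OF x, of v] le(1)[of "norm v"] by simp
    fix y assume y: "y \<in> cball a R"
    show "norm (frechet_derivative f (at x) v - frechet_derivative f (at y) v) \<le> (B0 + C) * norm (x - y) * norm v"
      using d[OF x y, of v] le(2)[of "norm (x - y) * norm v"] by (simp add: mult.assoc)
  qed
  then show ?thesis using B0 C by (intro exI[of _ "B0 + C"]) auto
qed

section \<open>Flows of bounded vector fields\<close>

lemma antiderivative_exists:
  fixes f :: "real \<Rightarrow> 'a::euclidean_space"
  assumes "continuous_on UNIV f"
  shows "\<exists>F. F 0 = 0 \<and> (\<forall>t. (F has_vector_derivative f t) (at t))"
proof -
  obtain F where F: "\<And>t. (F has_vector_derivative f t) (at t)"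
    using einterval_antiderivative[of "-\<infinity>" "\<infinity>" f] assms
    by (auto simp: continuous_on_eq_continuous_at)
  have "((\<lambda>t. F t - F 0) has_vector_derivative f t) (at t)" for t
    using F by (auto intro!: derivative_eq_intros)
  then show ?thesis by (intro exI[of _ "\<lambda>t. F t - F 0"]) auto
qed

lemma has_vector_derivative_reflect:
  fixes g :: "real \<Rightarrow> 'a::real_normed_vector"
  assumes "(g has_vector_derivative g') (at (- t))"
  shows "((\<lambda>t. g (- t)) has_vector_derivative - g') (at t)"
proof -
  have "((\<lambda>t. g (- t)) has_derivative (\<lambda>h. (- h) *\<^sub>R g')) (at t)"
    by (rule has_derivative_compose[where f = uminus and g = g])
      (use assms in \<open>auto simp: has_vector_derivative_def intro!: derivative_eq_intros\<close>)
  then show ?thesis by (simp add: has_vector_derivative_def)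
qed

text \<open>A majorant \<open>\<phi>\<close> in place of a constant serves the weighted Picard
  estimate. Negative times, which occur because the nodes \<open>c i\<close> may have any sign, are
  reduced to positive ones by reflection.\<close>

lemma vector_derivative_bound_abs:
  fixes g :: "real \<Rightarrow> 'a::real_normed_vector"
  assumes g: "\<And>t. (g has_vector_derivative g' t) (at t)"
    and \<phi>: "\<And>s. (\<phi> has_real_derivative \<phi>' s) (at s)"
    and bound: "\<And>t. \<bar>t\<bar> \<le> T \<Longrightarrow> norm (g' t) \<le> \<phi>' \<bar>t\<bar>"
    and "\<bar>t\<bar> \<le> T"
  shows "norm (g t - g 0) \<le> \<phi> \<bar>t\<bar> - \<phi> 0"
proof -
  have pos: "norm (f t - f 0) \<le> \<phi> t - \<phi> 0"
    if f: "\<And>t. (f has_vector_derivative f' t) (at t)" "\<And>t. \<bar>t\<bar> \<le> T \<Longrightarrow> norm (f' t) \<le> \<phi>' \<bar>t\<bar>"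
      and t: "0 < t" "t \<le> T" for f :: "real \<Rightarrow> 'a" and f' and t :: real
  proof (rule differentiable_bound_general[OF t(1), where f' = f' and \<phi>' = \<phi>'])
    show "continuous_on {0..t} f"
      using f(1) by (meson continuous_at_imp_continuous_on has_vector_derivative_continuous)
    show "continuous_on {0..t} \<phi>"
      using \<phi> by (meson continuous_at_imp_continuous_on DERIV_isCont)
    show "(\<phi> has_vector_derivative \<phi>' x) (at x)" for x
      using \<phi> by (simp add: has_real_derivative_iff_has_vector_derivative)
    show "norm (f' x) \<le> \<phi>' x" if "0 < x" "x < t" for x
      using f(2)[of x] that t by simp
  qed (rule f)
  consider "t = 0" | "0 < t" | "t < 0" by linarith
  then show ?thesis
  proof cases
    case 2
    then show ?thesis using pos[of g g' t] g bound \<open>\<bar>t\<bar> \<le> T\<close> by simp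
  next
    case 3
    have "norm (g (- (- t)) - g (- 0)) \<le> \<phi> (- t) - \<phi> 0"
    proof (rule pos[where f = "\<lambda>t. g (- t)" and f' = "\<lambda>t. - g' (- t)"])
      show "((\<lambda>t. g (- t)) has_vector_derivative - g' (- s)) (at s)" for s
        by (rule has_vector_derivative_reflect[OF g])
      show "norm (- g' (- s)) \<le> \<phi>' \<bar>s\<bar>" if "\<bar>s\<bar> \<le> T" for s
        using bound[of "- s"] that by simp
    qed (use 3 \<open>\<bar>t\<bar> \<le> T\<close> in auto)
    then show ?thesis using 3 by simp
  qed simp
qed

lemma vector_derivative_bound_const:
  fixes g :: "real \<Rightarrow> 'a::real_normed_vector"
  assumes g: "\<And>t. (g has_vector_derivative g' t) (at t)"
    and bound: "\<And>\<tau>. \<bar>\<tau>\<bar> \<le> \<bar>t\<bar> \<Longrightarrow> norm (g' \<tau>) \<le> C"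
  shows "norm (g t - g 0) \<le> C * \<bar>t\<bar>"
  using vector_derivative_bound_abs[OF g, of "\<lambda>s. C * s" "\<lambda>_. C" "\<bar>t\<bar>" t] bound
  by (auto intro!: derivative_eq_intros)

text \<open>Gronwall's inequality: \<open>exp (- (2 * K * t))\<close> times the squared distance is
  nonincreasing, and the square is differentiable even where the curves meet. The Lipschitz bound is
  asked for along the two curves only, because the fields in question are controlled on balls and
  not globally.\<close>

lemma integral_curve_dist_forward:
  fixes x y :: "real \<Rightarrow> 'a::real_inner"
  assumes x: "\<And>t. (x has_vector_derivative X (x t)) (at t)"
    and y: "\<And>t. (y has_vector_derivative X (y t)) (at t)"
    and lip: "\<And>t. 0 \<le> t \<Longrightarrow> t \<le> T \<Longrightarrow> norm (X (x t) - X (y t)) \<le> K * norm (x t - y t)"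
    and t: "0 \<le> t" "t \<le> T"
  shows "norm (x t - y t) \<le> exp (K * t) * norm (x 0 - y 0)"
proof -
  define d where "d t = x t - y t" for t
  define d' where "d' t = X (x t) - X (y t)" for t
  define u where "u t = exp (- (2 * K * t)) * (d t \<bullet> d t)" for t
  have d: "(d has_vector_derivative d' t) (at t)" for t
    unfolding d_def[abs_def] d'_def by (rule has_vector_derivative_diff[OF x y])
  then have "((\<lambda>t. d t \<bullet> d t) has_vector_derivative d t \<bullet> d' t + d' t \<bullet> d t) (at t)" for t
    using bounded_bilinear.has_vector_derivative[OF bounded_bilinear_inner] by blast
  then have "((\<lambda>t. d t \<bullet> d t) has_real_derivative 2 * (d t \<bullet> d' t)) (at t)" for t
    by (simp add: has_real_derivative_iff_has_vector_derivative inner_commute)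
  then have u: "(u has_real_derivative exp (- (2 * K * t)) * (2 * (d t \<bullet> d' t) - 2 * K * (d t \<bullet> d t))) (at t)" for t
    unfolding u_def[abs_def] by (auto intro!: derivative_eq_intros simp: algebra_simps)
  have "u t \<le> u 0"
  proof (rule DERIV_nonpos_imp_nonincreasing[OF t(1)])
    fix s assume s: "0 \<le> s" "s \<le> t"
    have "d s \<bullet> d' s \<le> norm (d s) * norm (d' s)" by (rule norm_cauchy_schwarz)
    also have "\<dots> \<le> norm (d s) * (K * norm (d s))"
      using lip[of s] s t by (intro mult_left_mono) (auto simp: d_def d'_def)
    also have "\<dots> = K * (d s \<bullet> d s)" by (simp add: dot_square_norm power2_eq_square)
    finally have "exp (- (2 * K * s)) * (2 * (d s \<bullet> d' s) - 2 * K * (d s \<bullet> d s)) \<le> 0"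
      by (intro mult_nonneg_nonpos) auto
    then show "\<exists>y. (u has_real_derivative y) (at s) \<and> y \<le> 0" using u by blast
  qed
  then have "exp (2 * K * t) * u t \<le> exp (2 * K * t) * (d 0 \<bullet> d 0)"
    by (simp add: u_def)
  then have "(norm (d t))\<^sup>2 \<le> (exp (K * t) * norm (d 0))\<^sup>2"
    by (simp add: u_def dot_square_norm power_mult_distrib flip: exp_double mult.assoc exp_add)
  then show ?thesis by (simp add: d_def power2_le_iff_abs_le abs_mult)
qed

lemma integral_curve_dist:
  fixes x y :: "real \<Rightarrow> 'a::real_inner"
  assumes x: "\<And>t. (x has_vector_derivative X (x t)) (at t)"
    and y: "\<And>t. (y has_vector_derivative X (y t)) (at t)"
    and lip: "\<And>t. \<bar>t\<bar> \<le> T \<Longrightarrow> norm (X (x t) - X (y t)) \<le> K * norm (x t - y t)"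
    and t: "\<bar>t\<bar> \<le> T"
  shows "norm (x t - y t) \<le> exp (K * \<bar>t\<bar>) * norm (x 0 - y 0)"
proof (cases "0 \<le> t")
  case True
  then show ?thesis
    using integral_curve_dist_forward[of x X y T K t] assms by simp
next
  case False
  have "norm (x (- (- t)) - y (- (- t))) \<le> exp (K * (- t)) * norm (x (- 0) - y (- 0))"
  proof (rule integral_curve_dist_forward[where X = "\<lambda>z. - X z" and T = T])
    show "norm (- X (x (- s)) - - X (y (- s))) \<le> K * norm (x (- s) - y (- s))"
      if "0 \<le> s" "s \<le> T" for s
      using lip[of "- s"] that by (simp add: norm_minus_commute)
  qed (use False t in \<open>auto intro: has_vector_derivative_reflect x y\<close>)
  then show ?thesis using False by simp
qed

text \<open>A solution that starts in the ball of radius \<open>R\<close> stays within radius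
  \<open>R + M * T\<close> up to time \<open>T\<close>. This replaces global Lipschitz continuity of
  the field: it excludes blow-up and lets local constants serve on every bounded time
  interval.\<close>

locale bounded_C1_field =
  fixes X :: "'a::euclidean_space \<Rightarrow> 'a" and M :: real
  assumes X_C1: "Ck 1 X" and X_bound: "norm (X z) \<le> M"
begin

lemma M_nonneg: "0 \<le> M"
  using X_bound norm_ge_zero order_trans by blast

lemma X_lipschitz:
  obtains K where "1 \<le> K" "\<And>x y. x \<in> cball 0 R \<Longrightarrow> y \<in> cball 0 R \<Longrightarrow> norm (X x - X y) \<le> K * norm (x - y)"
proof -
  obtain B where B: "\<forall>x\<in>cball 0 R. \<forall>y\<in>cball 0 R. norm (X x - X y) \<le> B * norm (x - y)"
    using Ck_1_bounds[OF X_C1, of 0 R] by meson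
  have "B * norm (x - y) \<le> max 1 B * norm (x - y)" for x y :: 'a
    by (intro mult_right_mono) auto
  then show ?thesis using that[of "max 1 B"] B by (meson max.cobounded1 order_trans)
qed

lemma X_continuous: "continuous_on S X"
  using Ck_imp_continuous[OF X_C1] continuous_on_subset by blast

lemma integral_curve_bound:
  assumes "\<And>t. (z has_vector_derivative X (z t)) (at t)"
  shows "norm (z t - z 0) \<le> M * \<bar>t\<bar>"
  by (rule vector_derivative_bound_const[OF assms X_bound])

lemma integral_curve_in_cball:
  assumes "\<And>t. (z has_vector_derivative X (z t)) (at t)" "z 0 \<in> cball 0 R" "\<bar>t\<bar> \<le> T"
  shows "z t \<in> cball 0 (R + M * T)"
proof -
  have "norm (z t) \<le> norm (z 0) + norm (z t - z 0)"
    by (rule norm_triangle_sub)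
  also have "\<dots> \<le> R + M * \<bar>t\<bar>"
    using assms integral_curve_bound[OF assms(1), of t] by (intro add_mono) auto
  also have "\<dots> \<le> R + M * T" using assms M_nonneg by (intro add_left_mono mult_left_mono)
  finally show ?thesis by simp
qed

lemma integral_curve_lipschitz:
  obtains C where "0 \<le> C" "\<And>x y t. (\<And>t. (x has_vector_derivative X (x t)) (at t)) \<Longrightarrow>
     (\<And>t. (y has_vector_derivative X (y t)) (at t)) \<Longrightarrow> x 0 \<in> cball 0 R \<Longrightarrow> y 0 \<in> cball 0 R \<Longrightarrow>
     \<bar>t\<bar> \<le> T \<Longrightarrow> norm (x t - y t) \<le> C * norm (x 0 - y 0)"
proof -
  obtain K where K: "1 \<le> K" "\<And>x y. x \<in> cball 0 (R + M * T) \<Longrightarrow> y \<in> cball 0 (R + M * T) \<Longrightarrow>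
      norm (X x - X y) \<le> K * norm (x - y)"
    using X_lipschitz[of "R + M * T"] by metis
  have "norm (x t - y t) \<le> exp (K * T) * norm (x 0 - y 0)"
    if x: "\<And>t. (x has_vector_derivative X (x t)) (at t)" and y: "\<And>t. (y has_vector_derivative X (y t)) (at t)"
      and in_ball: "x 0 \<in> cball 0 R" "y 0 \<in> cball 0 R" and t: "\<bar>t\<bar> \<le> T" for x y t
  proof -
    have "norm (x t - y t) \<le> exp (K * \<bar>t\<bar>) * norm (x 0 - y 0)"
      by (rule integral_curve_dist[OF x y _ t])
        (intro K(2) integral_curve_in_cball[OF x] integral_curve_in_cball[OF y] in_ball)
    also have "\<dots> \<le> exp (K * T) * norm (x 0 - y 0)"
      using K(1) t by (intro mult_right_mono) auto
    finally show ?thesis .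
  qed
  then show ?thesis using that[of "exp (K * T)"] by simp
qed

lemma integral_curve_unique:
  assumes "\<And>t. (x has_vector_derivative X (x t)) (at t)"
    and "\<And>t. (y has_vector_derivative X (y t)) (at t)" and "x 0 = y 0"
  shows "x = y"
proof
  fix t
  show "x t = y t"
  proof (rule integral_curve_lipschitz[of "norm (x 0)" "\<bar>t\<bar>"])
    fix C assume "\<And>x' y' t'. (\<And>t. (x' has_vector_derivative X (x' t)) (at t)) \<Longrightarrow>
      (\<And>t. (y' has_vector_derivative X (y' t)) (at t)) \<Longrightarrow> x' 0 \<in> cball 0 (norm (x 0)) \<Longrightarrow>
      y' 0 \<in> cball 0 (norm (x 0)) \<Longrightarrow> \<bar>t'\<bar> \<le> \<bar>t\<bar> \<Longrightarrow> norm (x' t' - y' t') \<le> C * norm (x' 0 - y' 0)"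
    from this[OF assms(1,2)] show ?thesis using assms(3) by simp
  qed
qed

text \<open>Picard iteration. The weight \<open>exp (2 K |t|)\<close> makes it a contraction by \<open>1/2\<close>.\<close>

lemma integral_curve_exists:
  "\<exists>z. z 0 = z0 \<and> (\<forall>t. (z has_vector_derivative X (z t)) (at t))"
proof -
  have "\<exists>F. F 0 = z0 \<and> (\<forall>t. (F has_vector_derivative X (\<phi> t)) (at t))"
    if "continuous_on UNIV \<phi>" for \<phi>
  proof -
    have "continuous_on UNIV (\<lambda>t. X (\<phi> t))"
      by (rule continuous_on_compose2[OF X_continuous[of UNIV] that]) simp
    then obtain F where F: "F 0 = 0" "\<And>t. (F has_vector_derivative X (\<phi> t)) (at t)"
      using antiderivative_exists by blast
    have "((\<lambda>t. z0 + F t) has_vector_derivative X (\<phi> t)) (at t)" for t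
      using F(2) by (auto intro!: derivative_eq_intros)
    then show ?thesis using F(1) by (intro exI[of _ "\<lambda>t. z0 + F t"]) auto
  qed
  then obtain step where step: "\<And>\<phi>. continuous_on UNIV \<phi> \<Longrightarrow> step \<phi> 0 = z0"
    "\<And>\<phi> t. continuous_on UNIV \<phi> \<Longrightarrow> (step \<phi> has_vector_derivative X (\<phi> t)) (at t)"
    by metis
  define ph where "ph n = (step ^^ n) (\<lambda>_. z0)" for n
  have cont: "continuous_on UNIV (ph n)" for n
  proof (induction n)
    case (Suc n)
    then have "(ph (Suc n) has_vector_derivative X (ph n t)) (at t)" for t
      using step(2) by (simp add: ph_def)
    then show ?case by (meson continuous_at_imp_continuous_on has_vector_derivative_continuous)
  qed (simp add: ph_def)
  have ph0: "ph n 0 = z0" for n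
    using step(1)[OF cont] by (cases n) (auto simp: ph_def)
  have ph': "(ph (Suc n) has_vector_derivative X (ph n t)) (at t)" for n t
    using step(2)[OF cont] by (simp add: ph_def)
  have ph_bound: "norm (ph n t - z0) \<le> M * \<bar>t\<bar>" for n t
  proof (cases n)
    case 0
    then show ?thesis using M_nonneg by (simp add: ph_def)
  next
    case (Suc m)
    then show ?thesis using vector_derivative_bound_const[OF ph' X_bound, of m t] ph0 by simp
  qed
  \<comment> \<open>The Lipschitz constant depends on how far the iterates can travel, so the limit
    is first studied on each bounded time interval separately.\<close>
  have local: "\<exists>z. (\<forall>t\<in>{-T<..<T}. (\<lambda>n. ph n t) \<longlonglongrightarrow> z t \<and> (z has_vector_derivative X (z t)) (at t))"
    if T: "T > 0" for T
  proof -
    define R where "R = norm z0 + M * T"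
    obtain K where K: "1 \<le> K" "\<And>x y. x \<in> cball 0 R \<Longrightarrow> y \<in> cball 0 R \<Longrightarrow> norm (X x - X y) \<le> K * norm (x - y)"
      using X_lipschitz[of R] by metis
    have inR: "ph n t \<in> cball 0 R" if "\<bar>t\<bar> \<le> T" for n t
    proof -
      have "norm (ph n t) \<le> norm z0 + norm (ph n t - z0)" by (rule norm_triangle_sub)
      also have "\<dots> \<le> norm z0 + M * T"
        using ph_bound[of n t] mult_left_mono[OF that M_nonneg] by linarith
      finally show ?thesis by (simp add: R_def)
    qed
    define A where "A = M * T"
    have A: "0 \<le> A" using M_nonneg T by (simp add: A_def)
    have diff: "norm (ph (Suc n) t - ph n t) \<le> A * (1/2) ^ n * exp (2 * K * \<bar>t\<bar>)" if "\<bar>t\<bar> \<le> T" for n t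
      using that
    proof (induction n arbitrary: t)
      case 0
      have "norm (ph (Suc 0) t - ph 0 t) \<le> M * \<bar>t\<bar>" using ph_bound[of "Suc 0" t] by (simp add: ph_def)
      also have "\<dots> \<le> A * 1" unfolding A_def using 0 M_nonneg by (simp add: mult_left_mono)
      also have "\<dots> \<le> A * exp (2 * K * \<bar>t\<bar>)" using A K by (intro mult_left_mono) auto
      finally show ?case by simp
    next
      case (Suc n)
      \<comment> \<open>\<open>\<phi>\<close> is a primitive of \<open>K\<close> times the previous
        bound: integrating \<open>exp (2 * K * s)\<close> contributes \<open>1 / (2 * K)\<close>,
        which leaves the factor \<open>1/2\<close>.\<close>
      define \<phi> where "\<phi> s = A * (1/2) ^ Suc n * exp (2 * K * s)" for s
      have "norm ((ph (Suc (Suc n)) t - ph (Suc n) t) - (ph (Suc (Suc n)) 0 - ph (Suc n) 0)) \<le> \<phi> \<bar>t\<bar> - \<phi> 0"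
      proof (rule vector_derivative_bound_abs[OF _ _ _ Suc.prems])
        show "((\<lambda>t. ph (Suc (Suc n)) t - ph (Suc n) t) has_vector_derivative X (ph (Suc n) s) - X (ph n s)) (at s)" for s
          by (intro derivative_intros ph')
        show "(\<phi> has_real_derivative K * (A * (1/2) ^ n * exp (2 * K * s))) (at s)" for s
          unfolding \<phi>_def by (auto intro!: derivative_eq_intros)
        show "norm (X (ph (Suc n) s) - X (ph n s)) \<le> K * (A * (1/2) ^ n * exp (2 * K * \<bar>s\<bar>))" if "\<bar>s\<bar> \<le> T" for s
          using K(2)[OF inR inR, OF that that, of "Suc n" n] mult_left_mono[OF Suc.IH[OF that], of K] K(1)
          by linarith
      qed
      moreover have "0 \<le> \<phi> 0" using A by (simp add: \<phi>_def)
      ultimately show ?case by (simp add: ph0 \<phi>_def)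
    qed
    define A' where "A' = A * exp (2 * K * T)"
    have A': "0 \<le> A'" using A by (simp add: A'_def)
    have diff': "norm (ph (Suc n) t - ph n t) \<le> A' * (1/2) ^ n" if "\<bar>t\<bar> \<le> T" for n t
    proof -
      have "A * (1/2) ^ n * exp (2 * K * \<bar>t\<bar>) \<le> A * (1/2) ^ n * exp (2 * K * T)"
        using A K that by (intro mult_left_mono) auto
      then show ?thesis using diff[OF that, of n] by (simp add: A'_def mult_ac)
    qed
    \<comment> \<open>The right-hand side is exactly the partial sum of the geometric series;
      keeping the subtracted tail makes the induction on \<open>k\<close> close.\<close>
    have far: "norm (ph (n + k) t - ph n t) \<le> 2 * A' * (1/2) ^ n - 2 * A' * (1/2) ^ (n + k)"
      if "\<bar>t\<bar> \<le> T" for n k t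
    proof (induction k)
      case (Suc k)
      have "norm (ph (n + Suc k) t - ph n t) \<le>
          norm (ph (Suc (n + k)) t - ph (n + k) t) + norm (ph (n + k) t - ph n t)"
        using norm_triangle_ineq[of "ph (Suc (n + k)) t - ph (n + k) t" "ph (n + k) t - ph n t"] by simp
      then show ?case using Suc diff'[OF that, of "n + k"] by simp
    qed simp
    have far': "norm (ph (n + k) t - ph n t) \<le> 2 * A' * (1/2) ^ n" if "\<bar>t\<bar> \<le> T" for n k t
    proof -
      have "0 \<le> 2 * A' * (1/2) ^ (n + k)" using A' by simp
      then show ?thesis using far[OF that, of n k] by linarith
    qed
    have small: "\<forall>\<^sub>F n in sequentially. C * (1/2) ^ n < e" if "e > 0" for e C :: real
    proof -
      have "(\<lambda>n. C * (1/2) ^ n) \<longlonglongrightarrow> C * 0" by (intro tendsto_intros LIMSEQ_power_zero) auto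
      then show ?thesis using order_tendstoD(2)[of _ "C * 0" sequentially e] that by simp
    qed
    have "Cauchy (\<lambda>n. ph n t)" if t: "\<bar>t\<bar> \<le> T" for t
    proof (rule metric_CauchyI)
      fix e :: real assume "e > 0"
      then obtain N where N: "4 * A' * (1/2) ^ N < e"
        using small[of e "4 * A'"] by (auto simp: eventually_sequentially)
      have "dist (ph m t) (ph N t) \<le> 2 * A' * (1/2) ^ N" if "N \<le> m" for m
        using far'[OF t, of N "m - N"] that by (simp add: dist_norm)
      note near = this
      have "dist (ph m t) (ph n t) < e" if "N \<le> m" "N \<le> n" for m n
        using near[OF that(1)] near[OF that(2)] N dist_triangle2[of "ph m t" "ph n t" "ph N t"] by linarith
      then show "\<exists>N. \<forall>m\<ge>N. \<forall>n\<ge>N. dist (ph m t) (ph n t) < e" by blast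
    qed
    then have conv: "convergent (\<lambda>n. ph n t)" if "\<bar>t\<bar> \<le> T" for t
      using that by (simp add: Cauchy_convergent_iff)
    define z where "z t = lim (\<lambda>n. ph n t)" for t
    have lim: "(\<lambda>n. ph n t) \<longlonglongrightarrow> z t" if "\<bar>t\<bar> \<le> T" for t
      using conv[OF that] by (simp add: z_def convergent_LIMSEQ_iff)
    have zR: "z t \<in> cball 0 R" if "\<bar>t\<bar> \<le> T" for t
      using closed_sequentially[OF closed_cball _ lim[OF that]] inR[OF that] by blast
    have zph: "norm (ph n t - z t) \<le> 2 * A' * (1/2) ^ n" if "\<bar>t\<bar> \<le> T" for n t
    proof -
      have "(\<lambda>k. norm (ph n t - ph (n + k) t)) \<longlonglongrightarrow> norm (ph n t - z t)"
        using LIMSEQ_ignore_initial_segment[OF lim[OF that], of n]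
        by (intro tendsto_intros) (simp add: add.commute)
      then show ?thesis
        by (rule LIMSEQ_le_const2) (use far'[OF that] norm_minus_commute in metis)
    qed
    \<comment> \<open>The derivatives \<open>X (ph n x)\<close> converge uniformly to
      \<open>X (z x)\<close>, because \<open>X\<close> is Lipschitz on a ball that holds all
      iterates and the limit. The sequence is shifted by one since the derivative of an iterate
      involves its predecessor.\<close>
    have "\<exists>g. \<forall>x\<in>{-T<..<T}. (\<lambda>n. ph (Suc n) x) \<longlonglongrightarrow> g x \<and>
        (g has_derivative (\<lambda>h. h *\<^sub>R X (z x))) (at x within {-T<..<T})"
    proof (rule has_derivative_sequence[of _ _ "\<lambda>n x h. h *\<^sub>R X (ph n x)" _ 0 z0])
      show "(ph (Suc n) has_derivative (\<lambda>h. h *\<^sub>R X (ph n x))) (at x within {-T<..<T})" for n x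
        using has_derivative_at_withinI[OF ph'[of n x, unfolded has_vector_derivative_def]] .
      fix e :: real assume "e > 0"
      have "\<forall>\<^sub>F n in sequentially. (K * (2 * A')) * (1/2) ^ n < e" by (rule small) fact
      then show "\<forall>\<^sub>F n in sequentially. \<forall>x\<in>{-T<..<T}. \<forall>h. norm (h *\<^sub>R X (ph n x) - h *\<^sub>R X (z x)) \<le> e * norm h"
      proof (rule eventually_mono, intro ballI allI)
        fix n x h assume n: "(K * (2 * A')) * (1/2) ^ n < e" and "x \<in> {-T<..<T}"
        then have x: "\<bar>x\<bar> \<le> T" by auto
        have "norm (X (ph n x) - X (z x)) \<le> K * norm (ph n x - z x)"
          using K(2)[OF inR[OF x] zR[OF x]] .
        also have "\<dots> \<le> K * (2 * A' * (1/2) ^ n)" using zph[OF x] K(1) by (intro mult_left_mono) auto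
        also have "\<dots> \<le> e" using n by (simp add: mult_ac)
        finally show "norm (h *\<^sub>R X (ph n x) - h *\<^sub>R X (z x)) \<le> e * norm h"
          by (metis abs_ge_zero mult.commute mult_left_mono norm_scaleR real_norm_def scaleR_diff_right)
      qed
    next
      show "convex {-T<..<T}" by simp
      show "0 \<in> {-T<..<T}" using T by simp
      show "(\<lambda>n. ph (Suc n) 0) \<longlonglongrightarrow> z0" by (simp add: ph0)
    qed
    then obtain g where g: "\<And>x. x \<in> {-T<..<T} \<Longrightarrow> (\<lambda>n. ph (Suc n) x) \<longlonglongrightarrow> g x"
      "\<And>x. x \<in> {-T<..<T} \<Longrightarrow> (g has_derivative (\<lambda>h. h *\<^sub>R X (z x))) (at x within {-T<..<T})"
      by blast
    have gz: "g x = z x" if x: "x \<in> {-T<..<T}" for x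
    proof (rule LIMSEQ_unique[OF g(1)[OF x]])
      show "(\<lambda>n. ph (Suc n) x) \<longlonglongrightarrow> z x" using lim[of x] x by (intro LIMSEQ_Suc) auto
    qed
    have "(g has_vector_derivative X (g x)) (at x)" if x: "x \<in> {-T<..<T}" for x
      using g(2)[OF x] gz[OF x] x by (simp add: has_vector_derivative_def at_within_open[OF x])
    moreover have "(\<lambda>n. ph n x) \<longlonglongrightarrow> g x" if "x \<in> {-T<..<T}" for x
      using g(1)[OF that] by (rule LIMSEQ_imp_Suc)
    ultimately show ?thesis by blast
  qed
  \<comment> \<open>The limits do not depend on \<open>T\<close>, so all local solutions are
    restrictions of this one function.\<close>
  define z where "z t = lim (\<lambda>n. ph n t)" for t
  have "(z has_vector_derivative X (z t)) (at t)" for t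
  proof -
    define T where "T = \<bar>t\<bar> + 1"
    obtain y where y: "\<And>s. s \<in> {-T<..<T} \<Longrightarrow> (\<lambda>n. ph n s) \<longlonglongrightarrow> y s"
      "\<And>s. s \<in> {-T<..<T} \<Longrightarrow> (y has_vector_derivative X (y s)) (at s)"
      using local[of T] unfolding T_def by (metis abs_ge_zero add_nonneg_pos zero_less_one)
    have yz: "y s = z s" if "s \<in> {-T<..<T}" for s
      using y(1)[OF that] by (simp add: z_def limI)
    have t: "t \<in> {-T<..<T}" by (auto simp: T_def)
    show ?thesis
      using has_vector_derivative_transform_within_open[OF y(2)[OF t] open_greaterThanLessThan t yz] yz[OF t]
      by simp
  qed
  moreover have "z 0 = z0" by (simp add: z_def ph0)
  ultimately show ?thesis by blast
qed

section \<open>The flow and its Lipschitz dependence on the initial state\<close>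

lemma flow_props: "flow X z0 0 = z0 \<and> (\<forall>t. (flow X z0 has_vector_derivative X (flow X z0 t)) (at t))"
proof -
  have "\<exists>!z. z 0 = z0 \<and> (\<forall>t. (z has_vector_derivative X (z t)) (at t))"
    using integral_curve_exists[of z0] integral_curve_unique by (auto intro!: ex_ex1I)
  from theI'[OF this] show ?thesis by (simp add: flow_def)
qed

lemma flow_0 [simp]: "flow X z 0 = z"
  and flow_deriv: "(flow X z has_vector_derivative X (flow X z t)) (at t)"
  using flow_props by auto

lemma flow_bound: "norm (flow X z t - z) \<le> M * \<bar>t\<bar>"
  using integral_curve_bound[OF flow_deriv, of z t] by simp

lemma flow_in_cball: "z \<in> cball 0 R \<Longrightarrow> \<bar>t\<bar> \<le> T \<Longrightarrow> flow X z t \<in> cball 0 (R + M * T)"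
  using integral_curve_in_cball[OF flow_deriv, of z] by simp

lemma flow_lipschitz:
  obtains C where "0 \<le> C" "\<And>x y t. x \<in> cball 0 R \<Longrightarrow> y \<in> cball 0 R \<Longrightarrow> \<bar>t\<bar> \<le> T \<Longrightarrow>
    norm (flow X x t - flow X y t) \<le> C * norm (x - y)"
proof (rule integral_curve_lipschitz[of R T])
  fix C assume C: "0 \<le> C" and *: "\<And>x y t. (\<And>t. (x has_vector_derivative X (x t)) (at t)) \<Longrightarrow>
     (\<And>t. (y has_vector_derivative X (y t)) (at t)) \<Longrightarrow> x 0 \<in> cball 0 R \<Longrightarrow> y 0 \<in> cball 0 R \<Longrightarrow>
     \<bar>t\<bar> \<le> T \<Longrightarrow> norm (x t - y t) \<le> C * norm (x 0 - y 0)"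
  show thesis
    by (rule that[OF C]) (use *[OF flow_deriv flow_deriv] in simp)
qed

lemma flow_continuous: "continuous_on S (flow X z)"
  using flow_deriv by (meson continuous_at_imp_continuous_on has_vector_derivative_continuous)

lemma flow_lie:
  assumes "Ck (Suc k) G"
  shows "((\<lambda>t. G (flow X z t)) has_vector_derivative lie X G (flow X z t)) (at t)"
  using vector_derivative_diff_chain_within[of "flow X z" "X (flow X z t)" t UNIV G
      "frechet_derivative G (at (flow X z t))"] flow_deriv Ck_Suc_has_derivative[OF assms]
  by (auto simp: o_def lie_def intro: has_derivative_at_withinI)

text \<open>This turns the coefficients of the Taylor method, defined through the flow, into
  explicit functions of the state whose smoothness is known.\<close>

lemma time_deriv_eq_lie:
  assumes "Ck (Suc k) X"
  shows "time_deriv X k z = (lie X ^^ k) X z"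
proof -
  \<comment> \<open>The identity is carried as one between functions of \<open>t\<close>; its value
    at \<open>0\<close> alone could not be differentiated again.\<close>
  have "((\<lambda>g t. vector_derivative g (at t)) ^^ j) (\<lambda>t. X (flow X z t)) = (\<lambda>t. (lie X ^^ j) X (flow X z t))"
    if "j \<le> k" for j
    using that
  proof (induction j)
    case (Suc j)
    have "Ck (Suc 0) ((lie X ^^ j) X)"
      using Suc.prems assms by (intro Ck_lie_funpow) (auto intro: Ck_mono simp del: Ck.simps)
    from flow_lie[OF this] show ?case using Suc by (auto intro!: ext vector_derivative_at)
  qed simp
  then show ?thesis by (simp add: time_deriv_def)
qed

section \<open>Taylor remainder along the flow\<close>

text \<open>The sum has \<open>N\<close> terms, hence degree below \<open>N\<close> and a remainder
  of order \<open>N\<close>. With the identity for \<open>G\<close> and \<open>Suc \<rho>\<close>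
  terms this is the error of the Taylor method of order \<open>\<rho>\<close>.\<close>

definition flow_remainder :: "('a \<Rightarrow> 'b::real_normed_vector) \<Rightarrow> nat \<Rightarrow> real \<Rightarrow> 'a \<Rightarrow> 'b" where
  "flow_remainder G N t z = G (flow X z t) - (\<Sum>j<N. (t ^ j / fact j) *\<^sub>R (lie X ^^ j) G z)"

lemma flow_remainder_Suc_zero: "flow_remainder G (Suc N) 0 z = 0"
  by (simp add: flow_remainder_def lessThan_Suc_eq_insert_0 sum.reindex zero_power)

text \<open>Differentiation in time shifts the expansion: the constant term drops out, and every
  other coefficient becomes one of \<open>lie X G\<close>, one degree lower. This is the recursion
  behind \<open>flow_remainder_bound\<close>.\<close>

lemma flow_remainder_deriv:
  assumes "Ck (Suc k) G"
  shows "((\<lambda>t. flow_remainder G (Suc N) t z) has_vector_derivative flow_remainder (lie X G) N t z) (at t)"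
proof -
  have split: "flow_remainder G (Suc N) t z = G (flow X z t) - G z -
      (\<Sum>j<N. (t ^ Suc j / fact (Suc j)) *\<^sub>R (lie X ^^ j) (lie X G) z)" for t
    unfolding flow_remainder_def sum.lessThan_Suc_shift by (simp add: funpow_swap1 del: fact_Suc)
  have "((\<lambda>t. (t ^ Suc j / fact (Suc j)) *\<^sub>R (lie X ^^ j) (lie X G) z) has_vector_derivative
      (t ^ j / fact j) *\<^sub>R (lie X ^^ j) (lie X G) z) (at t)" for j
  proof -
    have "((\<lambda>t. t ^ Suc j / fact (Suc j)) has_real_derivative real (Suc j) * t ^ j / fact (Suc j)) (at t)"
      by (rule DERIV_cdivide) (use DERIV_pow[of "Suc j" t] in \<open>simp del: power_Suc\<close>)
    moreover have "real (Suc j) * t ^ j / fact (Suc j) = t ^ j / fact j" by simp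
    ultimately have "((\<lambda>t. t ^ Suc j / fact (Suc j)) has_real_derivative t ^ j / fact j) (at t)"
      by metis
    from has_vector_derivative_scaleR[OF this has_vector_derivative_const[of "(lie X ^^ j) (lie X G) z"]]
    show ?thesis by simp
  qed
  then have "((\<lambda>t. flow_remainder G (Suc N) t z) has_vector_derivative lie X G (flow X z t) - 0 -
      (\<Sum>j<N. (t ^ j / fact j) *\<^sub>R (lie X ^^ j) (lie X G) z)) (at t)"
    unfolding split
    by (intro has_vector_derivative_diff has_vector_derivative_const has_vector_derivative_sum flow_lie[OF assms])
  then show ?thesis by (simp add: flow_remainder_def)
qed

text \<open>Each integration in time adds one power of \<open>t\<close>. The difference of the
  remainders at two initial states obeys the same recursion, so its Lipschitz constant gains the
  same powers, starting from the Lipschitz constants of \<open>G\<close> and of the flow. After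
  \<open>N\<close> Lie derivatives one derivative must be left for this start, hence
  \<open>N + 1\<close>.\<close>

lemma flow_remainder_bound:
  assumes "Ck (N + 1) G" "Ck (N + 1) X" "0 \<le> T"
  shows "\<exists>C\<ge>0. \<forall>t x y. \<bar>t\<bar> \<le> T \<longrightarrow> x \<in> cball 0 R \<longrightarrow> y \<in> cball 0 R \<longrightarrow>
      norm (flow_remainder G N t x) \<le> C * \<bar>t\<bar> ^ N \<and> norm (flow_remainder G N t x - flow_remainder G N t y) \<le> C * \<bar>t\<bar> ^ N * norm (x - y)"
  using assms(1,2)
proof (induction N arbitrary: G)
  case 0
  define R' where "R' = R + M * T"
  obtain B where B: "0 \<le> B" "\<And>x. x \<in> cball 0 R' \<Longrightarrow> norm (G x) \<le> B"
    "\<And>x y. x \<in> cball 0 R' \<Longrightarrow> y \<in> cball 0 R' \<Longrightarrow> norm (G x - G y) \<le> B * norm (x - y)"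
    using Ck_1_bounds[of G 0 R'] 0 by (auto simp del: Ck.simps)
  obtain C where C: "0 \<le> C" "\<And>x y t. x \<in> cball 0 R \<Longrightarrow> y \<in> cball 0 R \<Longrightarrow> \<bar>t\<bar> \<le> T \<Longrightarrow>
      norm (flow X x t - flow X y t) \<le> C * norm (x - y)"
    using flow_lipschitz by blast
  have "norm (flow_remainder G 0 t x) \<le> (B + B * C) * \<bar>t\<bar> ^ 0 \<and>
      norm (flow_remainder G 0 t x - flow_remainder G 0 t y) \<le> (B + B * C) * \<bar>t\<bar> ^ 0 * norm (x - y)"
    if t: "\<bar>t\<bar> \<le> T" and x: "x \<in> cball 0 R" and y: "y \<in> cball 0 R" for t x y
  proof -
    note in' = flow_in_cball[OF x t, folded R'_def] flow_in_cball[OF y t, folded R'_def]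
    have "norm (G (flow X x t) - G (flow X y t)) \<le> B * norm (flow X x t - flow X y t)"
      by (rule B(3)[OF in'])
    also have "\<dots> \<le> B * (C * norm (x - y))" by (intro mult_left_mono C B t x y)
    also have "\<dots> \<le> (B + B * C) * norm (x - y)" using B by (simp add: algebra_simps)
    finally show ?thesis using B(2)[OF in'(1)] mult_nonneg_nonneg[OF B(1) C(1)] by (simp add: flow_remainder_def)
  qed
  then show ?case using B C by (intro exI[of _ "B + B * C"]) auto
next
  case (Suc N)
  have "Ck (N + 1) (lie X G)" "Ck (N + 1) X"
    using Suc.prems Ck_mono[OF Suc.prems(2), of "N + 1"] by (auto intro!: Ck_lie simp del: Ck.simps)
  from Suc.IH[OF this] obtain C where C: "0 \<le> C" "\<And>t x y. \<bar>t\<bar> \<le> T \<Longrightarrow> x \<in> cball 0 R \<Longrightarrow> y \<in> cball 0 R \<Longrightarrow>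
      norm (flow_remainder (lie X G) N t x) \<le> C * \<bar>t\<bar> ^ N \<and>
      norm (flow_remainder (lie X G) N t x - flow_remainder (lie X G) N t y) \<le> C * \<bar>t\<bar> ^ N * norm (x - y)"
    by blast
  have G: "Ck (Suc (N + 1)) G" using Suc.prems(1) by simp
  have pow: "C * \<bar>\<tau>\<bar> ^ N \<le> C * \<bar>t\<bar> ^ N" if "\<bar>\<tau>\<bar> \<le> \<bar>t\<bar>" for \<tau> t :: real
    using that C(1) by (intro mult_left_mono power_mono) auto
  have "norm (flow_remainder G (Suc N) t x) \<le> C * \<bar>t\<bar> ^ Suc N \<and>
      norm (flow_remainder G (Suc N) t x - flow_remainder G (Suc N) t y) \<le> C * \<bar>t\<bar> ^ Suc N * norm (x - y)"
    if t: "\<bar>t\<bar> \<le> T" and x: "x \<in> cball 0 R" and y: "y \<in> cball 0 R" for t x y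
  proof
    have "norm (flow_remainder G (Suc N) t x - flow_remainder G (Suc N) 0 x) \<le> C * \<bar>t\<bar> ^ N * \<bar>t\<bar>"
    proof (rule vector_derivative_bound_const[OF flow_remainder_deriv[OF G]])
      show "norm (flow_remainder (lie X G) N \<tau> x) \<le> C * \<bar>t\<bar> ^ N" if "\<bar>\<tau>\<bar> \<le> \<bar>t\<bar>" for \<tau>
        using C(2)[of \<tau> x x] x t that pow[OF that] by linarith
    qed
    then show "norm (flow_remainder G (Suc N) t x) \<le> C * \<bar>t\<bar> ^ Suc N" by (simp add: flow_remainder_Suc_zero mult_ac)
    have "norm ((flow_remainder G (Suc N) t x - flow_remainder G (Suc N) t y) - (flow_remainder G (Suc N) 0 x - flow_remainder G (Suc N) 0 y))
        \<le> C * \<bar>t\<bar> ^ N * norm (x - y) * \<bar>t\<bar>"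
    proof (rule vector_derivative_bound_const)
      show "((\<lambda>t. flow_remainder G (Suc N) t x - flow_remainder G (Suc N) t y) has_vector_derivative
          flow_remainder (lie X G) N \<tau> x - flow_remainder (lie X G) N \<tau> y) (at \<tau>)" for \<tau>
        by (intro derivative_intros flow_remainder_deriv[OF G])
      show "norm (flow_remainder (lie X G) N \<tau> x - flow_remainder (lie X G) N \<tau> y) \<le> C * \<bar>t\<bar> ^ N * norm (x - y)"
        if "\<bar>\<tau>\<bar> \<le> \<bar>t\<bar>" for \<tau>
        using C(2)[of \<tau> x y] x y t that mult_right_mono[OF pow[OF that], of "norm (x - y)"]
        by simp
    qed
    then show "norm (flow_remainder G (Suc N) t x - flow_remainder G (Suc N) t y) \<le> C * \<bar>t\<bar> ^ Suc N * norm (x - y)"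
      by (simp add: flow_remainder_Suc_zero mult_ac)
  qed
  then show ?case using C(1) by blast
qed

lemma flow_remainder_continuous:
  assumes "continuous_on UNIV G"
  shows "continuous_on S (\<lambda>t. flow_remainder G N t z)"
proof -
  have "continuous_on S (\<lambda>t. G (flow X z t))"
    by (rule continuous_on_compose2[OF assms flow_continuous]) simp
  moreover have "continuous_on S (\<lambda>t. \<Sum>j<N. (t ^ j / fact j) *\<^sub>R (lie X ^^ j) G z)"
    by (intro continuous_on_sum continuous_on_scaleR continuous_on_divide continuous_on_power
        continuous_on_id continuous_on_const) simp
  ultimately show ?thesis unfolding flow_remainder_def by (rule continuous_on_diff)
qed

end

section \<open>Families of maps depending on the step size\<close>

text \<open>The constant is uniform in \<open>h\<close> but may depend on the ball, and so may the
  range of step sizes.\<close>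

definition fam_C11 :: "(real \<Rightarrow> 'a::real_normed_vector \<Rightarrow> 'b::real_normed_vector) \<Rightarrow> bool" where
  "fam_C11 f \<longleftrightarrow> (\<forall>R. \<exists>B. \<forall>\<^sub>F h in at_right 0. C11 B (ball 0 R) (f h))"

definition lip_bound :: "real \<Rightarrow> 'a::real_normed_vector set \<Rightarrow> ('a \<Rightarrow> 'b::real_normed_vector) \<Rightarrow> bool" where
  "lip_bound C S f \<longleftrightarrow> (\<forall>x\<in>S. norm (f x) \<le> C \<and> (\<forall>y\<in>S. norm (f x - f y) \<le> C * norm (x - y)))"

text \<open>This reads \<open>f = O(h ^ k)\<close> in the Lipschitz norm, locally uniformly. For
  \<open>k = 0\<close> it states boundedness and Lipschitz continuity uniformly in \<open>h\<close>,
  which is all that is available for families built from the flow.\<close>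

definition small_lip :: "nat \<Rightarrow> (real \<Rightarrow> 'a::real_normed_vector \<Rightarrow> 'b::real_normed_vector) \<Rightarrow> bool" where
  "small_lip k f \<longleftrightarrow> (\<forall>R. \<exists>C. \<forall>\<^sub>F h in at_right 0. lip_bound (C * h ^ k) (ball 0 R) (f h))"

lemma eventually_at_right_pos: "\<forall>\<^sub>F h in at_right 0. (0::real) < h"
  by (simp add: eventually_at_right_less)

lemma eventually_at_right_less_const: "0 < e \<Longrightarrow> \<forall>\<^sub>F h in at_right 0. h < (e::real)"
  by (rule eventually_at_rightI[of 0 e]) auto

lemma eventually_at_right_mult_less:
  assumes "0 < e" shows "\<forall>\<^sub>F h in at_right 0. h * B < (e::real)"
proof -
  have "\<forall>\<^sub>F h in at_right 0. h < e / (\<bar>B\<bar> + 1)"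
    using assms by (intro eventually_at_right_less_const) simp
  with eventually_at_right_pos show ?thesis
  proof eventually_elim
    case (elim h)
    note elim = elim[unfolded lip_bound_def]
    have "h * B \<le> h * (\<bar>B\<bar> + 1)" using elim by (intro mult_left_mono) auto
    also have "\<dots> < e" using elim by (simp add: pos_less_divide_eq)
    finally show ?case .
  qed
qed

lemma fam_C11E:
  assumes "fam_C11 f"
  obtains B where "1 \<le> B" "\<forall>\<^sub>F h in at_right 0. C11 B (ball 0 R) (f h)"
proof -
  obtain B where B: "\<forall>\<^sub>F h in at_right 0. C11 B (ball 0 R) (f h)"
    using assms unfolding fam_C11_def by blast
  then have "\<forall>\<^sub>F h in at_right 0. C11 (max 1 B) (ball 0 R) (f h)"
    by (rule eventually_mono) (auto intro: C11_mono)
  then show ?thesis using that[of "max 1 B"] by simp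
qed

lemma lip_bound_mono: "lip_bound C S f \<Longrightarrow> C \<le> C' \<Longrightarrow> lip_bound C' S f"
  unfolding lip_bound_def by (meson mult_right_mono norm_ge_zero order_trans)

lemma small_lipE:
  assumes "small_lip k f"
  obtains C where "1 \<le> C" "\<forall>\<^sub>F h in at_right 0. lip_bound (C * h ^ k) (ball 0 R) (f h)"
proof -
  obtain C where "\<forall>\<^sub>F h in at_right 0. lip_bound (C * h ^ k) (ball 0 R) (f h)"
    using assms unfolding small_lip_def by blast
  then have "\<forall>\<^sub>F h in at_right 0. lip_bound (max 1 C * h ^ k) (ball 0 R) (f h)"
    using eventually_at_right_pos by eventually_elim (erule lip_bound_mono, auto intro: mult_right_mono)
  then show ?thesis using that[of "max 1 C"] by simp
qed

lemma small_lipI: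
  assumes "\<And>R. 0 < R \<Longrightarrow> \<exists>C. \<forall>\<^sub>F h in at_right 0. lip_bound (C * h ^ k) (ball 0 R) (f h)"
  shows "small_lip k f"
  unfolding small_lip_def
proof
  fix R :: real
  show "\<exists>C. \<forall>\<^sub>F h in at_right 0. lip_bound (C * h ^ k) (ball 0 R) (f h)"
  proof (cases "0 < R")
    case False
    then have empty: "ball 0 R = ({} :: 'a set)" by simp
    show ?thesis unfolding empty lip_bound_def by simp
  qed (rule assms)
qed

lemma small_lip_cong:
  assumes "small_lip k f" "\<And>R. 0 < R \<Longrightarrow> \<forall>\<^sub>F h in at_right 0. \<forall>x\<in>ball 0 R. f h x = g h x"
  shows "small_lip k g"
proof (rule small_lipI, goal_cases)
  case R: (1 R)
  obtain C where C: "1 \<le> C" "\<forall>\<^sub>F h in at_right 0. lip_bound (C * h ^ k) (ball 0 R) (f h)"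
    by (rule small_lipE[where R = "R", OF assms(1)])
  have "\<forall>\<^sub>F h in at_right 0. lip_bound (C * h ^ k) (ball 0 R) (g h)"
    using C(2) assms(2)[OF R] by eventually_elim (simp add: lip_bound_def)
  then show ?case by (rule exI[of _ "C"])
qed

lemma C11_const: "norm c \<le> B \<Longrightarrow> C11 B S (\<lambda>_. c)"
  using order_trans[OF norm_ge_zero, of c B] unfolding C11_def
  by (auto intro!: exI[of _ "\<lambda>_ _. 0"] mult_nonneg_nonneg)

lemma C11_ident: "C11 (max R 1) (ball 0 R) (\<lambda>x. x)"
  unfolding C11_def
  by (auto intro!: exI[of _ "\<lambda>_ v. v"] mult_nonneg_nonneg simp: le_max_iff_disj mult_le_cancel_right1)

lemma fam_C11_ident: "fam_C11 (\<lambda>h x. x)"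
  unfolding fam_C11_def using C11_ident by (blast intro: always_eventually)

lemma fam_C11_Pair:
  assumes "fam_C11 f" "fam_C11 g" shows "fam_C11 (\<lambda>h x. (f h x, g h x))"
  unfolding fam_C11_def
proof
  fix R
  obtain A B where "\<forall>\<^sub>F h in at_right 0. C11 A (ball 0 R) (f h)" "\<forall>\<^sub>F h in at_right 0. C11 B (ball 0 R) (g h)"
    using assms unfolding fam_C11_def by meson
  then have "\<forall>\<^sub>F h in at_right 0. C11 (A + B) (ball 0 R) (\<lambda>x. (f h x, g h x))"
    by eventually_elim (rule C11_Pair)
  then show "\<exists>B. \<forall>\<^sub>F h in at_right 0. C11 B (ball 0 R) (\<lambda>x. (f h x, g h x))" ..
qed

lemma fam_C11_compose:
  assumes "fam_C11 f" "fam_C11 g" shows "fam_C11 (\<lambda>h x. f h (g h x))"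
  unfolding fam_C11_def
proof
  fix R
  obtain B where B: "1 \<le> B" "\<forall>\<^sub>F h in at_right 0. C11 B (ball 0 R) (g h)"
    by (rule fam_C11E[where R = "R", OF assms(2)])
  \<comment> \<open>The values of \<open>g h\<close> have norm at most \<open>B\<close>, so they lie
    in the open ball of radius \<open>B + 1\<close>.\<close>
  obtain A where A: "1 \<le> A" "\<forall>\<^sub>F h in at_right 0. C11 A (ball 0 (B + 1)) (f h)"
    by (rule fam_C11E[where R = "B + 1", OF assms(1)])
  have "\<forall>\<^sub>F h in at_right 0. C11 (A + A * B + A * B\<^sup>2) (ball 0 R) (\<lambda>x. f h (g h x))"
    using A(2) B(2)
  proof eventually_elim
    case (elim h)
    have "g h ` ball 0 R \<subseteq> ball 0 (B + 1)" using C11_bound[OF elim(2)] by fastforce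
    then show ?case using elim A(1) B(1) by (intro C11_compose) auto
  qed
  then show "\<exists>B. \<forall>\<^sub>F h in at_right 0. C11 B (ball 0 R) (\<lambda>x. f h (g h x))" ..
qed

text \<open>Joint smoothness in \<open>(h, x)\<close> is what makes the bounds uniform in
  \<open>h\<close>: for \<open>h < 1\<close> the pairs stay in one compact ball.\<close>

lemma fam_C11_of_Ck:
  fixes f :: "real \<times> 'a::euclidean_space \<Rightarrow> 'b::real_normed_vector"
  assumes "Ck 2 f" shows "fam_C11 (\<lambda>h x. f (h, x))"
proof (rule fam_C11_compose[where f = "\<lambda>_. f" and g = Pair])
  show "fam_C11 (\<lambda>_. f)"
    unfolding fam_C11_def
    using Ck_2_imp_C11[OF assms] C11_mono[OF _ order_refl ball_subset_cball] by (meson always_eventually)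
  have "\<forall>\<^sub>F h in at_right 0. C11 (1 + max R 1) (ball 0 R) (Pair (h :: real) :: 'a \<Rightarrow> _)" for R
    using eventually_at_right_pos eventually_at_right_less_const[OF zero_less_one]
    by eventually_elim (intro C11_Pair C11_ident C11_const, simp)
  then show "fam_C11 (Pair :: real \<Rightarrow> 'a \<Rightarrow> _)" unfolding fam_C11_def by blast
qed

lemma fam_C11_imp_small_lip: "fam_C11 f \<Longrightarrow> small_lip 0 f"
proof (rule small_lipI, goal_cases)
  case (1 R)
  then obtain B where "\<forall>\<^sub>F h in at_right 0. C11 B (ball 0 R) (f h)" unfolding fam_C11_def by blast
  then have "\<forall>\<^sub>F h in at_right 0. lip_bound (B * h ^ 0) (ball 0 R) (f h)"
  proof eventually_elim
    case (elim h)
    note elim = elim[unfolded lip_bound_def]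
    show ?case using C11_bound[OF elim] C11_lipschitz[OF elim convex_ball] by (simp add: lip_bound_def)
  qed
  then show ?case by (rule exI[of _ "B"])
qed

section \<open>Calculus of \<open>O(h ^ k)\<close> in the Lipschitz norm\<close>

lemma small_lip_mono:
  assumes "small_lip k f" "j \<le> k" shows "small_lip j f"
proof (rule small_lipI, goal_cases)
  case (1 R)
  obtain C where C: "1 \<le> C" "\<forall>\<^sub>F h in at_right 0. lip_bound (C * h ^ k) (ball 0 R) (f h)"
    by (rule small_lipE[where R = R, OF assms(1)])
  have "\<forall>\<^sub>F h in at_right 0. lip_bound (C * h ^ j) (ball 0 R) (f h)"
    using C(2) eventually_at_right_pos eventually_at_right_less_const[OF zero_less_one]
  proof eventually_elim
    case (elim h)
    from elim(1) show ?case
      by (rule lip_bound_mono) (use elim C(1) assms(2) in \<open>auto intro!: mult_left_mono power_decreasing\<close>)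
  qed
  then show ?case by (rule exI[of _ C])
qed

lemma small_lip_add:
  fixes f :: "real \<Rightarrow> 'a::real_normed_vector \<Rightarrow> 'b::real_normed_vector"
  assumes "small_lip k f" "small_lip k g" shows "small_lip k (\<lambda>h x. f h x + g h x)"
proof (rule small_lipI, goal_cases)
  case (1 R)
  obtain A where A: "1 \<le> A" "\<forall>\<^sub>F h in at_right 0. lip_bound (A * h ^ k) (ball 0 R) (f h)"
    by (rule small_lipE[where R = "R", OF assms(1)])
  obtain B where B: "1 \<le> B" "\<forall>\<^sub>F h in at_right 0. lip_bound (B * h ^ k) (ball 0 R) (g h)"
    by (rule small_lipE[where R = "R", OF assms(2)])
  have "\<forall>\<^sub>F h in at_right 0. lip_bound ((A + B) * h ^ k) (ball 0 R) (\<lambda>x. f h x + g h x)"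
    using A(2) B(2)
  proof eventually_elim
    case (elim h)
    note elim = elim[unfolded lip_bound_def]
    show ?case unfolding lip_bound_def
    proof (intro ballI conjI)
      fix x y :: 'a assume x: "x \<in> ball 0 R" and y: "y \<in> ball 0 R"
      show "norm (f h x + g h x) \<le> (A + B) * h ^ k"
        using elim x norm_triangle_ineq[of "f h x" "g h x"] by (force simp: distrib_right)
      have "norm (f h x + g h x - (f h y + g h y)) \<le> norm (f h x - f h y) + norm (g h x - g h y)"
        by (rule norm_diff_triangle_ineq)
      also have "\<dots> \<le> A * h ^ k * norm (x - y) + B * h ^ k * norm (x - y)"
        using elim x y by (intro add_mono) blast+
      finally show "norm (f h x + g h x - (f h y + g h y)) \<le> (A + B) * h ^ k * norm (x - y)"
        by (simp add: distrib_right)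
    qed
  qed
  then show ?case by (rule exI[of _ "A + B"])
qed

lemma small_lip_bounded_linear:
  fixes f :: "real \<Rightarrow> 'a::real_normed_vector \<Rightarrow> 'b::real_normed_vector"
  assumes "bounded_linear g" "small_lip k f" shows "small_lip k (\<lambda>h x. g (f h x))"
proof (rule small_lipI, goal_cases)
  case (1 R)
  interpret g: bounded_linear g by fact
  obtain K where K: "0 \<le> K" "\<And>x. norm (g x) \<le> norm x * K" using g.nonneg_bounded by blast
  obtain A where A: "1 \<le> A" "\<forall>\<^sub>F h in at_right 0. lip_bound (A * h ^ k) (ball 0 R) (f h)"
    by (rule small_lipE[where R = "R", OF assms(2)])
  have "\<forall>\<^sub>F h in at_right 0. lip_bound ((A * K) * h ^ k) (ball 0 R) (\<lambda>x. g (f h x))"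
    using A(2)
  proof eventually_elim
    case (elim h)
    note elim = elim[unfolded lip_bound_def]
    have le: "norm (g u) \<le> b * K" if "norm u \<le> b" for u b
      using K(2)[of u] mult_right_mono[OF that K(1)] by linarith
    show ?case unfolding lip_bound_def
    proof (intro ballI conjI)
      fix x y :: 'a assume x: "x \<in> ball 0 R" and y: "y \<in> ball 0 R"
      show "norm (g (f h x)) \<le> (A * K) * h ^ k"
        using le[of "f h x" "A * h ^ k"] elim x by (simp add: mult_ac)
      show "norm (g (f h x) - g (f h y)) \<le> (A * K) * h ^ k * norm (x - y)"
        using le[of "f h x - f h y" "A * h ^ k * norm (x - y)"] elim x y by (simp add: mult_ac g.diff)
    qed
  qed
  then show ?case by (rule exI[of _ "A * K"])
qed

lemma small_lip_uminus: "small_lip k f \<Longrightarrow> small_lip k (\<lambda>h x. - f h x)"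
  by (rule small_lip_bounded_linear[OF bounded_linear_minus[OF bounded_linear_ident]])

lemma small_lip_diff: "small_lip k f \<Longrightarrow> small_lip k g \<Longrightarrow> small_lip k (\<lambda>h x. f h x - g h x)"
  using small_lip_add[of k f "\<lambda>h x. - g h x"] by (simp add: small_lip_uminus)

lemma small_lip_zero: "small_lip k (\<lambda>h x. 0)"
  by (rule small_lipI) (auto intro!: exI[of _ 0] simp: lip_bound_def)

lemma small_lip_sum: "(\<And>i. i \<in> I \<Longrightarrow> small_lip k (f i)) \<Longrightarrow> small_lip k (\<lambda>h x. \<Sum>i\<in>I. f i h x)"
  by (induction I rule: infinite_finite_induct) (simp_all add: small_lip_zero small_lip_add)

lemma small_lip_scale_inverse:
  fixes f :: "real \<Rightarrow> 'a::real_normed_vector \<Rightarrow> 'b::real_normed_vector"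
  assumes "small_lip (Suc k) f" shows "small_lip k (\<lambda>h x. (1 / h) *\<^sub>R f h x)"
proof (rule small_lipI, goal_cases)
  case (1 R)
  obtain A where A: "1 \<le> A" "\<forall>\<^sub>F h in at_right 0. lip_bound (A * h ^ Suc k) (ball 0 R) (f h)"
    by (rule small_lipE[where R = "R", OF assms])
  have "\<forall>\<^sub>F h in at_right 0. lip_bound (A * h ^ k) (ball 0 R) (\<lambda>x. (1 / h) *\<^sub>R f h x)"
    using A(2) eventually_at_right_pos
  proof eventually_elim
    case (elim h)
    note elim = elim[unfolded lip_bound_def]
    have le: "norm ((1 / h) *\<^sub>R u) \<le> A * h ^ k * t" if "norm u \<le> A * h ^ Suc k * t" for u :: 'b and t
      using that elim(2) by (simp add: divide_le_eq mult_ac)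
    show ?case unfolding lip_bound_def
    proof (intro ballI conjI)
      fix x y :: 'a assume x: "x \<in> ball 0 R" and y: "y \<in> ball 0 R"
      show "norm ((1 / h) *\<^sub>R f h x) \<le> A * h ^ k"
        using le[of "f h x" 1] elim x by simp
      show "norm ((1 / h) *\<^sub>R f h x - (1 / h) *\<^sub>R f h y) \<le> A * h ^ k * norm (x - y)"
        using le[of "f h x - f h y" "norm (x - y)"] elim x y by (simp only: scaleR_diff_right)
    qed
  qed
  then show ?case by (rule exI[of _ "A"])
qed

lemma small_lip_scale:
  assumes "small_lip k f" shows "small_lip (Suc k) (\<lambda>h x. h *\<^sub>R f h x)"
proof (rule small_lipI, goal_cases)
  case (1 R)
  obtain A where A: "1 \<le> A" "\<forall>\<^sub>F h in at_right 0. lip_bound (A * h ^ k) (ball 0 R) (f h)"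
    by (rule small_lipE[where R = R, OF assms])
  have "\<forall>\<^sub>F h in at_right 0. lip_bound (A * h ^ Suc k) (ball 0 R) (\<lambda>x. h *\<^sub>R f h x)"
    using A(2) eventually_at_right_pos
  proof eventually_elim
    case (elim h)
    note elim = elim[unfolded lip_bound_def]
    have le: "norm (h *\<^sub>R u) \<le> A * h ^ Suc k * t" if "norm u \<le> A * h ^ k * t" for u :: 'b and t
      using mult_left_mono[OF that, of h] elim(2) by (simp add: mult_ac)
    have "norm (h *\<^sub>R f h x) \<le> A * h ^ Suc k" if "x \<in> ball 0 R" for x
      using le[of "f h x" 1] elim that by simp
    moreover have "norm (h *\<^sub>R f h x - h *\<^sub>R f h y) \<le> A * h ^ Suc k * norm (x - y)"
      if "x \<in> ball 0 R" "y \<in> ball 0 R" for x y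
      unfolding scaleR_diff_right[symmetric] using elim that by (intro le) blast
    ultimately show ?case unfolding lip_bound_def by blast
  qed
  then show ?case by (rule exI[of _ A])
qed

lemma small_lip_compose:
  fixes g :: "real \<Rightarrow> 'a::real_normed_vector \<Rightarrow> 'b::real_normed_vector"
  assumes "small_lip k f" "small_lip 0 g" shows "small_lip k (\<lambda>h x. f h (g h x))"
proof (rule small_lipI, goal_cases)
  case (1 R)
  obtain B where B: "1 \<le> B" "\<forall>\<^sub>F h in at_right 0. lip_bound (B * h ^ 0) (ball 0 R) (g h)"
    by (rule small_lipE[where R = "R", OF assms(2)])
  obtain A where A: "1 \<le> A" "\<forall>\<^sub>F h in at_right 0. lip_bound (A * h ^ k) (ball 0 (B + 1)) (f h)"
    by (rule small_lipE[where R = "B + 1", OF assms(1)])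
  have "\<forall>\<^sub>F h in at_right 0. lip_bound ((A * B) * h ^ k) (ball 0 R) (\<lambda>x. f h (g h x))"
    using A(2) B(2) eventually_at_right_pos
  proof eventually_elim
    case (elim h)
    note elim = elim[unfolded lip_bound_def]
    have Ah: "0 \<le> A * h ^ k" using A(1) elim(3) by simp
    have in_ball: "g h x \<in> ball 0 (B + 1)" if "x \<in> ball 0 R" for x using elim(2) that by fastforce
    show ?case unfolding lip_bound_def
    proof (intro ballI conjI)
      fix x y :: 'a assume x: "x \<in> ball 0 R" and y: "y \<in> ball 0 R"
      have "norm (f h (g h x)) \<le> A * h ^ k" using elim(1) in_ball[OF x] by blast
      also have "\<dots> \<le> (A * h ^ k) * B" using Ah B(1) mult_left_mono[of 1 B "A * h ^ k"] by simp
      finally show "norm (f h (g h x)) \<le> (A * B) * h ^ k" by (simp add: mult_ac)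
      have "norm (f h (g h x) - f h (g h y)) \<le> A * h ^ k * norm (g h x - g h y)"
        using elim(1) in_ball[OF x] in_ball[OF y] by blast
      also have "\<dots> \<le> A * h ^ k * (B * norm (x - y))"
        using elim(2) x y Ah by (intro mult_left_mono) auto
      finally show "norm (f h (g h x) - f h (g h y)) \<le> (A * B) * h ^ k * norm (x - y)"
        by (simp add: mult_ac)
    qed
  qed
  then show ?case by (rule exI[of _ "A * B"])
qed

lemma small_lip_inner:
  fixes f :: "real \<Rightarrow> 'a::real_normed_vector \<Rightarrow> 'b::real_inner"
  assumes "small_lip 0 f" "small_lip k g" shows "small_lip k (\<lambda>h x. f h x \<bullet> g h x)"
proof (rule small_lipI, goal_cases)
  case (1 R)
  obtain A where A: "1 \<le> A" "\<forall>\<^sub>F h in at_right 0. lip_bound (A * h ^ 0) (ball 0 R) (f h)"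
    by (rule small_lipE[where R = "R", OF assms(1)])
  obtain B where B: "1 \<le> B" "\<forall>\<^sub>F h in at_right 0. lip_bound (B * h ^ k) (ball 0 R) (g h)"
    by (rule small_lipE[where R = "R", OF assms(2)])
  have "\<forall>\<^sub>F h in at_right 0. lip_bound ((2 * A * B) * h ^ k) (ball 0 R) (\<lambda>x. f h x \<bullet> g h x)"
    using A(2) B(2) eventually_at_right_pos
  proof eventually_elim
    case (elim h)
    note elim = elim[unfolded lip_bound_def]
    have Bh: "0 \<le> B * h ^ k" using B(1) elim(3) by simp
    have le: "norm (u \<bullet> v) \<le> a * b" if "norm u \<le> a" "norm v \<le> b" for u v :: 'b and a b
    proof -
      have "0 \<le> a" using that(1) norm_ge_zero order_trans by blast
      have "norm (u \<bullet> v) \<le> norm u * norm v" by (simp add: Cauchy_Schwarz_ineq2)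
      also have "\<dots> \<le> a * b" using that \<open>0 \<le> a\<close> by (intro mult_mono) auto
      finally show ?thesis .
    qed
    show ?case unfolding lip_bound_def
    proof (intro ballI conjI)
      fix x y :: 'a assume x: "x \<in> ball 0 R" and y: "y \<in> ball 0 R"
      have f: "norm (f h x) \<le> A" "norm (f h x - f h y) \<le> A * norm (x - y)" using elim(1) x y by auto
      have g: "norm (g h x - g h y) \<le> B * h ^ k * norm (x - y)" "norm (g h x) \<le> B * h ^ k" "norm (g h y) \<le> B * h ^ k"
        using elim(2) x y by blast+
      have "0 \<le> A * (B * h ^ k)" using Bh A(1) by simp
      then show "norm (f h x \<bullet> g h x) \<le> (2 * A * B) * h ^ k"
        using le[OF f(1) g(2)] by (simp add: mult_ac)
      have "f h x \<bullet> g h x - f h y \<bullet> g h y = f h x \<bullet> (g h x - g h y) + (f h x - f h y) \<bullet> g h y"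
        by (simp add: inner_diff_left inner_diff_right)
      then have "norm (f h x \<bullet> g h x - f h y \<bullet> g h y) \<le> A * (B * h ^ k * norm (x - y)) + (A * norm (x - y)) * (B * h ^ k)"
        using norm_triangle_le[OF add_mono[OF le[OF f(1) g(1)] le[OF f(2) g(3)]]] by simp
      then show "norm (f h x \<bullet> g h x - f h y \<bullet> g h y) \<le> (2 * A * B) * h ^ k * norm (x - y)"
        by (simp add: mult_ac)
    qed
  qed
  then show ?case by (rule exI[of _ "2 * A * B"])
qed

text \<open>A Lipschitz map \<open>g\<close> would preserve smallness of the values only; smallness
  of the Lipschitz constant survives because the derivative of \<open>g\<close> is Lipschitz as
  well, by \<open>C11_double_difference\<close>.\<close>

lemma small_lip_C11_difference:
  fixes x :: "real \<Rightarrow> 'a::real_normed_vector \<Rightarrow> 'b::real_normed_vector"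
  assumes g: "fam_C11 g" and x: "small_lip 0 x" and x': "small_lip 0 x'"
    and d: "small_lip k (\<lambda>h w. x h w - x' h w)"
  shows "small_lip k (\<lambda>h w. g h (x h w) - g h (x' h w))"
proof (rule small_lipI, goal_cases)
  case (1 R)
  obtain A where A: "1 \<le> A" "\<forall>\<^sub>F h in at_right 0. lip_bound (A * h ^ 0) (ball 0 R) (x h)"
    by (rule small_lipE[where R = "R", OF x])
  obtain A' where A': "1 \<le> A'" "\<forall>\<^sub>F h in at_right 0. lip_bound (A' * h ^ 0) (ball 0 R) (x' h)"
    by (rule small_lipE[where R = "R", OF x'])
  obtain C where C: "1 \<le> C" "\<forall>\<^sub>F h in at_right 0. lip_bound (C * h ^ k) (ball 0 R) (\<lambda>w. x h w - x' h w)"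
    by (rule small_lipE[where R = "R", OF d])
  define R' where "R' = A + A' + 1"
  obtain B where B: "1 \<le> B" "\<forall>\<^sub>F h in at_right 0. C11 B (ball 0 R') (g h)"
    by (rule fam_C11E[where R = R', OF g])
  have "\<forall>\<^sub>F h in at_right 0. lip_bound ((B * C * (1 + A + A')) * h ^ k) (ball 0 R) (\<lambda>w. g h (x h w) - g h (x' h w))"
    using A(2) A'(2) C(2) B(2) eventually_at_right_pos
  proof eventually_elim
    case (elim h)
    note elim = elim[unfolded lip_bound_def]
    have Ch: "0 \<le> B * (C * h ^ k)" using B(1) C(1) elim(5) by simp
    have inb: "x h w \<in> ball 0 R'" "x' h w \<in> ball 0 R'" if "w \<in> ball 0 R" for w
      using elim(1,2) that A(1) A'(1) by (fastforce simp: R'_def)+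
    show ?case unfolding lip_bound_def
    proof (intro ballI conjI)
      fix w v :: 'a assume w: "w \<in> ball 0 R" and v: "v \<in> ball 0 R"
      have "norm (g h (x h w) - g h (x' h w)) \<le> B * norm (x h w - x' h w)"
        by (rule C11_lipschitz[OF elim(4) convex_ball inb[OF w]])
      also have "\<dots> \<le> B * (C * h ^ k)" using elim(3) w B(1) by (intro mult_left_mono) auto
      also have "\<dots> \<le> B * (C * h ^ k) * (1 + A + A')"
        using Ch A(1) A'(1) mult_left_mono[of 1 "1 + A + A'" "B * (C * h ^ k)"] by simp
      finally show "norm (g h (x h w) - g h (x' h w)) \<le> (B * C * (1 + A + A')) * h ^ k" by (simp only: mult_ac)
      have "norm (g h (x h w) - g h (x' h w) - (g h (x h v) - g h (x' h v)))
        \<le> B * norm (x h w - x' h w - (x h v - x' h v)) +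
          B * (norm (x h w - x h v) + norm (x' h w - x' h v)) * norm (x h v - x' h v)"
        by (rule C11_double_difference[OF elim(4) convex_ball inb[OF w] inb[OF v]])
      also have "\<dots> \<le> B * (C * h ^ k * norm (w - v)) + B * (A * norm (w - v) + A' * norm (w - v)) * (C * h ^ k)"
        using elim(1-3) w v B(1) A(1) A'(1) by (intro add_mono mult_mono mult_left_mono) auto
      finally show "norm (g h (x h w) - g h (x' h w) - (g h (x h v) - g h (x' h v)))
          \<le> (B * C * (1 + A + A')) * h ^ k * norm (w - v)" by (simp add: algebra_simps)
    qed
  qed
  then show ?case by (rule exI[of _ "B * C * (1 + A + A')"])
qed

lemma small_lip_linear: "bounded_linear g \<Longrightarrow> small_lip 0 (\<lambda>h. g)"
  using small_lip_bounded_linear[OF _ fam_C11_imp_small_lip[OF fam_C11_ident]] .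

lemma fam_C11_linear:
  fixes g :: "'a::euclidean_space \<Rightarrow> 'b::real_normed_vector"
  assumes "bounded_linear g" shows "fam_C11 (\<lambda>h :: real. g)"
  using fam_C11_of_Ck[OF Ck_linear[OF bounded_linear_compose[OF assms bounded_linear_snd]]] by simp

section \<open>Near-identity equations\<close>

text \<open>This translates between the filter used in the definitions and uniform statements on
  balls. Towards balls it is compactness: finitely many neighbourhoods cover the closed ball, and
  finitely many ranges of step sizes have a common part.\<close>

lemma eventually_prod_at_right_nhds_iff:
  fixes P :: "real \<Rightarrow> 'a::euclidean_space \<Rightarrow> bool"
  shows "(\<forall>a. \<forall>\<^sub>F (h, a') in at_right 0 \<times>\<^sub>F nhds a. P h a') \<longleftrightarrow>
    (\<forall>R. \<forall>\<^sub>F h in at_right 0. \<forall>a\<in>ball 0 R. P h a)"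
proof safe
  fix R
  assume P: "\<forall>a. \<forall>\<^sub>F (h, a') in at_right 0 \<times>\<^sub>F nhds a. P h a'"
  have "\<exists>U. open U \<and> a \<in> U \<and> (\<forall>\<^sub>F h in at_right 0. \<forall>a'\<in>U. P h a')" for a
  proof -
    obtain Q1 Q2 where Q: "eventually Q1 (at_right 0)" "eventually Q2 (nhds a)" "\<And>h a'. Q1 h \<Longrightarrow> Q2 a' \<Longrightarrow> P h a'"
      using P[rule_format, of a] unfolding eventually_prod_filter by auto
    obtain U where "open U" "a \<in> U" "\<forall>a'\<in>U. Q2 a'" using Q(2) unfolding eventually_nhds by blast
    moreover have "\<forall>\<^sub>F h in at_right 0. \<forall>a'\<in>U. P h a'"
      using Q(1) by (rule eventually_mono) (use Q(3) calculation(3) in blast)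
    ultimately show ?thesis by blast
  qed
  then obtain U where U: "\<And>a. open (U a)" "\<And>a. a \<in> U a" "\<And>a. \<forall>\<^sub>F h in at_right 0. \<forall>a'\<in>U a. P h a'"
    by metis
  obtain D where D: "D \<subseteq> cball 0 R" "finite D" "cball 0 R \<subseteq> (\<Union>a\<in>D. U a)"
    using compactE_image[OF compact_cball, of "cball 0 R" U 0 R] U by blast
  have "\<forall>\<^sub>F h in at_right 0. \<forall>a\<in>D. \<forall>a'\<in>U a. P h a'"
    using D(2) U(3) by (simp add: eventually_ball_finite)
  then show "\<forall>\<^sub>F h in at_right 0. \<forall>a\<in>ball 0 R. P h a"
    by (rule eventually_mono) (use D(3) ball_subset_cball in blast)
next
  fix a :: 'a
  assume P: "\<forall>R. \<forall>\<^sub>F h in at_right 0. \<forall>a\<in>ball 0 R. P h a"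
  have "eventually (\<lambda>a'. a' \<in> ball 0 (norm a + 1)) (nhds a)"
    by (rule eventually_nhds_in_open) auto
  with P[rule_format, of "norm a + 1"] show "\<forall>\<^sub>F (h, a') in at_right 0 \<times>\<^sub>F nhds a. P h a'"
    unfolding eventually_prod_filter by blast
qed

lemma eventually_prod_at_right_nhdsI:
  fixes P :: "real \<Rightarrow> 'a::real_normed_vector \<Rightarrow> bool"
  assumes "\<forall>\<^sub>F h in at_right 0. \<forall>a\<in>ball 0 (norm a0 + 1). P h a"
  shows "\<forall>\<^sub>F x in at_right 0 \<times>\<^sub>F nhds a0. P (fst x) (snd x)"
proof -
  have "eventually (\<lambda>a. a \<in> ball 0 (norm a0 + 1)) (nhds a0)"
    by (rule eventually_nhds_in_open) auto
  with assms show ?thesis unfolding eventually_prod_filter by force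
qed

text \<open>The last clause is uniqueness in quantitative form: a candidate in the unit ball is at
  most twice its residual away from the solution. With residual \<open>0\<close> it gives
  uniqueness; in \<open>discrete_map_order\<close> it turns the residual of the exact flow into an
  error bound.\<close>

definition near_solution ::
  "real \<Rightarrow> (real \<Rightarrow> 'a \<times> 'b \<Rightarrow> 'b) \<Rightarrow> ('a \<Rightarrow> 'b) \<Rightarrow> 'a \<Rightarrow> 'b::real_normed_vector \<Rightarrow> bool" where
  "near_solution h \<Phi> x0 a y \<longleftrightarrow> dist y (x0 a) < 1 \<and> y = x0 a - h *\<^sub>R \<Phi> h (a, y) \<and>
    (\<forall>y'. dist y' (x0 a) < 1 \<longrightarrow> norm (y' - y) \<le> 2 * norm (y' - (x0 a - h *\<^sub>R \<Phi> h (a, y'))))"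

text \<open>Banach's fixed point theorem on the closed unit ball about \<open>x0 a\<close>: once
  \<open>h * B < 1 / 2\<close> the map is a contraction by \<open>1 / 2\<close>, which is also the
  source of the factor \<open>2\<close> in \<open>near_solution\<close>.\<close>

lemma near_identity_solution:
  fixes \<Phi> :: "real \<Rightarrow> 'a::real_normed_vector \<times> 'b::banach \<Rightarrow> 'b" and x0 :: "'a \<Rightarrow> 'b"
  assumes \<Phi>: "small_lip 0 \<Phi>" and x0: "\<And>a. norm (x0 a) \<le> norm a"
  shows "\<exists>y. \<forall>R. \<exists>B. \<forall>\<^sub>F h in at_right 0. \<forall>a\<in>ball 0 R. norm (y h a - x0 a) \<le> h * B \<and>
    near_solution h \<Phi> x0 a (y h a)"
proof -
  \<comment> \<open>The choice makes no reference to \<open>R\<close>, so that one function serves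
    all balls although the admissible \<open>h\<close> depend on \<open>R\<close>.\<close>
  define y where "y h a = (SOME y. dist y (x0 a) < 1 \<and> y = x0 a - h *\<^sub>R \<Phi> h (a, y))" for h a
  have "\<exists>B. \<forall>\<^sub>F h in at_right 0. \<forall>a\<in>ball 0 R. norm (y h a - x0 a) \<le> h * B \<and>
    near_solution h \<Phi> x0 a (y h a)" for R
  proof -
    \<comment> \<open>If \<open>norm a < R\<close>, then a point \<open>u\<close> at distance at
      most \<open>1\<close> from \<open>x0 a\<close> has norm below \<open>R + 1\<close>, so the
      pair \<open>(a, u)\<close> has norm below \<open>2 * R + 2\<close>.\<close>
    obtain B where B: "1 \<le> B" "\<forall>\<^sub>F h in at_right 0. lip_bound (B * h ^ 0) (ball 0 (2 * R + 2)) (\<Phi> h)"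
      by (rule small_lipE[where R = "2 * R + 2", OF \<Phi>])
    have "\<forall>\<^sub>F h in at_right 0. h * B < 1 / 2" by (rule eventually_at_right_mult_less) simp
    with B(2) eventually_at_right_pos
    have "\<forall>\<^sub>F h in at_right 0. \<forall>a\<in>ball 0 R. norm (y h a - x0 a) \<le> h * B \<and>
      near_solution h \<Phi> x0 a (y h a)"
    proof eventually_elim
      case (elim h)
      note elim = elim[unfolded lip_bound_def]
      show ?case
      proof
        fix a :: 'a assume a: "a \<in> ball 0 R"
        define T where "T y = x0 a - h *\<^sub>R \<Phi> h (a, y)" for y
        have in_ball: "(a, u) \<in> ball 0 (2 * R + 2)" if "u \<in> cball (x0 a) 1" for u
        proof -
          have "norm (a, u) \<le> norm a + norm u" by (rule norm_Pair_le)
          moreover have "norm u \<le> norm (x0 a) + norm (u - x0 a)" by (rule norm_triangle_sub)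
          moreover have "norm (u - x0 a) \<le> 1" using that by (simp add: dist_norm norm_minus_commute)
          moreover have "norm a < R" using a by simp
          ultimately have "norm (a, u) < 2 * R + 2" using x0[of a] norm_ge_zero[of a] by linarith
          then show ?thesis by (simp only: mem_ball_0)
        qed
        have T_bound: "norm (T u - x0 a) \<le> h * B" if "u \<in> cball (x0 a) 1" for u
        proof -
          have "norm (T u - x0 a) = h * norm (\<Phi> h (a, u))" using elim(2) by (simp add: T_def)
          also have "\<dots> \<le> h * B" using elim(1,2) in_ball[OF that] by (intro mult_left_mono) auto
          finally show ?thesis .
        qed
        have T_lip: "norm (T u - T v) \<le> 1 / 2 * norm (u - v)" if "u \<in> cball (x0 a) 1" "v \<in> cball (x0 a) 1" for u v
        proof -
          have "norm (T u - T v) = norm (h *\<^sub>R (\<Phi> h (a, u) - \<Phi> h (a, v)))"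
            by (simp add: T_def norm_minus_commute algebra_simps)
          also have "\<dots> = h * norm (\<Phi> h (a, u) - \<Phi> h (a, v))" using elim(2) by simp
          also have "norm (\<Phi> h (a, u) - \<Phi> h (a, v)) \<le> B * norm ((a, u) - (a, v))"
            using elim(1) in_ball[OF that(1)] in_ball[OF that(2)] by fastforce
          also have "norm ((a, u) - (a, v)) = norm (u - v)" by (simp add: norm_Pair)
          also have "h * (B * norm (u - v)) \<le> 1 / 2 * norm (u - v)"
            using elim(3) mult_right_mono[of "h * B" "1 / 2" "norm (u - v)"] by (simp add: mult.assoc)
          finally show ?thesis using elim(2) by simp
        qed
        have "\<exists>!u. u \<in> cball (x0 a) 1 \<and> T u = u"
        proof (rule Banach_fix[where c = "1 / 2"])
          show "T ` cball (x0 a) 1 \<subseteq> cball (x0 a) 1"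
            using T_bound elim(3) by (force simp: dist_norm norm_minus_commute)
        qed (use T_lip in \<open>auto simp: dist_norm complete_eq_closed\<close>)
        then obtain u where u: "u \<in> cball (x0 a) 1" "T u = u" by blast
        have "dist u (x0 a) < 1" using T_bound[OF u(1)] u(2) elim(3) by (simp add: dist_norm)
        then have "\<exists>y. dist y (x0 a) < 1 \<and> y = x0 a - h *\<^sub>R \<Phi> h (a, y)" using u(2) by (auto simp: T_def)
        from someI_ex[OF this] have yp: "dist (y h a) (x0 a) < 1" "y h a = x0 a - h *\<^sub>R \<Phi> h (a, y h a)"
          unfolding y_def[symmetric] by auto
        then have yT: "T (y h a) = y h a" "y h a \<in> cball (x0 a) 1" by (auto simp: T_def dist_commute)
        have "norm (y h a - x0 a) \<le> h * B" using T_bound[OF yT(2)] yT(1) by simp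
        moreover have "norm (y' - y h a) \<le> 2 * norm (y' - T y')" if "dist y' (x0 a) < 1" for y'
        proof -
          have "norm (y' - y h a) \<le> norm (y' - T y') + norm (T y' - T (y h a))"
            using norm_triangle_ineq[of "y' - T y'" "T y' - T (y h a)"] yT(1) by simp
          also have "norm (T y' - T (y h a)) \<le> 1 / 2 * norm (y' - y h a)"
            using T_lip[OF _ yT(2), of y'] that by (simp add: dist_commute)
          finally show ?thesis by simp
        qed
        ultimately show "norm (y h a - x0 a) \<le> h * B \<and> near_solution h \<Phi> x0 a (y h a)"
          using yp by (auto simp: near_solution_def T_def)
      qed
    qed
    then show ?thesis by (rule exI[of _ B])
  qed
  then show ?thesis by (intro exI[of _ y]) blast
qed

text \<open>\<open>local_solution\<close> is chosen by \<open>SOME\<close>, so nothing is known of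
  it beyond \<open>is_local_solution\<close>. The fixed points have this property, hence so does the
  chosen function.\<close>

lemma local_solution_near_identity:
  fixes \<Phi> :: "real \<Rightarrow> 'a::euclidean_space \<times> 'b::banach \<Rightarrow> 'b" and x0 :: "'a \<Rightarrow> 'b"
  assumes \<Phi>: "small_lip 0 \<Phi>" and x0: "\<And>a. norm (x0 a) \<le> norm a"
    and S: "\<And>R. \<forall>\<^sub>F h in at_right 0. \<forall>a\<in>ball 0 R. \<forall>y. dist y (x0 a) < 1 \<longrightarrow>
      (S h a y \<longleftrightarrow> y = x0 a - h *\<^sub>R \<Phi> h (a, y))"
  shows "\<forall>\<^sub>F h in at_right 0. \<forall>a\<in>ball 0 R. near_solution h \<Phi> x0 a (local_solution S x0 h a)"
proof -
  obtain y where "\<forall>R. \<exists>B. \<forall>\<^sub>F h in at_right 0. \<forall>a\<in>ball 0 R. norm (y h a - x0 a) \<le> h * B \<and>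
    near_solution h \<Phi> x0 a (y h a)"
    using near_identity_solution[of \<Phi> x0, OF \<Phi> x0] by (rule exE)
  then obtain B where y: "\<And>R. \<forall>\<^sub>F h in at_right 0. \<forall>a\<in>ball 0 R. norm (y h a - x0 a) \<le> h * B R \<and>
    near_solution h \<Phi> x0 a (y h a)"
    unfolding choice_iff by blast
  have small: "\<forall>\<^sub>F h in at_right 0. \<forall>a\<in>ball 0 R. dist (y h a) (x0 a) < e" if "e > 0" for e R
    using y[of R] eventually_at_right_mult_less[OF that, of "B R"]
    by eventually_elim (auto simp: dist_norm intro: le_less_trans)
  have unique: "\<forall>\<^sub>F h in at_right 0. \<forall>a\<in>ball 0 R. \<forall>y'. (dist y' (x0 a) < 1 \<and> S h a y') \<longleftrightarrow> y' = y h a" for R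
    using y[of R] S[of R]
  proof eventually_elim
    case (elim h)
    show ?case
    proof (intro ballI allI)
      fix a :: 'a and y' assume a: "a \<in> ball 0 R"
      note ya = elim(1)[unfolded near_solution_def, rule_format, OF a] and Sa = elim(2)[rule_format, OF a]
      show "(dist y' (x0 a) < 1 \<and> S h a y') \<longleftrightarrow> y' = y h a"
      proof
        assume y': "dist y' (x0 a) < 1 \<and> S h a y'"
        then have "y' - (x0 a - h *\<^sub>R \<Phi> h (a, y')) = 0" using Sa[of y'] by auto
        moreover have "norm (y' - y h a) \<le> 2 * norm (y' - (x0 a - h *\<^sub>R \<Phi> h (a, y')))" using ya y' by blast
        ultimately show "y' = y h a" by simp
      next
        assume "y' = y h a"
        then show "dist y' (x0 a) < 1 \<and> S h a y'" using ya Sa by blast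
      qed
    qed
  qed
  have "is_local_solution S x0 y"
    unfolding is_local_solution_def
  proof (intro allI conjI)
    fix a
    show "((\<lambda>h. y h a) \<longlongrightarrow> x0 a) (at_right 0)"
    proof (rule tendstoI)
      fix e :: real assume "e > 0"
      from small[OF this, of "norm a + 1"] show "\<forall>\<^sub>F h in at_right 0. dist (y h a) (x0 a) < e"
        by (rule eventually_mono) auto
    qed
    have "\<forall>\<^sub>F (h, a') in at_right 0 \<times>\<^sub>F nhds a. \<forall>y'. (dist y' (x0 a') < 1 \<and> S h a' y') \<longleftrightarrow> y' = y h a'"
      using unique eventually_prod_at_right_nhds_iff[of "\<lambda>h a. \<forall>y'. (dist y' (x0 a) < 1 \<and> S h a y') \<longleftrightarrow> y' = y h a"]
      by blast
    then show "\<exists>\<delta>>0. \<forall>\<^sub>F (h, a') in at_right 0 \<times>\<^sub>F nhds a. \<forall>y'. (dist y' (x0 a') < \<delta> \<and> S h a' y') \<longleftrightarrow> y' = y h a'"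
      by (intro exI[of _ 1]) simp
  qed
  then have sol: "is_local_solution S x0 (local_solution S x0)"
    unfolding local_solution_def by (rule someI[where P = "is_local_solution S x0"])
  \<comment> \<open>The uniqueness radius \<open>\<delta>\<close> of the chosen function is
    arbitrary, but the fixed points tend to \<open>x0\<close> uniformly on balls, so they eventually
    fall within it and must coincide with the chosen values.\<close>
  have "\<forall>a. \<forall>\<^sub>F (h, a') in at_right 0 \<times>\<^sub>F nhds a. local_solution S x0 h a' = y h a'"
  proof
    fix a
    obtain \<delta> where \<delta>: "0 < \<delta>" "\<forall>\<^sub>F (h, a') in at_right 0 \<times>\<^sub>F nhds a.
        \<forall>y. (dist y (x0 a') < \<delta> \<and> S h a' y) \<longleftrightarrow> y = local_solution S x0 h a'"
      using sol unfolding is_local_solution_def by blast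
    have "\<forall>\<^sub>F (h, a') in at_right 0 \<times>\<^sub>F nhds a. dist (y h a') (x0 a') < \<delta> \<and> S h a' (y h a')"
    proof -
      have "\<forall>\<^sub>F h in at_right 0. \<forall>a'\<in>ball 0 R. dist (y h a') (x0 a') < \<delta> \<and> S h a' (y h a')" for R
        using small[OF \<delta>(1), of R] unique[of R] by eventually_elim blast
      then show ?thesis
        using eventually_prod_at_right_nhds_iff[of "\<lambda>h a'. dist (y h a') (x0 a') < \<delta> \<and> S h a' (y h a')"]
        by blast
    qed
    with \<delta>(2) show "\<forall>\<^sub>F (h, a') in at_right 0 \<times>\<^sub>F nhds a. local_solution S x0 h a' = y h a'"
      by eventually_elim (clarsimp, metis)
  qed
  then have eq: "\<forall>\<^sub>F h in at_right 0. \<forall>a\<in>ball 0 R. local_solution S x0 h a = y h a"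
    using eventually_prod_at_right_nhds_iff[of "\<lambda>h a. local_solution S x0 h a = y h a"] by blast
  show ?thesis
    using y[of R] eq
  proof eventually_elim
    case (elim h)
    show ?case
    proof
      fix a :: 'a assume a: "a \<in> ball 0 R"
      show "near_solution h \<Phi> x0 a (local_solution S x0 h a)"
        unfolding elim(2)[rule_format, OF a] using elim(1) a by blast
    qed
  qed
qed

text \<open>Unknown and data live in the same space: in the applications \<open>z h w\<close> is the
  whole initial state, half of it copied from the data \<open>w\<close>. Both boundary value
  problems, exact or discretized, thereby become one type of equation.\<close>

definition implicit_family :: "(real \<Rightarrow> 'a \<Rightarrow> 'a) \<Rightarrow> (real \<Rightarrow> 'a::real_normed_vector \<Rightarrow> 'a) \<Rightarrow> bool" where
  "implicit_family V z \<longleftrightarrow> (\<forall>R. \<forall>\<^sub>F h in at_right 0. \<forall>w\<in>ball 0 R.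
     norm (z h w - w) < 1 \<and> z h w + h *\<^sub>R V h (z h w) = w)"

lemma implicit_familyD:
  "implicit_family V z \<Longrightarrow> \<forall>\<^sub>F h in at_right 0. \<forall>w\<in>ball 0 R. norm (z h w - w) < 1 \<and> z h w + h *\<^sub>R V h (z h w) = w"
  by (simp add: implicit_family_def)

lemma implicit_family_in_ball:
  assumes "norm (z - w) < 1" "w \<in> ball 0 R" shows "z \<in> ball 0 (R + 1)"
  using norm_triangle_sub[of z w] assms by simp

lemma implicit_family_lipschitz:
  fixes V z :: "real \<Rightarrow> 'a::real_normed_vector \<Rightarrow> 'a"
  assumes V: "small_lip 0 V" and z: "implicit_family V z"
  shows "\<forall>\<^sub>F h in at_right 0. \<forall>w\<in>ball 0 R. \<forall>w'\<in>ball 0 R. norm (z h w - z h w') \<le> 2 * norm (w - w')"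
proof -
  obtain B where B: "1 \<le> B" "\<forall>\<^sub>F h in at_right 0. lip_bound (B * h ^ 0) (ball 0 (R + 1)) (V h)"
    by (rule small_lipE[where R = "R + 1", OF V])
  have "\<forall>\<^sub>F h in at_right 0. h * B < 1 / 2" by (rule eventually_at_right_mult_less) simp
  with B(2) implicit_familyD[OF z, of R] eventually_at_right_pos show ?thesis
  proof eventually_elim
    case (elim h)
    note elim = elim[unfolded lip_bound_def]
    show ?case
    proof (intro ballI)
      fix w w' :: 'a assume w: "w \<in> ball 0 R" and w': "w' \<in> ball 0 R"
      have zb: "z h w \<in> ball 0 (R + 1)" "z h w' \<in> ball 0 (R + 1)"
        using elim(2) w w' implicit_family_in_ball by blast+
      have "z h w + h *\<^sub>R V h (z h w) = w" "z h w' + h *\<^sub>R V h (z h w') = w'" using elim(2) w w' by blast+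
      then have "z h w - z h w' = (w - w') - h *\<^sub>R (V h (z h w) - V h (z h w'))"
        by (auto simp: algebra_simps)
      then have "norm (z h w - z h w') \<le> norm (w - w') + h * norm (V h (z h w) - V h (z h w'))"
        using norm_triangle_ineq4[of "w - w'" "h *\<^sub>R (V h (z h w) - V h (z h w'))"] elim(3) by simp
      also have "h * norm (V h (z h w) - V h (z h w')) \<le> h * (B * norm (z h w - z h w'))"
        using elim(1,3) zb by (intro mult_left_mono) auto
      also have "\<dots> \<le> 1 / 2 * norm (z h w - z h w')"
        using elim(4) mult_right_mono[of "h * B" "1 / 2" "norm (z h w - z h w')"] by (simp add: mult.assoc)
      finally show "norm (z h w - z h w') \<le> 2 * norm (w - w')" by simp
    qed
  qed
qed

lemma implicit_family_small_lip:
  fixes V z :: "real \<Rightarrow> 'a::real_normed_vector \<Rightarrow> 'a"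
  assumes V: "small_lip 0 V" and z: "implicit_family V z"
  shows "small_lip 0 z"
proof (rule small_lipI, goal_cases)
  case (1 R)
  have "\<forall>\<^sub>F h in at_right 0. lip_bound ((\<bar>R\<bar> + 2) * h ^ 0) (ball 0 R) (z h)"
    using implicit_family_lipschitz[OF V z, of R] implicit_familyD[OF z, of R]
  proof eventually_elim
    case (elim h)
    note elim = elim[unfolded lip_bound_def]
    have "2 * t \<le> (\<bar>R\<bar> + 2) * t" if "0 \<le> t" for t using that by (intro mult_right_mono) auto
    note le = this[OF norm_ge_zero]
    show ?case unfolding lip_bound_def
    proof (intro ballI conjI)
      fix x y :: 'a assume x: "x \<in> ball 0 R" and y: "y \<in> ball 0 R"
      have "z h x \<in> ball 0 (R + 1)" using elim(2) x implicit_family_in_ball by blast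
      then show "norm (z h x) \<le> (\<bar>R\<bar> + 2) * h ^ 0" by simp
      show "norm (z h x - z h y) \<le> (\<bar>R\<bar> + 2) * h ^ 0 * norm (x - y)"
        using elim(1) x y le[of "x - y"] by fastforce
    qed
  qed
  then show ?case by (rule exI[of _ "\<bar>R\<bar> + 2"])
qed

lemma implicit_family_unique:
  fixes V z :: "real \<Rightarrow> 'a::real_normed_vector \<Rightarrow> 'a"
  assumes V: "small_lip 0 V" and z: "implicit_family V z"
  shows "\<forall>\<^sub>F h in at_right 0. \<forall>w\<in>ball 0 R. \<forall>y. norm (y - w) < 1 \<longrightarrow> y + h *\<^sub>R V h y = w \<longrightarrow> z h w = y"
proof -
  obtain B where B: "1 \<le> B" "\<forall>\<^sub>F h in at_right 0. lip_bound (B * h ^ 0) (ball 0 (R + 1)) (V h)"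
    by (rule small_lipE[where R = "R + 1", OF V])
  have "\<forall>\<^sub>F h in at_right 0. h * B < 1 / 2" by (rule eventually_at_right_mult_less) simp
  with B(2) implicit_familyD[OF z, of R] eventually_at_right_pos show ?thesis
  proof eventually_elim
    case (elim h)
    note elim = elim[unfolded lip_bound_def]
    show ?case
    proof (intro ballI allI impI)
      fix w y :: 'a assume w: "w \<in> ball 0 R" and y: "norm (y - w) < 1" "y + h *\<^sub>R V h y = w"
      have zw: "norm (z h w - w) < 1" "z h w + h *\<^sub>R V h (z h w) = w" using elim(2) w by auto
      have in_ball: "z h w \<in> ball 0 (R + 1)" "y \<in> ball 0 (R + 1)"
        using zw y w implicit_family_in_ball by blast+
      have "z h w - y = h *\<^sub>R (V h y - V h (z h w))" using zw(2) y(2)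
        by (simp add: algebra_simps)
      then have "norm (z h w - y) = h * norm (V h y - V h (z h w))" using elim(3) by simp
      also have "\<dots> \<le> h * (B * norm (y - z h w))"
        using elim(1,3) in_ball by (intro mult_left_mono) auto
      also have "\<dots> \<le> 1 / 2 * norm (z h w - y)"
        using elim(4) mult_right_mono[of "h * B" "1 / 2" "norm (z h w - y)"]
        by (simp add: mult.assoc norm_minus_commute)
      finally have "norm (z h w - y) \<le> 0" by simp
      then show "z h w = y" by simp
    qed
  qed
qed

text \<open>The lower bound \<open>norm v \<le> 2 * norm (f v)\<close> for the perturbed map makes
  it injective, hence bijective in finite dimension, and bounds its inverse by
  \<open>2\<close>.\<close>

lemma linear_perturbation_inverse:
  fixes A :: "'a::euclidean_space \<Rightarrow> 'a"
  assumes A: "linear A" and small: "\<And>v. norm (A v) \<le> 1 / 2 * norm v"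
  obtains g where "bounded_linear g" "g \<circ> (\<lambda>v. v + A v) = id" "\<And>v. g v + A (g v) = v"
    "\<And>v. norm (g v) \<le> 2 * norm v"
proof -
  define f where "f v = v + A v" for v
  have f: "linear f" unfolding f_def by (intro linear_compose_add linear_ident A)
  have lower: "norm v \<le> 2 * norm (f v)" for v
    using norm_triangle_ineq4[of "f v" "A v"] small[of v] by (simp add: f_def)
  have "inj f"
    unfolding linear_injective_0[OF f] using lower by (metis mult_zero_right norm_le_zero_iff norm_zero)
  then obtain g where g: "linear g" "\<And>x. g (f x) = x" "\<And>x. f (g x) = x"
    using linear_injective_isomorphism[OF f] by blast
  show ?thesis
  proof (rule that)
    show "bounded_linear g" using g(1) by (simp add: linear_conv_bounded_linear)
    show "g \<circ> (\<lambda>v. v + A v) = id" using g(2) by (auto simp: f_def fun_eq_iff)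
    show "g v + A (g v) = v" for v using g(3)[of v] by (simp add: f_def)
    show "norm (g v) \<le> 2 * norm v" for v using lower[of "g v"] g(3)[of v] by simp
  qed
qed

text \<open>\<open>z h\<close> inverts \<open>x + h V(x)\<close>. It is continuous by the Lipschitz
  bound, so its derivative is the inverse of the perturbed identity. The values are below
  \<open>R + 1\<close>, the derivative is bounded by \<open>2\<close> and its Lipschitz constant by
  \<open>4\<close>; \<open>\<bar>R\<bar> + 4\<close> dominates all three.\<close>

lemma implicit_family_C11:
  fixes V z :: "real \<Rightarrow> 'a::euclidean_space \<Rightarrow> 'a"
  assumes V: "fam_C11 V" and z: "implicit_family V z"
  shows "fam_C11 z"
  unfolding fam_C11_def
proof
  fix R :: real
  obtain B where B: "1 \<le> B" "\<forall>\<^sub>F h in at_right 0. C11 B (ball 0 (R + 1)) (V h)"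
    by (rule fam_C11E[where R = "R + 1", OF V])
  have "\<forall>\<^sub>F h in at_right 0. h * B < 1 / 2" by (rule eventually_at_right_mult_less) simp
  with B(2) implicit_familyD[OF z, of R] eventually_at_right_pos
    implicit_family_lipschitz[OF fam_C11_imp_small_lip[OF V] z, of R]
  have "\<forall>\<^sub>F h in at_right 0. C11 (\<bar>R\<bar> + 4) (ball 0 R) (z h)"
  proof eventually_elim
    case (elim h)
    obtain V' where V': "\<And>x. x \<in> ball 0 (R + 1) \<Longrightarrow> (V h has_derivative V' x) (at x)"
      "\<And>x v. x \<in> ball 0 (R + 1) \<Longrightarrow> norm (V' x v) \<le> B * norm v"
      "\<And>x y v. x \<in> ball 0 (R + 1) \<Longrightarrow> y \<in> ball 0 (R + 1) \<Longrightarrow> norm (V' x v - V' y v) \<le> B * norm (x - y) * norm v"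
      using elim(1) unfolding C11_def by blast
    have zb: "z h w \<in> ball 0 (R + 1)" if "w \<in> ball 0 R" for w
      using elim(2) that implicit_family_in_ball by blast
    have lin: "linear (\<lambda>v. h *\<^sub>R V' (z h w) v)" if "w \<in> ball 0 R" for w
      using V'(1)[OF zb[OF that]] by (intro linear_compose_scale_right has_derivative_linear)
    have hB: "h * (B * t) \<le> 1 / 2 * t" if "0 \<le> t" for t
      using elim(5) mult_right_mono[of "h * B" "1 / 2" t] that by (simp add: mult.assoc)
    have small: "norm (h *\<^sub>R V' (z h w) v) \<le> 1 / 2 * norm v" if "w \<in> ball 0 R" for w v
    proof -
      have "norm (h *\<^sub>R V' (z h w) v) \<le> h * (B * norm v)"
        using V'(2)[OF zb[OF that]] elim(3) by (auto intro: mult_left_mono)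
      also have "\<dots> \<le> 1 / 2 * norm v" by (rule hB) simp
      finally show ?thesis .
    qed
    have "\<forall>w\<in>ball 0 R. \<exists>g. bounded_linear g \<and> g \<circ> (\<lambda>v. v + h *\<^sub>R V' (z h w) v) = id \<and>
        (\<forall>v. g v + h *\<^sub>R V' (z h w) (g v) = v) \<and> (\<forall>v. norm (g v) \<le> 2 * norm v)"
    proof
      fix w :: 'a assume w: "w \<in> ball 0 R"
      show "\<exists>g. bounded_linear g \<and> g \<circ> (\<lambda>v. v + h *\<^sub>R V' (z h w) v) = id \<and>
        (\<forall>v. g v + h *\<^sub>R V' (z h w) (g v) = v) \<and> (\<forall>v. norm (g v) \<le> 2 * norm v)"
        by (rule linear_perturbation_inverse[OF lin[OF w] small[OF w]]) blast
    qed
    then obtain g where g0: "\<forall>w\<in>ball 0 R. bounded_linear (g w) \<and> g w \<circ> (\<lambda>v. v + h *\<^sub>R V' (z h w) v) = id \<and>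
        (\<forall>v. g w v + h *\<^sub>R V' (z h w) (g w v) = v) \<and> (\<forall>v. norm (g w v) \<le> 2 * norm v)"
      unfolding bchoice_iff by (rule exE)
    have g: "bounded_linear (g w)" "g w \<circ> (\<lambda>v. v + h *\<^sub>R V' (z h w) v) = id"
      "\<And>v. g w v + h *\<^sub>R V' (z h w) (g w v) = v" "\<And>v. norm (g w v) \<le> 2 * norm v"
      if "w \<in> ball 0 R" for w
      using g0[rule_format, OF that] by blast+
    have "continuous_on (ball 0 R) (z h)"
    proof (rule lipschitz_on_continuous_on[of 2])
      show "2-lipschitz_on (ball 0 R) (z h)" using elim(4) by (auto simp: lipschitz_on_def dist_norm)
    qed
    then have cont: "continuous (at w) (z h)" if "w \<in> ball 0 R" for w
      using that by (simp add: continuous_on_eq_continuous_at)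
    have deriv: "(z h has_derivative g w) (at w)" if w: "w \<in> ball 0 R" for w
    proof (rule has_derivative_inverse_basic[where f = "\<lambda>x. x + h *\<^sub>R V h x" and T = "ball 0 R", OF _ g(1,2)[OF w] cont[OF w]])
      show "((\<lambda>x. x + h *\<^sub>R V h x) has_derivative (\<lambda>v. v + h *\<^sub>R V' (z h w) v)) (at (z h w))"
        by (intro has_derivative_add has_derivative_ident has_derivative_scaleR_right V'(1) zb w)
    qed (use w elim(2) in auto)
    have lip: "norm (g w v - g w' v) \<le> 4 * norm (w - w') * norm v" if w: "w \<in> ball 0 R" and w': "w' \<in> ball 0 R" for w w' v
    proof -
      have lV: "linear (V' (z h w))" using V'(1)[OF zb[OF w]] by (rule has_derivative_linear)
      \<comment> \<open>Subtracting the equations that define the two inverses leaves a term with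
        \<open>g w v - g w' v\<close> itself, which has a factor at most \<open>1 / 2\<close> and is
        absorbed into the left-hand side.\<close>
      have "g w v - g w' v = h *\<^sub>R (V' (z h w') (g w' v) - V' (z h w) (g w v))"
        using g(3)[OF w, of v] g(3)[OF w', of v] by (simp add: algebra_simps eq_diff_eq)
      also have "\<dots> = - (h *\<^sub>R V' (z h w) (g w v - g w' v)) - h *\<^sub>R (V' (z h w) (g w' v) - V' (z h w') (g w' v))"
        using lV by (simp add: linear_diff algebra_simps)
      finally have "norm (g w v - g w' v) \<le> norm (h *\<^sub>R V' (z h w) (g w v - g w' v))
          + norm (h *\<^sub>R (V' (z h w) (g w' v) - V' (z h w') (g w' v)))"
        by (metis norm_minus_cancel norm_triangle_ineq4)
      also have "\<dots> \<le> 1 / 2 * norm (g w v - g w' v) + h * (B * norm (z h w - z h w') * norm (g w' v))"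
        using small[OF w, of "g w v - g w' v"] V'(3)[OF zb[OF w] zb[OF w'], of "g w' v"] elim(3)
        by (intro add_mono) (auto intro: mult_left_mono)
      also have "h * (B * norm (z h w - z h w') * norm (g w' v)) \<le> 1 / 2 * (norm (z h w - z h w') * norm (g w' v))"
        using hB[of "norm (z h w - z h w') * norm (g w' v)"] by (simp add: mult.assoc)
      also have "\<dots> \<le> 1 / 2 * ((2 * norm (w - w')) * (2 * norm v))"
        using elim(4) w w' g(4)[OF w', of v] by (intro mult_left_mono mult_mono) auto
      finally have "norm (g w v - g w' v) \<le> 2 * (1 / 2 * ((2 * norm (w - w')) * (2 * norm v)))" by linarith
      then show ?thesis by (simp add: mult_ac)
    qed
    have le: "2 * t \<le> (\<bar>R\<bar> + 4) * t" "4 * t \<le> (\<bar>R\<bar> + 4) * t" if "0 \<le> t" for t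
      using that by (auto intro!: mult_right_mono)
    show "C11 (\<bar>R\<bar> + 4) (ball 0 R) (z h)"
      unfolding C11_def
    proof (intro conjI ballI exI[of _ g] allI)
      fix w v :: 'a assume w: "w \<in> ball 0 R"
      show "norm (z h w) \<le> \<bar>R\<bar> + 4" using zb[OF w] by simp
      show "(z h has_derivative g w) (at w)" by (rule deriv[OF w])
      show "norm (g w v) \<le> (\<bar>R\<bar> + 4) * norm v"
        using g(4)[OF w, of v] le(1)[of "norm v"] by simp
      fix w' :: 'a assume w': "w' \<in> ball 0 R"
      show "norm (g w v - g w' v) \<le> (\<bar>R\<bar> + 4) * norm (w - w') * norm v"
        using lip[OF w w', of v] le(2)[of "norm (w - w') * norm v"] by (simp add: mult.assoc)
    qed
  qed
  then show "\<exists>B. \<forall>\<^sub>F h in at_right 0. C11 B (ball 0 R) (z h)" by (rule exI)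
qed

text \<open>The field enters the equation with a factor \<open>h\<close>, so closeness of order
  \<open>k\<close> of the fields becomes closeness of order \<open>k + 1\<close> of the solutions.
  The roles are asymmetric: \<open>V\<close> is the smooth Taylor increment, \<open>V'\<close> the
  flow increment, which is known to be Lipschitz only.\<close>

lemma implicit_family_difference:
  fixes V V' z z' :: "real \<Rightarrow> 'a::euclidean_space \<Rightarrow> 'a"
  assumes V: "fam_C11 V" and V': "small_lip 0 V'" and d: "small_lip k (\<lambda>h x. V h x - V' h x)"
    and z: "implicit_family V z" and z': "implicit_family V' z'"
  shows "small_lip (Suc k) (\<lambda>h w. z h w - z' h w)"
proof (rule small_lipI, goal_cases)
  case (1 R)
  obtain B where B: "1 \<le> B" "\<forall>\<^sub>F h in at_right 0. C11 B (ball 0 (R + 1)) (V h)"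
    by (rule fam_C11E[where R = "R + 1", OF V])
  obtain C where C: "1 \<le> C" "\<forall>\<^sub>F h in at_right 0. lip_bound (C * h ^ k) (ball 0 (R + 1)) (\<lambda>x. V h x - V' h x)"
    by (rule small_lipE[where R = "R + 1", OF d])
  have "\<forall>\<^sub>F h in at_right 0. h * B < 1 / 2" by (rule eventually_at_right_mult_less) simp
  with B(2) C(2) implicit_familyD[OF z, of R] implicit_familyD[OF z', of R] eventually_at_right_pos
    implicit_family_lipschitz[OF fam_C11_imp_small_lip[OF V] z, of R]
    implicit_family_lipschitz[OF V' z', of R]
  \<comment> \<open>The Lipschitz estimate has contributions \<open>2\<close> from the difference of
    the fields and \<open>4\<close> from the double difference of \<open>V\<close>; absorbing half
    of the left-hand side doubles their sum to \<open>12\<close>.\<close>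
  have "\<forall>\<^sub>F h in at_right 0. lip_bound ((12 * C) * h ^ Suc k) (ball 0 R) (\<lambda>w. z h w - z' h w)"
  proof eventually_elim
    case (elim h)
    note elim = elim[unfolded lip_bound_def]
    have zb: "z h w \<in> ball 0 (R + 1)" "z' h w \<in> ball 0 (R + 1)" if "w \<in> ball 0 R" for w
      using elim(3,4) that implicit_family_in_ball by blast+
    have hB: "h * (B * t) \<le> 1 / 2 * t" if "0 \<le> t" for t
      using elim(8) mult_right_mono[of "h * B" "1 / 2" t] that by (simp add: mult.assoc)
    have Ch: "0 \<le> C * h ^ Suc k" using C(1) elim(5) by simp
    define D where "D w = z h w - z' h w" for w
    define E where "E x = V h x - V' h x" for x
    have eq: "D w = - (h *\<^sub>R E (z' h w)) - h *\<^sub>R (V h (z h w) - V h (z' h w))" if w: "w \<in> ball 0 R" for w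
    proof -
      have "z h w = w - h *\<^sub>R V h (z h w)" "z' h w = w - h *\<^sub>R V' h (z' h w)"
        using elim(3,4) w by (metis add_diff_cancel_right')+
      then have "D w = (w - h *\<^sub>R V h (z h w)) - (w - h *\<^sub>R V' h (z' h w))" unfolding D_def by metis
      then show ?thesis by (simp add: E_def algebra_simps)
    qed
    have bound: "norm (D w) \<le> 2 * (C * h ^ Suc k)" if w: "w \<in> ball 0 R" for w
    proof -
      have "norm (D w) \<le> h * norm (E (z' h w)) + h * norm (V h (z h w) - V h (z' h w))"
        unfolding eq[OF w] using norm_triangle_ineq4[of "- (h *\<^sub>R E (z' h w))"] elim(5)
        by (metis abs_of_pos norm_minus_cancel norm_scaleR)
      also have "\<dots> \<le> h * (C * h ^ k) + h * (B * norm (D w))"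
        using elim(2,5) zb[OF w] C11_lipschitz[OF elim(1) convex_ball zb[OF w]]
        by (intro add_mono mult_left_mono) (auto simp: D_def E_def)
      also have "\<dots> \<le> h * (C * h ^ k) + 1 / 2 * norm (D w)" by (intro add_left_mono hB) simp
      finally have "norm (D w) \<le> 2 * (h * (C * h ^ k))" by linarith
      then show ?thesis by (simp add: mult_ac)
    qed
    have lip: "norm (D w - D v) \<le> 12 * (C * h ^ Suc k) * norm (w - v)" if w: "w \<in> ball 0 R" and v: "v \<in> ball 0 R" for w v
    proof -
      define N where "N = (V h (z h w) - V h (z' h w)) - (V h (z h v) - V h (z' h v))"
      have "D w - D v = - (h *\<^sub>R (E (z' h w) - E (z' h v))) - h *\<^sub>R N"
        unfolding eq[OF w] eq[OF v] N_def by (simp add: algebra_simps)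
      then have "norm (D w - D v) \<le> h * norm (E (z' h w) - E (z' h v)) + h * norm N"
        using norm_triangle_ineq4[of "- (h *\<^sub>R (E (z' h w) - E (z' h v)))" "h *\<^sub>R N"] elim(5)
        by (metis abs_of_pos norm_minus_cancel norm_scaleR)
      also have "h * norm (E (z' h w) - E (z' h v)) \<le> h * (C * h ^ k * (2 * norm (w - v)))"
      proof (rule mult_left_mono)
        have "norm (E (z' h w) - E (z' h v)) \<le> C * h ^ k * norm (z' h w - z' h v)"
          unfolding E_def using elim(2) zb(2)[OF w] zb(2)[OF v] by blast
        also have "\<dots> \<le> C * h ^ k * (2 * norm (w - v))"
          using elim(7) w v C(1) elim(5) by (intro mult_left_mono) auto
        finally show "norm (E (z' h w) - E (z' h v)) \<le> C * h ^ k * (2 * norm (w - v))" .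
      qed (use elim(5) in simp)
      also have "h * norm N \<le> h * (B * (norm (D w - D v) + (norm (z h w - z h v) + norm (z' h w - z' h v)) * norm (D v)))"
        using C11_double_difference[OF elim(1) convex_ball zb[OF w] zb[OF v]] elim(5)
        by (intro mult_left_mono) (auto simp: D_def N_def algebra_simps)
      also have "\<dots> \<le> 1 / 2 * (norm (D w - D v) + (norm (z h w - z h v) + norm (z' h w - z' h v)) * norm (D v))"
        by (rule hB) simp
      also have "(norm (z h w - z h v) + norm (z' h w - z' h v)) * norm (D v)
          \<le> (2 * norm (w - v) + 2 * norm (w - v)) * (2 * (C * h ^ Suc k))"
        using elim(6,7) w v bound[OF v] by (intro mult_mono add_mono) auto
      finally show ?thesis by (simp add: algebra_simps)
    qed
    show ?case unfolding lip_bound_def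
    proof (intro ballI conjI)
      fix w v :: 'a assume w: "w \<in> ball 0 R" and v: "v \<in> ball 0 R"
      show "norm (z h w - z' h w) \<le> (12 * C) * h ^ Suc k"
        using bound[OF w] Ch unfolding D_def by linarith
      show "norm (z h w - z' h w - (z h v - z' h v)) \<le> (12 * C) * h ^ Suc k * norm (w - v)"
        using lip[OF w v] unfolding D_def by (simp only: mult.assoc)
    qed
  qed
  then show ?case by (rule exI[of _ "12 * C"])
qed

section \<open>Quadrature rules are exact on polynomials\<close>

lemma has_integral_power_0:
  assumes "0 \<le> (h::real)"
  shows "((\<lambda>t. t ^ j) has_integral h ^ Suc j / real (Suc j)) {0..h}"
proof -
  have "((\<lambda>t. t ^ j) has_integral h ^ Suc j / real (Suc j) - 0 ^ Suc j / real (Suc j)) {0..h}"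
  proof (rule fundamental_theorem_of_calculus)
    show "((\<lambda>t. t ^ Suc j / real (Suc j)) has_vector_derivative t ^ j) (at t within {0..h})" for t
      unfolding has_real_derivative_iff_has_vector_derivative[symmetric]
      using DERIV_cdivide[OF DERIV_pow[of "Suc j" t "{0..h}"], of "real (Suc j)"]
      by (simp del: power_Suc of_nat_Suc)
  qed (use assms in simp)
  then show ?thesis by simp
qed

text \<open>On \<open>t ^ j\<close> the rule errs by exactly \<open>h ^ Suc j\<close> times the
  defect \<open>e\<close> of the moment, and for \<open>j < s\<close> this is not
  \<open>O(h ^ (s + 1))\<close> unless \<open>e = 0\<close>. Monomials are smooth of every order, so
  they meet whatever smoothness \<open>quadrature_order\<close> demands.\<close>

lemma quadrature_order_moments:
  assumes "quadrature_order m b c s" "j < s"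
  shows "(\<Sum>i=1..m. b i * c i ^ j) = 1 / (real j + 1)"
proof (rule ccontr)
  define e where "e = 1 / (real j + 1) - (\<Sum>i=1..m. b i * c i ^ j)"
  assume "\<not> ?thesis"
  then have e: "\<bar>e\<bar> > 0" by (simp add: e_def)
  obtain k where k: "\<And>F :: real \<Rightarrow> real. Ck k F \<Longrightarrow>
        (\<lambda>h. integral {0..h} F - h * (\<Sum>i=1..m. b i * F (c i * h))) \<in> O[at_right 0](\<lambda>h. h ^ (s + 1))"
    using assms(1) unfolding quadrature_order_def by blast
  have "Ck k (\<lambda>t :: real. t ^ j)" by (intro Ck_power Ck_id)
  from k[OF this] obtain C where C: "C > 0" "\<forall>\<^sub>F h in at_right 0.
      norm (integral {0..h} (\<lambda>t. t ^ j) - h * (\<Sum>i=1..m. b i * (c i * h) ^ j)) \<le> C * norm (h ^ (s + 1))"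
    by (elim landau_o.bigE)
  have "\<forall>\<^sub>F h in at_right 0. h * C < \<bar>e\<bar>" by (rule eventually_at_right_mult_less[OF e])
  with C(2) eventually_at_right_pos eventually_at_right_less_const[OF zero_less_one]
  have "\<forall>\<^sub>F h :: real in at_right 0. False"
  proof eventually_elim
    case (elim h)
    have int: "integral {0..h} (\<lambda>t. t ^ j) = h ^ Suc j / real (Suc j)"
      using has_integral_power_0[of h j] elim by (simp add: integral_unique)
    have quad: "h * (\<Sum>i=1..m. b i * (c i * h) ^ j) = h ^ Suc j * (\<Sum>i=1..m. b i * c i ^ j)"
      by (simp add: sum_distrib_left power_mult_distrib mult_ac)
    have "integral {0..h} (\<lambda>t. t ^ j) - h * (\<Sum>i=1..m. b i * (c i * h) ^ j) = h ^ Suc j * e"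
      unfolding int quad by (simp add: e_def right_diff_distrib add.commute)
    with elim have "h ^ Suc j * \<bar>e\<bar> \<le> C * h ^ (s + 1)" by (simp add: abs_mult)
    also have "\<dots> \<le> C * h ^ Suc (Suc j)"
      using elim C(1) assms(2) by (intro mult_left_mono power_decreasing) auto
    also have "\<dots> = h ^ Suc j * (h * C)" by simp
    finally have "\<bar>e\<bar> \<le> h * C" using elim by simp
    then show False using elim by simp
  qed
  then show False by simp
qed

section \<open>Hamiltonian vector fields\<close>

lemma GDERIV_unique: "GDERIV f x :> D \<Longrightarrow> GDERIV f x :> D' \<Longrightarrow> D = D'"
proof -
  assume "GDERIV f x :> D" "GDERIV f x :> D'"
  then have "(\<lambda>h. h \<bullet> D) = (\<lambda>h. h \<bullet> D')" unfolding gderiv_def by (rule has_derivative_unique)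
  then have "(D - D') \<bullet> D = (D - D') \<bullet> D'" by metis
  then have "(D - D') \<bullet> (D - D') = 0" by (simp only: inner_diff_right[of "D - D'" D D'] diff_self)
  then show "D = D'" by simp
qed

lemma gradient_eqI: "GDERIV f x :> D \<Longrightarrow> gradient f x = D"
  unfolding gradient_def using GDERIV_unique by (intro the_equality)

text \<open>Given the total derivative, existence and value of the partial gradients reduce to
  equations between vectors. The \<open>GDERIV\<close> conditions of the discrete maps are unfolded
  this way.\<close>

lemma GDERIV_partials:
  fixes f :: "'a::euclidean_space \<Rightarrow> 'b::euclidean_space \<Rightarrow> real"
  assumes "((\<lambda>w. f (fst w) (snd w)) has_derivative (\<lambda>v. v \<bullet> g)) (at w)"
  shows "GDERIV (\<lambda>q. f q (snd w)) (fst w) :> d \<longleftrightarrow> d = fst g"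
    and "GDERIV (\<lambda>p. f (fst w) p) (snd w) :> e \<longleftrightarrow> e = snd g"
proof -
  have f': "((\<lambda>w. f (fst w) (snd w)) has_derivative (\<lambda>v. v \<bullet> g)) (at (fst w, snd w))"
    using assms by simp
  have "((\<lambda>q. f q (snd w)) has_derivative (\<lambda>v. (v, 0) \<bullet> g)) (at (fst w))"
    using has_derivative_compose[where f = "\<lambda>q. (q, snd w)", OF _ f']
    by (simp add: has_derivative_Pair has_derivative_ident)
  then have "GDERIV (\<lambda>q. f q (snd w)) (fst w) :> fst g"
    by (simp add: gderiv_def inner_prod_def)
  then show "GDERIV (\<lambda>q. f q (snd w)) (fst w) :> d \<longleftrightarrow> d = fst g"
    using GDERIV_unique by blast
  have "((\<lambda>p. f (fst w) p) has_derivative (\<lambda>v. (0, v) \<bullet> g)) (at (snd w))"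
    using has_derivative_compose[where f = "\<lambda>p. (fst w, p)", OF _ f']
    by (simp add: has_derivative_Pair has_derivative_ident)
  then have "GDERIV (\<lambda>p. f (fst w) p) (snd w) :> snd g"
    by (simp add: gderiv_def inner_prod_def)
  then show "GDERIV (\<lambda>p. f (fst w) p) (snd w) :> e \<longleftrightarrow> e = snd g"
    using GDERIV_unique by blast
qed

text \<open>The gradient represents the derivative as an inner product; testing the operator bounds
  with the gradient, or with a difference of gradients, carries them over with the same
  constant.\<close>

lemma fam_C11_gradient:
  fixes K :: "real \<Rightarrow> 'a::euclidean_space \<Rightarrow> real"
  assumes K: "fam_C11 K"
  shows "\<forall>\<^sub>F h in at_right 0. \<forall>w\<in>ball 0 R. GDERIV (K h) w :> gradient (K h) w"
    and "small_lip 0 (\<lambda>h w. gradient (K h) w)"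
proof -
  have main: "(\<forall>w\<in>S. GDERIV f w :> gradient f w) \<and>
      (\<forall>w\<in>S. norm (gradient f w) \<le> B \<and> (\<forall>v\<in>S. norm (gradient f w - gradient f v) \<le> B * norm (w - v)))"
    if f: "C11 B S f" and B: "1 \<le> B" for B S and f :: "'a \<Rightarrow> real"
  proof -
    obtain f' where f': "\<And>x. x \<in> S \<Longrightarrow> (f has_derivative f' x) (at x)"
      "\<And>x v. x \<in> S \<Longrightarrow> norm (f' x v) \<le> B * norm v"
      "\<And>x y v. x \<in> S \<Longrightarrow> y \<in> S \<Longrightarrow> norm (f' x v - f' y v) \<le> B * norm (x - y) * norm v"
      using f unfolding C11_def by blast
    have lin: "linear (f' x)" if "x \<in> S" for x
      using f'(1)[OF that] by (rule has_derivative_linear)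
    have f'_eq: "f' x = (\<lambda>v. v \<bullet> (\<Sum>i\<in>Basis. f' x i *\<^sub>R i))" if "x \<in> S" for x
    proof
      show "f' x v = v \<bullet> (\<Sum>i\<in>Basis. f' x i *\<^sub>R i)" for v
        using linear_Basis_expansion[OF lin[OF that], of v] by (simp add: inner_sum_right mult.commute)
    qed
    have G: "GDERIV f x :> (\<Sum>i\<in>Basis. f' x i *\<^sub>R i)" if "x \<in> S" for x
      unfolding gderiv_def using f'(1)[OF that] f'_eq[OF that] by simp
    have G': "gradient f x = (\<Sum>i\<in>Basis. f' x i *\<^sub>R i)" if "x \<in> S" for x
      by (rule gradient_eqI[OF G[OF that]])
    have inner: "f' x v = v \<bullet> gradient f x" if "x \<in> S" for x v
      using f'_eq[OF that] G'[OF that] by metis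
    have bound: "norm d \<le> b" if "norm (d \<bullet> d) \<le> b * norm d" "0 \<le> b" for d :: 'a and b
      using that by (cases "d = 0") (auto simp: dot_square_norm power2_eq_square)
    show ?thesis
    proof (intro conjI ballI)
      fix w assume w: "w \<in> S"
      show "GDERIV f w :> gradient f w" using G[OF w] G'[OF w] by simp
      show "norm (gradient f w) \<le> B"
        using f'(2)[OF w, of "gradient f w"] B by (intro bound) (simp_all add: inner[OF w])
      fix v assume v: "v \<in> S"
      show "norm (gradient f w - gradient f v) \<le> B * norm (w - v)"
        using f'(3)[OF w v, of "gradient f w - gradient f v"] B
        by (intro bound) (simp_all add: inner[OF w] inner[OF v] inner_diff_right)
    qed
  qed
  have ev: "\<exists>B\<ge>1. \<forall>\<^sub>F h in at_right 0. C11 B (ball 0 R) (K h)" for R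
    by (rule fam_C11E[where R = R, OF K]) blast
  show "\<forall>\<^sub>F h in at_right 0. \<forall>w\<in>ball 0 R. GDERIV (K h) w :> gradient (K h) w"
  proof -
    obtain B where B: "1 \<le> B" "\<forall>\<^sub>F h in at_right 0. C11 B (ball 0 R) (K h)" using ev by blast
    from B(2) show ?thesis by (rule eventually_mono) (use main[OF _ B(1)] in blast)
  qed
  show "small_lip 0 (\<lambda>h w. gradient (K h) w)"
  proof (rule small_lipI, goal_cases)
    case (1 R)
    obtain B where B: "1 \<le> B" "\<forall>\<^sub>F h in at_right 0. C11 B (ball 0 R) (K h)" using ev by blast
    from B(2) have "\<forall>\<^sub>F h in at_right 0. lip_bound (B * h ^ 0) (ball 0 R) (\<lambda>x. gradient (K h) x)"
      by (rule eventually_mono) (use main[OF _ B(1)] in \<open>simp add: lip_bound_def\<close>)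
    then show ?case by (rule exI[of _ B])
  qed
qed

text \<open>Here the Lipschitz seminorm pays off: a small Lipschitz constant of a difference bounds
  the difference of the derivatives. The same lemma bounds the Hamiltonian vector field by the
  Lipschitz constant of \<open>H\<close>.\<close>

lemma has_derivative_norm_le_lipschitz:
  fixes f :: "'a::real_normed_vector \<Rightarrow> 'b::real_normed_vector"
  assumes f: "(f has_derivative f') (at x)" and S: "open S" "x \<in> S"
    and lip: "\<And>y. y \<in> S \<Longrightarrow> norm (f y - f x) \<le> C * norm (y - x)"
  shows "norm (f' v) \<le> C * norm v"
proof (cases "v = 0")
  case False
  obtain r where r: "r > 0" "ball x r \<subseteq> S" using S openE by blast
  have lin: "linear f'" using f by (rule has_derivative_linear)
  have "norm (f' v) / norm v \<le> C + e" if e: "e > 0" for e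
  proof -
    obtain d where d: "d > 0" "\<And>y. norm (y - x) < d \<Longrightarrow> norm (f y - f x - f' (y - x)) \<le> e * norm (y - x)"
      using f e unfolding has_derivative_at_alt by blast
    define t where "t = min d r / 2 / norm v"
    have t: "t > 0" using d r False by (simp add: t_def)
    have tv: "norm (t *\<^sub>R v) = min d r / 2" using d r False by (simp add: t_def)
    then have "norm (t *\<^sub>R v) < d" "norm (t *\<^sub>R v) < r" using d r by auto
    then have "norm (f (x + t *\<^sub>R v) - f x - f' (t *\<^sub>R v)) \<le> e * norm (t *\<^sub>R v)"
      "norm (f (x + t *\<^sub>R v) - f x) \<le> C * norm (t *\<^sub>R v)"
      using d(2)[of "x + t *\<^sub>R v"] lip[of "x + t *\<^sub>R v"] r(2) by (auto simp: dist_norm subset_iff)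
    then have "norm (f' (t *\<^sub>R v)) \<le> (C + e) * norm (t *\<^sub>R v)"
      using norm_triangle_ineq4[of "f (x + t *\<^sub>R v) - f x" "f (x + t *\<^sub>R v) - f x - f' (t *\<^sub>R v)"]
      by (simp add: distrib_right)
    then have "t * norm (f' v) \<le> t * ((C + e) * norm v)"
      using t lin by (simp add: linear_cmul mult_ac)
    then show ?thesis using t False by (simp add: divide_le_eq)
  qed
  then have "norm (f' v) / norm v \<le> C" by (rule field_le_epsilon)
  then show ?thesis using False by (simp add: divide_le_eq)
qed (use linear_0[OF has_derivative_linear[OF f]] in simp)

section \<open>Partial gradients and vector field of a smooth Hamiltonian\<close>

context
  fixes H :: "'q::euclidean_space \<times> 'q \<Rightarrow> real" and k :: nat
  assumes H: "Ck (Suc k) H"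
begin

text \<open>The partial gradients are defined by a description; as finite sums of directional
  derivatives of \<open>H\<close> they inherit its smoothness.\<close>

lemma dH_eqs:
  "dH_dq H z = (\<Sum>i\<in>Basis. frechet_derivative H (at z) (i, 0) *\<^sub>R i)"
  "dH_dp H z = (\<Sum>i\<in>Basis. frechet_derivative H (at z) (0, i) *\<^sub>R i)"
proof -
  have H': "(H has_derivative frechet_derivative H (at (fst z, snd z))) (at (fst z, snd z))"
    using Ck_Suc_has_derivative[OF H, of "(fst z, snd z)"] .
  then have lin: "linear (frechet_derivative H (at (fst z, snd z)))" by (rule has_derivative_linear)
  have "((\<lambda>q. H (q, snd z)) has_derivative (\<lambda>v. frechet_derivative H (at (fst z, snd z)) (v, 0))) (at (fst z))"
    by (rule has_derivative_compose[where f = "\<lambda>q. (q, snd z)" and g = H, OF _ H']) (auto intro!: derivative_eq_intros)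
  note d = this
  have "frechet_derivative H (at z) (v, 0) = v \<bullet> (\<Sum>i\<in>Basis. frechet_derivative H (at z) (i, 0) *\<^sub>R i)" for v
    using linear_Basis_expansion[OF has_derivative_linear[OF d], of v] by (simp add: inner_sum_right mult.commute)
  note expand = has_derivative_eq_rhs[OF d[unfolded prod.collapse] ext, OF this]
  have "GDERIV (\<lambda>q. H (q, snd z)) (fst z) :> (\<Sum>i\<in>Basis. frechet_derivative H (at z) (i, 0) *\<^sub>R i)"
    unfolding gderiv_def by (rule expand)
  then show "dH_dq H z = (\<Sum>i\<in>Basis. frechet_derivative H (at z) (i, 0) *\<^sub>R i)"
    unfolding dH_dq_def by (rule gradient_eqI)
  have "((\<lambda>p. H (fst z, p)) has_derivative (\<lambda>v. frechet_derivative H (at (fst z, snd z)) (0, v))) (at (snd z))"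
    by (rule has_derivative_compose[where f = "\<lambda>p. (fst z, p)" and g = H, OF _ H']) (auto intro!: derivative_eq_intros)
  note d = this
  have "frechet_derivative H (at z) (0, v) = v \<bullet> (\<Sum>i\<in>Basis. frechet_derivative H (at z) (0, i) *\<^sub>R i)" for v
    using linear_Basis_expansion[OF has_derivative_linear[OF d], of v] by (simp add: inner_sum_right mult.commute)
  note expand = has_derivative_eq_rhs[OF d[unfolded prod.collapse] ext, OF this]
  have "GDERIV (\<lambda>p. H (fst z, p)) (snd z) :> (\<Sum>i\<in>Basis. frechet_derivative H (at z) (0, i) *\<^sub>R i)"
    unfolding gderiv_def by (rule expand)
  then show "dH_dp H z = (\<Sum>i\<in>Basis. frechet_derivative H (at z) (0, i) *\<^sub>R i)"
    unfolding dH_dp_def by (rule gradient_eqI)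
qed

lemma frechet_derivative_eq_dH:
  "frechet_derivative H (at z) (u, v) = u \<bullet> dH_dq H z + v \<bullet> dH_dp H z"
proof -
  have lin: "linear (frechet_derivative H (at z))"
    using Ck_Suc_has_derivative[OF H] by (rule has_derivative_linear)
  then have l: "linear (\<lambda>u. frechet_derivative H (at z) (u, 0))" "linear (\<lambda>v. frechet_derivative H (at z) (0, v))"
    using linear_compose[of "\<lambda>u. (u, 0)" "frechet_derivative H (at z)"]
      linear_compose[of "\<lambda>v. (0, v)" "frechet_derivative H (at z)"]
    by (auto simp: o_def linear_iff)
  have "frechet_derivative H (at z) (u, v) = frechet_derivative H (at z) ((u, 0) + (0, v))" by simp
  also have "\<dots> = frechet_derivative H (at z) (u, 0) + frechet_derivative H (at z) (0, v)"
    by (rule linear_add[OF lin])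
  finally show ?thesis
    using linear_Basis_expansion[OF l(1), of u] linear_Basis_expansion[OF l(2), of v]
    by (simp add: dH_eqs inner_sum_right mult.commute)
qed

lemma Ck_dH_dq: "Ck k (dH_dq H)" and Ck_dH_dp: "Ck k (dH_dp H)"
proof -
  have "Ck k (\<lambda>z. \<Sum>i\<in>Basis. frechet_derivative H (at z) (i, 0) *\<^sub>R i)"
    "Ck k (\<lambda>z. \<Sum>i\<in>Basis. frechet_derivative H (at z) (0, i) *\<^sub>R i)"
    using H by (intro Ck_sum Ck_scaleR Ck_const; simp)+
  then show "Ck k (dH_dq H)" "Ck k (dH_dp H)" by (simp_all add: dH_eqs[abs_def])
qed

lemma Ck_ham_vf: "Ck k (ham_vf H)"
  unfolding ham_vf_def[abs_def] by (intro Ck_Pair Ck_uminus Ck_dH_dq Ck_dH_dp)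

text \<open>Lipschitz continuity of \<open>H\<close> enters here: it bounds both partial gradients,
  and a bounded vector field has solutions for all times.\<close>

lemma norm_ham_vf_le:
  assumes "L-lipschitz_on UNIV H"
  shows "norm (ham_vf H z) \<le> 2 * L"
proof -
  have L: "norm (frechet_derivative H (at z) v) \<le> L * norm v" for v
  proof (rule has_derivative_norm_le_lipschitz[OF Ck_Suc_has_derivative[OF H], of UNIV])
    show "norm (H y - H z) \<le> L * norm (y - z)" for y
      using lipschitz_onD[OF assms, of y z] by (simp only: dist_norm UNIV_I)
  qed simp_all
  have le: "norm d \<le> L" if "d \<bullet> d \<le> L * norm d" for d :: 'q
    using that assms lipschitz_on_nonneg
    by (cases "d = 0") (auto simp: dot_square_norm power2_eq_square)
  have "norm (dH_dq H z) \<le> L" "norm (dH_dp H z) \<le> L"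
    using L[of "(dH_dq H z, 0)"] L[of "(0, dH_dp H z)"]
    by (auto intro!: le simp: frechet_derivative_eq_dH norm_Pair)
  moreover have "norm (ham_vf H z) \<le> norm (dH_dp H z) + norm (- dH_dq H z)"
    unfolding ham_vf_def by (rule norm_Pair_le)
  ultimately show ?thesis by simp
qed

end

section \<open>Taylor increments\<close>

context bounded_C1_field
begin

text \<open>The Taylor step minus its starting point, divided by \<open>h\<close> and written as a
  polynomial in \<open>h\<close>, so that nothing singular happens at \<open>h = 0\<close>. Its
  counterpart \<open>flow_incr\<close> is a genuine quotient, of interest for \<open>h > 0\<close>
  only.\<close>

definition taylor_incr :: "nat \<Rightarrow> real \<Rightarrow> 'a \<Rightarrow> 'a" where
  "taylor_incr \<rho> h z = (\<Sum>j<\<rho>. (h ^ j / fact (Suc j)) *\<^sub>R (lie X ^^ j) X z)"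

definition flow_incr :: "real \<Rightarrow> 'a \<Rightarrow> 'a" where
  "flow_incr h z = (1 / h) *\<^sub>R (flow X z h - z)"

lemma taylor_eq:
  assumes "Ck \<rho> X"
  shows "taylor X \<rho> h z = z + h *\<^sub>R taylor_incr \<rho> h z"
proof -
  have "(\<Sum>k=1..\<rho>. (h ^ k / fact k) *\<^sub>R time_deriv X (k - 1) z) =
      (\<Sum>j<\<rho>. (h ^ Suc j / fact (Suc j)) *\<^sub>R time_deriv X j z)"
    by (rule sum.reindex_bij_witness[of _ Suc "\<lambda>k. k - 1"]) auto
  also have "\<dots> = (\<Sum>j<\<rho>. (h ^ Suc j / fact (Suc j)) *\<^sub>R (lie X ^^ j) X z)"
    using assms by (intro sum.cong) (auto simp del: Ck.simps intro!: arg_cong2[where f = "(*\<^sub>R)"] time_deriv_eq_lie Ck_mono[OF assms])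
  finally show ?thesis
    by (simp add: taylor_def taylor_incr_def scaleR_sum_right del: fact_Suc)
qed

text \<open>The highest term has \<open>\<rho> - 1\<close> Lie derivatives, which leaves two of the
  \<open>\<rho> + 1\<close> derivatives of \<open>X\<close>.\<close>

lemma Ck_taylor_incr:
  assumes "Ck (\<rho> + 1) X"
  shows "Ck 2 (\<lambda>p. taylor_incr \<rho> (c * fst p) (snd p))"
  unfolding taylor_incr_def
proof (intro Ck_sum Ck_scaleR)
  fix j assume j: "j \<in> {..<\<rho>}"
  have "Ck 2 ((lie X ^^ j) X)"
    by (rule Ck_lie_funpow) (use j assms in \<open>auto intro: Ck_mono simp del: Ck.simps\<close>)
  then show "Ck 2 (\<lambda>p :: real \<times> 'a. (lie X ^^ j) X (snd p))"
    by (rule Ck_compose) (rule Ck_snd[OF Ck_id])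
  have "Ck 2 (\<lambda>p :: real \<times> 'a. (c * fst p) ^ j * (1 / fact (Suc j)))"
    by (intro Ck_mult Ck_power Ck_const Ck_fst Ck_id)
  then show "Ck 2 (\<lambda>p :: real \<times> 'a. (c * fst p) ^ j / fact (Suc j))" by (simp del: fact_Suc)
qed

lemma lie_ident: "lie X (\<lambda>x. x) = X"
  by (simp add: lie_def[abs_def])

text \<open>The Lie derivative of the identity is \<open>X\<close>, so the Lie iterates of the
  identity are those of \<open>X\<close> shifted by one; hence \<open>Suc \<rho>\<close> terms for a
  method of order \<open>\<rho>\<close>.\<close>

lemma flow_minus_taylor:
  assumes "Ck \<rho> X"
  shows "flow X z h - taylor X \<rho> h z = flow_remainder (\<lambda>x. x) (Suc \<rho>) h z"
  unfolding taylor_eq[OF assms] taylor_incr_def flow_remainder_def sum.lessThan_Suc_shift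
  by (simp add: funpow_Suc_right lie_ident scaleR_sum_right del: fact_Suc funpow.simps)

lemma small_lip_rem:
  assumes "Ck (N + 1) G" "Ck (N + 1) X"
  shows "small_lip N (\<lambda>h z. flow_remainder G N (c * h) z)"
proof (rule small_lipI, goal_cases)
  case (1 R)
  obtain C where C: "0 \<le> C" "\<And>t x y. \<bar>t\<bar> \<le> 1 \<Longrightarrow> x \<in> cball 0 R \<Longrightarrow> y \<in> cball 0 R \<Longrightarrow>
      norm (flow_remainder G N t x) \<le> C * \<bar>t\<bar> ^ N \<and> norm (flow_remainder G N t x - flow_remainder G N t y) \<le> C * \<bar>t\<bar> ^ N * norm (x - y)"
    using flow_remainder_bound[OF assms, of 1 R] by auto
  have "\<forall>\<^sub>F h in at_right 0. h * \<bar>c\<bar> < 1" by (rule eventually_at_right_mult_less) simp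
  with eventually_at_right_pos
  have "\<forall>\<^sub>F h in at_right 0. lip_bound ((C * \<bar>c\<bar> ^ N) * h ^ N) (ball 0 R) (flow_remainder G N (c * h))"
  proof eventually_elim
    case (elim h)
    note elim = elim[unfolded lip_bound_def]
    have "\<bar>c * h\<bar> \<le> 1" "\<bar>c * h\<bar> ^ N = \<bar>c\<bar> ^ N * h ^ N"
      using elim by (auto simp: abs_mult power_mult_distrib mult.commute)
    then have "norm (flow_remainder G N (c * h) x) \<le> (C * \<bar>c\<bar> ^ N) * h ^ N"
      "norm (flow_remainder G N (c * h) x - flow_remainder G N (c * h) y) \<le> (C * \<bar>c\<bar> ^ N) * h ^ N * norm (x - y)"
      if "x \<in> ball 0 R" "y \<in> ball 0 R" for x y
      using C(2)[of "c * h" x y] that by (simp_all add: mult.assoc)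
    then show ?case unfolding lip_bound_def by blast
  qed
  then show ?case by (rule exI[of _ "C * \<bar>c\<bar> ^ N"])
qed

text \<open>The remainder is of order \<open>\<rho> + 1\<close>; dividing by the step size costs one
  power.\<close>

lemma small_lip_taylor_incr_minus_flow_incr:
  assumes "Ck (\<rho> + 2) X"
  shows "small_lip \<rho> (\<lambda>h z. taylor_incr \<rho> h z - flow_incr h z)"
proof (rule small_lip_cong)
  have "small_lip (Suc \<rho>) (\<lambda>h z. flow_remainder (\<lambda>x. x) (Suc \<rho>) (1 * h) z)"
    using assms by (intro small_lip_rem Ck_id) simp
  then show "small_lip \<rho> (\<lambda>h z. - ((1 / h) *\<^sub>R flow_remainder (\<lambda>x. x) (Suc \<rho>) (1 * h) z))"
    by (intro small_lip_uminus small_lip_scale_inverse)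
  have "- ((1 / h) *\<^sub>R flow_remainder (\<lambda>x. x) (Suc \<rho>) (1 * h) z) = taylor_incr \<rho> h z - flow_incr h z"
    if "0 < h" for h z
    using that flow_minus_taylor[of \<rho> z h] taylor_eq[of \<rho> h z] Ck_mono[OF assms, of \<rho>]
    by (simp add: flow_incr_def field_simps del: Ck.simps)
  then show "\<forall>\<^sub>F h in at_right 0. \<forall>z\<in>ball 0 R.
      - ((1 / h) *\<^sub>R flow_remainder (\<lambda>x. x) (Suc \<rho>) (1 * h) z) = taylor_incr \<rho> h z - flow_incr h z" for R
    using eventually_at_right_pos by (auto elim: eventually_mono)
qed

lemma fam_C11_taylor_incr:
  assumes "Ck (\<rho> + 1) X" shows "fam_C11 (taylor_incr \<rho>)"
  using fam_C11_of_Ck[OF Ck_taylor_incr[OF assms, of 1]] by simp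

text \<open>Bounds on the flow alone would not survive the division by \<open>h\<close>. The
  increment is instead written as the smooth increment of the first-order method minus an error of
  order \<open>1\<close>.\<close>

lemma small_lip_flow_incr:
  assumes "Ck 3 X" shows "small_lip 0 flow_incr"
proof (rule small_lip_cong)
  have "Ck (1 + 1) X" "Ck (1 + 2) X" by (rule Ck_mono[OF assms], simp)+
  then show "small_lip 0 (\<lambda>h z. taylor_incr 1 h z - (taylor_incr 1 h z - flow_incr h z))"
    by (intro small_lip_diff[OF fam_C11_imp_small_lip[OF fam_C11_taylor_incr]]
      small_lip_mono[OF small_lip_taylor_incr_minus_flow_incr]) simp_all
qed simp

end

section \<open>Lipschitz Hamiltonians\<close>

text \<open>Order \<open>r + s + 5\<close> for \<open>H\<close> leaves \<open>r + s + 4\<close>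
  derivatives of the vector field and of the Lagrangian. This covers at once the
  \<open>r + 3\<close> of the increment error of order \<open>r + 1\<close>, the
  \<open>s + 1\<close> of the Lagrangian remainder and the \<open>3\<close> of
  \<open>small_lip_flow_incr\<close>.\<close>

locale lipschitz_hamiltonian =
  fixes H :: "'q::euclidean_space \<times> 'q \<Rightarrow> real" and L :: real
    and r s m :: nat and b c :: "nat \<Rightarrow> real"
  assumes H_smooth: "Ck (r + s + 5) H"
    and H_lipschitz: "L-lipschitz_on UNIV H"
    and quadrature: "quadrature_order m b c s"
begin

abbreviation X :: "'q \<times> 'q \<Rightarrow> 'q \<times> 'q" where "X \<equiv> ham_vf H"

lemma H_C: "k \<le> r + s + 5 \<Longrightarrow> Ck k H"
  by (rule Ck_mono[OF H_smooth])

lemma X_C: "k \<le> r + s + 4 \<Longrightarrow> Ck k X"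
  by (rule Ck_ham_vf, rule H_C) simp

sublocale bounded_C1_field X "2 * L"
  using X_C[of 1] norm_ham_vf_le[OF H_C H_lipschitz] by unfold_locales auto

section \<open>Mean of the Lagrangian along the flow and its quadrature\<close>

definition lagrangian :: "'q \<times> 'q \<Rightarrow> real" where
  "lagrangian z = snd z \<bullet> dH_dp H z - H z"

lemma lagrangian_C: "k \<le> r + s + 4 \<Longrightarrow> Ck k lagrangian"
  unfolding lagrangian_def[abs_def]
  by (intro Ck_diff Ck_inner Ck_snd Ck_id Ck_dH_dp H_C) simp_all

definition quad_mean :: "real \<Rightarrow> 'q \<times> 'q \<Rightarrow> real" where
  "quad_mean h z = (\<Sum>i=1..m. b i * lagrangian (taylor X r (c i * h) z))"

definition exact_mean :: "real \<Rightarrow> 'q \<times> 'q \<Rightarrow> real" where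
  "exact_mean h z = (1 / h) * integral {0..h} (\<lambda>t. lagrangian (flow X z t))"

lemma lagrangian_flow_continuous: "continuous_on S (\<lambda>t. lagrangian (flow X z t))"
  by (rule continuous_on_compose2[OF Ck_imp_continuous[OF lagrangian_C[OF le0]] flow_continuous]) simp

lemma action_eq: "action H h (flow X z) = integral {0..h} (\<lambda>t. lagrangian (flow X z t))"
proof -
  have "((\<lambda>\<tau>. fst (flow X z \<tau>)) has_vector_derivative dH_dp H (flow X z t)) (at t)" for t
    using bounded_linear.has_vector_derivative[OF bounded_linear_fst flow_deriv, of z t] by (simp add: ham_vf_def)
  from vector_derivative_at[OF this] show ?thesis by (simp add: action_def lagrangian_def)
qed

lemma quadrature_action_eq: "quadrature_action H r m b c h z = h * quad_mean h z"
  by (simp add: quadrature_action_def quad_mean_def lagrangian_def Let_def)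

lemma Ck_taylor: "Ck 2 (\<lambda>p. taylor X r (d * fst p) (snd p))"
proof -
  have "Ck 2 (\<lambda>p. snd p + (d * fst p) *\<^sub>R taylor_incr r (d * fst p) (snd p))"
    by (intro Ck_add Ck_scaleR Ck_mult Ck_const Ck_fst Ck_snd Ck_id Ck_taylor_incr X_C) simp
  then show ?thesis by (simp add: taylor_eq[OF X_C])
qed

lemma Ck_quad_mean: "Ck 2 (\<lambda>p. quad_mean (fst p) (snd p))"
  unfolding quad_mean_def
  by (intro Ck_sum Ck_mult Ck_const Ck_compose[OF lagrangian_C Ck_taylor]) simp

lemma small_lip_rem_mean:
  assumes "Ck (N + 1) G" "Ck (N + 1) X"
  shows "small_lip N (\<lambda>h z. (1 / h) * integral {0..h} (\<lambda>t. flow_remainder G N t z :: real))"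
proof (rule small_lipI, goal_cases)
  case (1 R)
  obtain C where C: "0 \<le> C" "\<And>t x y. \<bar>t\<bar> \<le> 1 \<Longrightarrow> x \<in> cball 0 R \<Longrightarrow> y \<in> cball 0 R \<Longrightarrow>
      norm (flow_remainder G N t x) \<le> C * \<bar>t\<bar> ^ N \<and> norm (flow_remainder G N t x - flow_remainder G N t y) \<le> C * \<bar>t\<bar> ^ N * norm (x - y)"
    using flow_remainder_bound[OF assms, of 1 R] by auto
  have cont: "continuous_on S (\<lambda>t. flow_remainder G N t z)" for S z
    using flow_remainder_continuous[OF Ck_imp_continuous[OF assms(1)]] .
  have "\<forall>\<^sub>F h in at_right 0. lip_bound (C * h ^ N) (ball 0 R) (\<lambda>x. (1 / h) * integral {0..h} (\<lambda>t. flow_remainder G N t x))"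
    using eventually_at_right_pos eventually_at_right_less_const[OF zero_less_one]
  proof eventually_elim
    case (elim h)
    note elim = elim[unfolded lip_bound_def]
    have mean: "norm ((1 / h) * u) \<le> B" if "norm u \<le> B * (h - 0)" for u B :: real
      using that elim(1) by (simp add: divide_le_eq abs_mult)
    have pow: "C * \<bar>t\<bar> ^ N * d \<le> C * h ^ N * d" if "t \<in> {0..h}" "0 \<le> d" for t d
      using that C(1) by (intro mult_right_mono mult_left_mono power_mono) auto
    show ?case unfolding lip_bound_def
    proof (intro ballI conjI)
      fix x y :: "'q \<times> 'q" assume x: "x \<in> ball 0 R" and y: "y \<in> ball 0 R"
      have xy: "x \<in> cball 0 R" "y \<in> cball 0 R" using x y by auto
      show "norm ((1 / h) * integral {0..h} (\<lambda>t. flow_remainder G N t x)) \<le> C * h ^ N"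
      proof (intro mean integral_bound cont)
        fix t assume t: "t \<in> {0..h}"
        show "norm (flow_remainder G N t x) \<le> C * h ^ N"
          using C(2)[OF _ xy, of t] pow[OF t zero_le_one] t elim by fastforce
      qed (use elim in simp)
      have "norm ((1 / h) * integral {0..h} (\<lambda>t. flow_remainder G N t x - flow_remainder G N t y)) \<le> C * h ^ N * norm (x - y)"
      proof (intro mean integral_bound continuous_on_diff cont)
        fix t assume t: "t \<in> {0..h}"
        show "norm (flow_remainder G N t x - flow_remainder G N t y) \<le> C * h ^ N * norm (x - y)"
          using C(2)[OF _ xy, of t] pow[OF t norm_ge_zero[of "x - y"]] t elim by fastforce
      qed (use elim in simp)
      also have "integral {0..h} (\<lambda>t. flow_remainder G N t x - flow_remainder G N t y) =
          integral {0..h} (\<lambda>t. flow_remainder G N t x) - integral {0..h} (\<lambda>t. flow_remainder G N t y)"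
        by (intro integral_diff integrable_continuous_real cont)
      finally show "norm ((1 / h) * integral {0..h} (\<lambda>t. flow_remainder G N t x) - (1 / h) * integral {0..h} (\<lambda>t. flow_remainder G N t y))
        \<le> C * h ^ N * norm (x - y)" by (simp only: right_diff_distrib)
    qed
  qed
  then show ?case by (rule exI[of _ C])
qed

text \<open>By the moment identities the rule integrates the Taylor polynomial of the Lagrangian
  without error, so only remainders are left, at the nodes and under the integral. As an identity it
  carries no constant depending on \<open>z\<close>.\<close>

lemma exact_mean_expansion:
  assumes h: "0 < h"
  shows "exact_mean h z = (\<Sum>i=1..m. b i * (lagrangian (flow X z (c i * h)) - flow_remainder lagrangian s (c i * h) z))
    + (1 / h) * integral {0..h} (\<lambda>t. flow_remainder lagrangian s t z)"
proof -
  define D where "D j = (lie X ^^ j) lagrangian z" for j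
  define P where "P t = (\<Sum>j<s. t ^ j / fact j * D j)" for t
  have F: "lagrangian (flow X z t) = P t + flow_remainder lagrangian s t z" for t
    by (simp add: flow_remainder_def P_def D_def)
  have "((\<lambda>t. \<Sum>j<s. t ^ j * (D j / fact j)) has_integral (\<Sum>j<s. h ^ Suc j / real (Suc j) * (D j / fact j))) {0..h}"
    by (intro has_integral_sum has_integral_mult_left has_integral_power_0) (use h in auto)
  then have P: "(P has_integral (\<Sum>j<s. h ^ Suc j / real (Suc j) * (D j / fact j))) {0..h}"
    by (simp add: P_def[abs_def])
  have "(\<Sum>i=1..m. b i * P (c i * h)) = (\<Sum>i=1..m. \<Sum>j<s. b i * c i ^ j * (h ^ j * (D j / fact j)))"
    by (simp add: P_def sum_distrib_left power_mult_distrib mult_ac)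
  also have "\<dots> = (\<Sum>j<s. (\<Sum>i=1..m. b i * c i ^ j) * (h ^ j * (D j / fact j)))"
    by (subst sum.swap) (simp only: sum_distrib_right)
  also have "\<dots> = (\<Sum>j<s. 1 / (real j + 1) * (h ^ j * (D j / fact j)))"
    using quadrature_order_moments[OF quadrature] by (intro sum.cong refl) simp
  also have "\<dots> = (1 / h) * integral {0..h} P"
    unfolding integral_unique[OF P] sum_distrib_left
    using h by (intro sum.cong refl) (simp add: field_simps)
  finally have quad: "(1 / h) * integral {0..h} P = (\<Sum>i=1..m. b i * P (c i * h))" by simp
  have "integral {0..h} (\<lambda>t. lagrangian (flow X z t)) = integral {0..h} P + integral {0..h} (\<lambda>t. flow_remainder lagrangian s t z)"
    unfolding F
    by (intro integral_add has_integral_integrable[OF P] integrable_continuous_real flow_remainder_continuous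
        Ck_imp_continuous[OF lagrangian_C[OF le0]])
  then show ?thesis unfolding exact_mean_def distrib_left quad F by (simp only: distrib_left quad add_diff_cancel_right')
qed

text \<open>Three errors are added: the Taylor method in place of the flow at the nodes, of order
  \<open>r + 1\<close>, and the remainder of the Lagrangian, of order \<open>s\<close> both at the
  nodes and under the integral.\<close>

lemma small_lip_quad_mean_minus_exact_mean:
  "small_lip (min (r + 1) s) (\<lambda>h z. quad_mean h z - exact_mean h z)"
proof (rule small_lip_cong)
  define k where "k = min (r + 1) s"
  have lag: "Ck (s + 1) lagrangian" "Ck (s + 1) X" "Ck (r + 2) X" by (intro lagrangian_C X_C; simp)+
  have T: "fam_C11 (\<lambda>h z. taylor X r (d * h) z)" for d
    using fam_C11_of_Ck[OF Ck_taylor[of d]] by simp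
  have rem_id: "small_lip (r + 1) (\<lambda>h z. flow_remainder (\<lambda>x. x) (r + 1) (d * h) z)" for d
    using lag(3) by (intro small_lip_rem Ck_id) simp
  have flow_eq: "flow X z (d * h) = taylor X r (d * h) z + flow_remainder (\<lambda>x. x) (r + 1) (d * h) z" for d h z
    using flow_minus_taylor[OF X_C, of r z "d * h"] by (simp add: algebra_simps)
  have T0: "small_lip 0 (\<lambda>h z. taylor X r (d * h) z)" for d by (rule fam_C11_imp_small_lip[OF T])
  have fl: "small_lip 0 (\<lambda>h z. flow X z (d * h))" for d
    unfolding flow_eq by (intro small_lip_add T0 small_lip_mono[OF rem_id]) simp
  have "fam_C11 (\<lambda>h :: real. lagrangian)"
    using fam_C11_of_Ck[OF Ck_compose[OF lagrangian_C Ck_snd[OF Ck_id]]] by simp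
  then have "small_lip (r + 1) (\<lambda>h z. lagrangian (taylor X r (d * h) z) - lagrangian (flow X z (d * h)))" for d
  proof (rule small_lip_C11_difference[OF _ T0 fl])
    have "small_lip (r + 1) (\<lambda>h z. - flow_remainder (\<lambda>x. x) (r + 1) (d * h) z)" by (intro small_lip_uminus rem_id)
    then show "small_lip (r + 1) (\<lambda>h z. taylor X r (d * h) z - flow X z (d * h))"
      by (simp add: flow_eq)
  qed
  then have "small_lip k (\<lambda>h z. lagrangian (taylor X r (d * h) z) - lagrangian (flow X z (d * h)))" for d
    by (rule small_lip_mono) (simp add: k_def)
  moreover have "small_lip k (\<lambda>h z. flow_remainder lagrangian s (d * h) z)" for d
    by (rule small_lip_mono[OF small_lip_rem[OF lag(1,2)]]) (simp add: k_def)
  ultimately have "small_lip k (\<lambda>h z. b i * (lagrangian (taylor X r (c i * h) z)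
      - lagrangian (flow X z (c i * h)) + flow_remainder lagrangian s (c i * h) z))" for i
    by (rule small_lip_bounded_linear[OF bounded_linear_mult_right small_lip_add])
  moreover have "small_lip k (\<lambda>h z. (1 / h) * integral {0..h} (\<lambda>t. flow_remainder lagrangian s t z))"
    by (rule small_lip_mono[OF small_lip_rem_mean[OF lag(1,2)]]) (simp add: k_def)
  ultimately show "small_lip (min (r + 1) s) (\<lambda>h z. (\<Sum>i=1..m. b i * (lagrangian (taylor X r (c i * h) z)
      - lagrangian (flow X z (c i * h)) + flow_remainder lagrangian s (c i * h) z))
      - (1 / h) * integral {0..h} (\<lambda>t. flow_remainder lagrangian s t z))"
    unfolding k_def[symmetric]
    by (intro small_lip_diff[OF small_lip_sum])
  show "\<forall>\<^sub>F h in at_right 0. \<forall>z\<in>ball 0 R. (\<Sum>i=1..m. b i * (lagrangian (taylor X r (c i * h) z)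
      - lagrangian (flow X z (c i * h)) + flow_remainder lagrangian s (c i * h) z))
      - (1 / h) * integral {0..h} (\<lambda>t. flow_remainder lagrangian s t z) = quad_mean h z - exact_mean h z" for R
    using eventually_at_right_pos
  proof eventually_elim
    case (elim h)
    note elim = elim[unfolded lip_bound_def]
    show ?case
      unfolding exact_mean_expansion[OF elim] quad_mean_def
      by (simp add: distrib_left right_diff_distrib sum.distrib sum_subtractf)
  qed
qed

text \<open>The argument pairs the mixed data with the initial state, and only the momentum of the
  data is used. One formula serves both types, because either boundary term,
  \<open>p\<^sub>1 \<bullet> q\<^sub>1\<close> or \<open>- p\<^sub>0 \<bullet> q\<^sub>0\<close>, is
  a pairing of the data plus \<open>h\<close> times the momentum of the data paired with the
  position increment.\<close>

definition taylor_core :: "real \<Rightarrow> ('q \<times> 'q) \<times> ('q \<times> 'q) \<Rightarrow> real" where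
  "taylor_core h p = snd (fst p) \<bullet> fst (taylor_incr (r + 1) h (snd p)) - quad_mean h (snd p)"

definition exact_core :: "real \<Rightarrow> ('q \<times> 'q) \<times> ('q \<times> 'q) \<Rightarrow> real" where
  "exact_core h p = snd (fst p) \<bullet> fst (flow_incr h (snd p)) - exact_mean h (snd p)"

lemma fam_C11_taylor_core: "fam_C11 taylor_core"
proof -
  have "Ck 2 (\<lambda>x :: real \<times> ('q \<times> 'q) \<times> ('q \<times> 'q). (fst x, snd (snd x)))"
    by (intro Ck_Pair Ck_fst Ck_snd Ck_id)
  note proj = this
  have incr: "Ck 2 (\<lambda>x :: real \<times> ('q \<times> 'q) \<times> ('q \<times> 'q). taylor_incr (r + 1) (fst x) (snd (snd x)))"
    using Ck_compose[OF Ck_taylor_incr[OF X_C, of "r + 1" 1] proj] by simp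
  have quad: "Ck 2 (\<lambda>x :: real \<times> ('q \<times> 'q) \<times> ('q \<times> 'q). quad_mean (fst x) (snd (snd x)))"
    using Ck_compose[OF Ck_quad_mean proj] by simp
  have "Ck 2 (\<lambda>x :: real \<times> ('q \<times> 'q) \<times> ('q \<times> 'q). snd (fst (snd x)) \<bullet> fst (taylor_incr (r + 1) (fst x) (snd (snd x)))
      - quad_mean (fst x) (snd (snd x)))"
    by (intro Ck_diff[OF Ck_inner[OF _ Ck_fst[OF incr]] quad] Ck_snd Ck_fst Ck_id)
  from fam_C11_of_Ck[OF this] show ?thesis by (simp add: taylor_core_def[abs_def])
qed

text \<open>The difference is split at the Taylor core evaluated in the exact initial state
  \<open>z'\<close>. The change from \<open>z\<close> to \<open>z'\<close> costs regularity of the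
  smooth core only; the change of core happens at the same point, so the flow increment never has to
  be differentiated.\<close>

lemma core_family:
  assumes V: "fam_C11 V" and V': "small_lip 0 V'" and d: "small_lip r (\<lambda>h x. V h x - V' h x)"
    and z: "implicit_family V z" and z': "implicit_family V' z'"
  shows "fam_C11 (\<lambda>h w. taylor_core h (w, z h w))"
    and "small_lip (min (r + 1) s) (\<lambda>h w. taylor_core h (w, z h w) - exact_core h (w, z' h w))"
proof -
  show "fam_C11 (\<lambda>h w. taylor_core h (w, z h w))"
    by (rule fam_C11_compose[OF fam_C11_taylor_core fam_C11_Pair[OF fam_C11_ident implicit_family_C11[OF V z]]])
  define k where "k = min (r + 1) s"
  have zs: "small_lip 0 z" "small_lip 0 z'"
    using implicit_family_small_lip fam_C11_imp_small_lip V V' z z' by blast+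
  have id0: "small_lip 0 (\<lambda>(h :: real) w :: 'q \<times> 'q. w)" by (rule fam_C11_imp_small_lip[OF fam_C11_ident])
  have pair: "small_lip 0 (\<lambda>h w. (w, y h w))" if "small_lip 0 y" for y :: "real \<Rightarrow> 'q \<times> 'q \<Rightarrow> 'q \<times> 'q"
  proof -
    have "small_lip 0 (\<lambda>h w. (w, 0 :: 'q \<times> 'q) + (0 :: 'q \<times> 'q, y h w))"
      by (intro small_lip_add small_lip_bounded_linear[OF _ id0] small_lip_bounded_linear[OF _ that]
         bounded_linear_Pair bounded_linear_ident bounded_linear_zero)
    then show ?thesis by simp
  qed
  have "small_lip k (\<lambda>h w. z h w - z' h w)"
    by (rule small_lip_mono[OF implicit_family_difference[OF V V' d z z']]) (simp add: k_def)
  then have "small_lip k (\<lambda>h w. (0 :: 'q \<times> 'q, z h w - z' h w))"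
    by (rule small_lip_bounded_linear[rotated]) (intro bounded_linear_Pair bounded_linear_ident bounded_linear_zero)
  then have 1: "small_lip k (\<lambda>h w. taylor_core h (w, z h w) - taylor_core h (w, z' h w))"
    by (intro small_lip_C11_difference[OF fam_C11_taylor_core] pair zs) simp
  have "small_lip k (\<lambda>h z. taylor_incr (r + 1) h z - flow_incr h z)"
    by (rule small_lip_mono[OF small_lip_taylor_incr_minus_flow_incr[OF X_C]]) (simp_all add: k_def)
  from small_lip_compose[OF this zs(2)]
  have "small_lip k (\<lambda>h w. fst (taylor_incr (r + 1) h (z' h w) - flow_incr h (z' h w)))"
    by (rule small_lip_bounded_linear[OF bounded_linear_fst])
  moreover have "small_lip k (\<lambda>h w. quad_mean h (z' h w) - exact_mean h (z' h w))"
    using small_lip_compose[OF small_lip_quad_mean_minus_exact_mean zs(2)] by (simp add: k_def)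
  ultimately have "small_lip k (\<lambda>h w. snd w \<bullet> fst (taylor_incr (r + 1) h (z' h w) - flow_incr h (z' h w))
      - (quad_mean h (z' h w) - exact_mean h (z' h w)))"
    by (rule small_lip_diff[OF small_lip_inner[OF small_lip_linear[OF bounded_linear_snd]]])
  from small_lip_add[OF 1 this]
  show "small_lip (min (r + 1) s) (\<lambda>h w. taylor_core h (w, z h w) - exact_core h (w, z' h w))"
    by (simp add: taylor_core_def exact_core_def k_def inner_diff_right algebra_simps)
qed

section \<open>First variation of the action\<close>

text \<open>
  The first variation of the action along solutions consists of boundary terms only; this is its
  error, of second order in \<open>y - x\<close>.
\<close>

definition action_defect :: "real \<Rightarrow> 'q \<times> 'q \<Rightarrow> 'q \<times> 'q \<Rightarrow> real" where
  "action_defect h x y = h * exact_mean h y - h * exact_mean h x -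
     (snd (flow X x h) \<bullet> (fst (flow X y h) - fst (flow X x h)) - snd x \<bullet> (fst y - fst x))"

text \<open>Along two solutions the linear part of the difference of the Lagrangians is the time
  derivative of \<open>p\<^sub>u \<bullet> (q\<^sub>v - q\<^sub>u)\<close>, by Hamilton's equations.
  What remains to be integrated is quadratic in the distance of the solutions, and this distance is
  controlled by the Lipschitz constant of the flow.\<close>

lemma exact_mean_variation:
  "\<exists>C. \<forall>h x y. 0 < h \<longrightarrow> h \<le> 1 \<longrightarrow> x \<in> ball 0 R \<longrightarrow> y \<in> ball 0 R \<longrightarrow>
    norm (action_defect h x y) \<le> C * (norm (y - x))\<^sup>2"
proof -
  define R' where "R' = R + 2 * L * 1"
  obtain A where A: "0 \<le> A" "\<And>x y t. x \<in> cball 0 R \<Longrightarrow> y \<in> cball 0 R \<Longrightarrow> \<bar>t\<bar> \<le> 1 \<Longrightarrow>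
      norm (flow X x t - flow X y t) \<le> A * norm (x - y)"
    using flow_lipschitz[of R 1] by metis
  obtain B where B: "0 \<le> B" "C11 B (cball 0 R') H"
    using Ck_2_imp_C11[OF H_C[of 2], of 0 R'] by auto
  have "Ck 1 (dH_dp H)" by (rule Ck_dH_dp, rule H_C) simp
  from Ck_1_bounds[OF this, of 0 R'] obtain D where D: "0 \<le> D"
    "\<And>x y. x \<in> cball 0 R' \<Longrightarrow> y \<in> cball 0 R' \<Longrightarrow> norm (dH_dp H x - dH_dp H y) \<le> D * norm (x - y)"
    by meson
  have H': "(H has_derivative (\<lambda>v. fst v \<bullet> dH_dq H z + snd v \<bullet> dH_dp H z)) (at z)" for z
  proof -
    have "frechet_derivative H (at z) = (\<lambda>v. fst v \<bullet> dH_dq H z + snd v \<bullet> dH_dp H z)"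
      using frechet_derivative_eq_dH[OF H_C[of "Suc 0"], of z] by (auto simp: fun_eq_iff)
    then show ?thesis using Ck_Suc_has_derivative[OF H_C[of "Suc 0"], of z] by simp
  qed
  have dq: "((\<lambda>t. fst (flow X x t)) has_vector_derivative dH_dp H (flow X x t)) (at t)"
    and dp: "((\<lambda>t. snd (flow X x t)) has_vector_derivative - dH_dq H (flow X x t)) (at t)" for x t
    using bounded_linear.has_vector_derivative[OF bounded_linear_fst flow_deriv, of x t]
      bounded_linear.has_vector_derivative[OF bounded_linear_snd flow_deriv, of x t]
    by (simp_all add: ham_vf_def)
  have "norm (action_defect h x y)
      \<le> ((D + B) * A\<^sup>2) * (norm (y - x))\<^sup>2"
    if h: "0 < h" "h \<le> 1" and x: "x \<in> ball 0 R" and y: "y \<in> ball 0 R" for h x y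
  proof -
    define u where "u t = flow X x t" for t
    define v where "v t = flow X y t" for t
    define N where "N t = snd (u t) \<bullet> (fst (v t) - fst (u t))" for t
    define N' where "N' t = snd (u t) \<bullet> (dH_dp H (v t) - dH_dp H (u t)) + - dH_dq H (u t) \<bullet> (fst (v t) - fst (u t))" for t
    have xy: "x \<in> cball 0 R" "y \<in> cball 0 R" using x y by auto
    have "(N has_vector_derivative N' t) (at t)" for t
      unfolding N_def[abs_def] N'_def u_def v_def
      by (intro bounded_bilinear.has_vector_derivative[OF bounded_bilinear_inner] has_vector_derivative_diff dq dp)
    then have N: "(N' has_integral N h - N 0) {0..h}"
      using h by (intro fundamental_theorem_of_calculus) (auto intro: has_vector_derivative_at_within)
    define e where "e t = lagrangian (v t) - lagrangian (u t) - N' t" for t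
    have e_int: "(e has_integral (h * exact_mean h y - h * exact_mean h x - (N h - N 0))) {0..h}"
      unfolding e_def
    proof (intro has_integral_diff N)
      show "((\<lambda>t. lagrangian (v t)) has_integral h * exact_mean h y) {0..h}"
        "((\<lambda>t. lagrangian (u t)) has_integral h * exact_mean h x) {0..h}"
        using h integrable_integral[OF integrable_continuous_real[OF lagrangian_flow_continuous]]
        by (simp_all add: exact_mean_def u_def v_def)
    qed
    have e_bound: "norm (e t) \<le> ((D + B) * A\<^sup>2) * (norm (y - x))\<^sup>2" if t: "t \<in> cbox 0 h" for t
    proof -
      have t1: "\<bar>t\<bar> \<le> 1" using t h by auto
      have uv: "u t \<in> cball 0 R'" "v t \<in> cball 0 R'"
        using flow_in_cball[OF xy(1) t1] flow_in_cball[OF xy(2) t1] by (auto simp: u_def v_def R'_def)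
      define \<delta> where "\<delta> = norm (v t - u t)"
      have \<delta>: "\<delta> \<le> A * norm (y - x)" using A(2)[OF xy(2,1) t1] by (simp add: \<delta>_def u_def v_def)
      \<comment> \<open>All linear terms cancel: one summand is a product of two differences, the
        other is the first-order Taylor remainder of \<open>H\<close> at \<open>u t\<close>.\<close>
      have e_eq: "e t = (snd (v t) - snd (u t)) \<bullet> (dH_dp H (v t) - dH_dp H (u t)) -
          (H (v t) - H (u t) - (fst (v t - u t) \<bullet> dH_dq H (u t) + snd (v t - u t) \<bullet> dH_dp H (u t)))"
        by (simp add: e_def lagrangian_def N'_def inner_diff_left inner_diff_right inner_commute algebra_simps)
      have "norm (e t) \<le> norm ((snd (v t) - snd (u t)) \<bullet> (dH_dp H (v t) - dH_dp H (u t))) +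
          norm (H (v t) - H (u t) - (fst (v t - u t) \<bullet> dH_dq H (u t) + snd (v t - u t) \<bullet> dH_dp H (u t)))"
        unfolding e_eq by (rule norm_triangle_ineq4)
      also have "\<dots> \<le> \<delta> * (D * \<delta>) + B * \<delta> * \<delta>"
      proof (rule add_mono)
        have "norm ((snd (v t) - snd (u t)) \<bullet> (dH_dp H (v t) - dH_dp H (u t)))
            \<le> norm (snd (v t) - snd (u t)) * norm (dH_dp H (v t) - dH_dp H (u t))"
          by (simp add: Cauchy_Schwarz_ineq2)
        also have "\<dots> \<le> \<delta> * (D * \<delta>)"
        proof (rule mult_mono)
          show "norm (snd (v t) - snd (u t)) \<le> \<delta>"
            using norm_snd_le_norm[of "v t - u t"] by (simp add: \<delta>_def)
          show "norm (dH_dp H (v t) - dH_dp H (u t)) \<le> D * \<delta>"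
            unfolding \<delta>_def by (rule D(2)[OF uv(2,1)])
        qed (simp_all add: \<delta>_def)
        finally show "norm ((snd (v t) - snd (u t)) \<bullet> (dH_dp H (v t) - dH_dp H (u t))) \<le> \<delta> * (D * \<delta>)" .
        show "norm (H (v t) - H (u t) - (fst (v t - u t) \<bullet> dH_dq H (u t) + snd (v t - u t) \<bullet> dH_dp H (u t))) \<le> B * \<delta> * \<delta>"
          unfolding \<delta>_def by (rule C11_taylor_bound[OF B(2) convex_cball uv H'])
      qed
      also have "\<dots> = (D + B) * \<delta>\<^sup>2" by (simp add: power2_eq_square algebra_simps)
      also have "\<dots> \<le> (D + B) * (A * norm (y - x))\<^sup>2"
        using \<delta> B(1) D(1) by (intro mult_left_mono power_mono) (auto simp: \<delta>_def)
      finally show ?thesis by (simp add: power_mult_distrib mult_ac)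
    qed
    have "norm (h * exact_mean h y - h * exact_mean h x - (N h - N 0)) \<le> ((D + B) * A\<^sup>2) * (norm (y - x))\<^sup>2 * measure lborel (cbox 0 h)"
      using B(1) D(1) e_int by (intro has_integral_bound[OF _ _ e_bound]) auto
    also have "\<dots> \<le> ((D + B) * A\<^sup>2) * (norm (y - x))\<^sup>2 * 1"
      using h B(1) D(1) by (intro mult_left_mono) auto
    finally show ?thesis by (simp add: action_defect_def N_def u_def v_def)
  qed
  then show ?thesis by blast
qed

end

section \<open>Taylor and exact discrete Hamiltonians\<close>

lemma small_lip_imp_discrete_hamiltonian_order:
  fixes Hd HdE :: "real \<Rightarrow> 'q::euclidean_space \<Rightarrow> 'q \<Rightarrow> real"
  assumes "small_lip (Suc k) (\<lambda>h w. Hd h (fst w) (snd w) - HdE h (fst w) (snd w))"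
  shows "discrete_hamiltonian_order k Hd HdE"
  unfolding discrete_hamiltonian_order_def
proof
  fix a :: "'q \<times> 'q"
  obtain C where C: "\<forall>\<^sub>F h in at_right 0. lip_bound (C * h ^ Suc k) (ball 0 (norm a + 1))
      (\<lambda>w. Hd h (fst w) (snd w) - HdE h (fst w) (snd w))"
    by (rule small_lipE[where R = "norm a + 1", OF assms])
  have "\<forall>\<^sub>F h in at_right 0. \<forall>w\<in>ball 0 (norm a + 1).
      norm (Hd h (fst w) (snd w) - HdE h (fst w) (snd w)) \<le> C * norm (h ^ (k + 1))"
    using C eventually_at_right_pos by eventually_elim (auto simp: lip_bound_def)
  from eventually_prod_at_right_nhdsI[OF this]
  show "(\<lambda>(h, q, p). Hd h q p - HdE h q p) \<in> O[at_right 0 \<times>\<^sub>F nhds a](\<lambda>(h, _). h ^ (k + 1))"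
    by (intro bigoI[of _ C]) (simp add: case_prod_unfold)
qed

text \<open>
  \<open>P\<close> projects the data to the component that the unknown replaces and \<open>E\<close> embeds that component.
\<close>

lemma implicit_family_local_solution:
  fixes U :: "real \<Rightarrow> 'a::euclidean_space \<Rightarrow> 'b::euclidean_space"
  assumes U: "small_lip 0 U" and P: "bounded_linear P" "\<And>a. norm (P a) \<le> norm a"
    and E: "bounded_linear E" "\<And>u. norm (E u) \<le> norm u"
    and S: "\<forall>\<^sub>F h in at_right 0. \<forall>a y. S h a y \<longleftrightarrow> P a = y + h *\<^sub>R U h (a + E (y - P a))"
  shows "implicit_family (\<lambda>h z. E (U h z)) (\<lambda>h w. w + E (local_solution S P h w - P w))"
proof -
  interpret E: bounded_linear E by fact
  \<comment> \<open>The argument of \<open>U h\<close> is the full state: the data with the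
    component selected by \<open>P\<close> replaced by the unknown.\<close>
  define \<Phi> where "\<Phi> h p = U h (fst p + E (snd p - P (fst p)))" for h p
  have "bounded_linear (\<lambda>p. fst p + E (snd p - P (fst p)))"
    by (intro bounded_linear_add bounded_linear_fst bounded_linear_compose[OF E(1)] bounded_linear_sub
        bounded_linear_snd bounded_linear_compose[OF P(1) bounded_linear_fst])
  then have \<Phi>: "small_lip 0 \<Phi>"
    unfolding \<Phi>_def[abs_def] by (intro small_lip_compose[OF U] small_lip_linear)
  show ?thesis
    unfolding implicit_family_def
  proof
    fix R
    have "\<forall>\<^sub>F h in at_right 0. \<forall>a\<in>ball 0 R. near_solution h \<Phi> P a (local_solution S P h a)"
    proof (rule local_solution_near_identity[OF \<Phi> P(2)])
      show "\<forall>\<^sub>F h in at_right 0. \<forall>a\<in>ball 0 R. \<forall>y. dist y (P a) < 1 \<longrightarrow>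
          (S h a y \<longleftrightarrow> y = P a - h *\<^sub>R \<Phi> h (a, y))" for R
        using S by (rule eventually_mono) (auto simp: \<Phi>_def eq_diff_eq)
    qed
    then show "\<forall>\<^sub>F h in at_right 0. \<forall>w\<in>ball 0 R. norm (w + E (local_solution S P h w - P w) - w) < 1 \<and>
        w + E (local_solution S P h w - P w) + h *\<^sub>R E (U h (w + E (local_solution S P h w - P w))) = w"
    proof eventually_elim
      case (elim h)
      show ?case
      proof
        fix w :: 'a assume "w \<in> ball 0 R"
        then have y: "dist (local_solution S P h w) (P w) < 1"
          "local_solution S P h w - P w = - (h *\<^sub>R U h (w + E (local_solution S P h w - P w)))"
          using elim by (auto simp: near_solution_def \<Phi>_def eq_diff_eq algebra_simps)
        have "norm (E (local_solution S P h w - P w)) < 1"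
          using E(2) y(1) unfolding dist_norm by (rule le_less_trans)
        moreover have "E (local_solution S P h w - P w) = - (h *\<^sub>R E (U h (w + E (local_solution S P h w - P w))))"
          by (subst y(2)) (simp add: E.neg E.scaleR)
        ultimately show "norm (w + E (local_solution S P h w - P w) - w) < 1 \<and>
          w + E (local_solution S P h w - P w) + h *\<^sub>R E (U h (w + E (local_solution S P h w - P w))) = w"
          by (simp add: eq_neg_iff_add_eq_0)
      qed
    qed
  qed
qed

lemma bounded_linear_embed:
  "bounded_linear (\<lambda>z :: 'a::real_normed_vector \<times> 'b::real_normed_vector. (0 :: 'c::real_normed_vector, snd z))"
  "bounded_linear (\<lambda>z :: 'a \<times> 'b. (fst z, 0 :: 'c))"
  by (intro bounded_linear_Pair bounded_linear_zero bounded_linear_fst bounded_linear_snd)+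

context lipschitz_hamiltonian
begin

section \<open>The mixed boundary value problems as near-identity equations\<close>

lemma scaleR_flow_incr: "0 < h \<Longrightarrow> h *\<^sub>R flow_incr h z = flow X z h - z"
  by (simp add: flow_incr_def)

lemma small_lip_incr: "small_lip 0 flow_incr" "\<rho> \<le> r + 1 \<Longrightarrow> small_lip 0 (taylor_incr \<rho>)"
  by (rule small_lip_flow_incr[OF X_C], simp)
    (rule fam_C11_imp_small_lip[OF fam_C11_taylor_incr[OF X_C]], simp)

lemma taylor_step: "\<rho> \<le> r + 1 \<Longrightarrow> taylor X \<rho> h z = z + h *\<^sub>R taylor_incr \<rho> h z"
  by (rule taylor_eq[OF X_C]) simp

text \<open>In the Type II problem the position is given, so the perturbation of the identity must
  vanish in that component; only the momentum equation is implicit. \<open>position\<close> plays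
  the same part for Type III.\<close>

definition momentum :: "(real \<Rightarrow> 'q \<times> 'q \<Rightarrow> 'q \<times> 'q) \<Rightarrow> real \<Rightarrow> 'q \<times> 'q \<Rightarrow> 'q \<times> 'q" where
  "momentum W h z = (0, snd (W h z))"

definition position :: "(real \<Rightarrow> 'q \<times> 'q \<Rightarrow> 'q \<times> 'q) \<Rightarrow> real \<Rightarrow> 'q \<times> 'q \<Rightarrow> 'q \<times> 'q" where
  "position W h z = (fst (W h z), 0)"

lemma small_lip_momentum: "small_lip k W \<Longrightarrow> small_lip k (momentum W)"
  and small_lip_position: "small_lip k W \<Longrightarrow> small_lip k (position W)"
  unfolding momentum_def[abs_def] position_def[abs_def]
  by (rule small_lip_bounded_linear[OF bounded_linear_embed(1)], assumption)
    (rule small_lip_bounded_linear[OF bounded_linear_embed(2)])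

lemma fam_C11_momentum: "fam_C11 W \<Longrightarrow> fam_C11 (momentum W)"
  and fam_C11_position: "fam_C11 W \<Longrightarrow> fam_C11 (position W)"
  unfolding momentum_def[abs_def] position_def[abs_def]
  by (rule fam_C11_compose[OF fam_C11_linear[OF bounded_linear_embed(1)]], assumption)
    (rule fam_C11_compose[OF fam_C11_linear[OF bounded_linear_embed(2)]])

lemma implicit_family_momentum:
  assumes W: "small_lip 0 W"
    and S: "\<forall>\<^sub>F h in at_right 0. \<forall>a y. S h a y \<longleftrightarrow> snd a = y + h *\<^sub>R snd (W h (fst a, y))"
  shows "implicit_family (momentum W) (\<lambda>h w. (fst w, local_solution S (\<lambda>(q, p). p) h w))"
proof -
  have embed: "a + (0, y - snd a) = (fst a, y)" for a :: "'q \<times> 'q" and y by (simp add: prod_eq_iff)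
  have "implicit_family (\<lambda>h z. (0, snd (W h z))) (\<lambda>h w. w + (0, local_solution S snd h w - snd w))"
    by (rule implicit_family_local_solution[where E = "\<lambda>u. (0, u)" and P = snd])
      (use S in \<open>auto simp: embed norm_Pair norm_snd_le_norm intro!: small_lip_bounded_linear[OF _ W]
        bounded_linear_snd bounded_linear_Pair bounded_linear_zero bounded_linear_ident\<close>)
  moreover have "(\<lambda>(q, p). p) = (snd :: 'q \<times> 'q \<Rightarrow> 'q)" by auto
  ultimately show ?thesis by (simp add: embed momentum_def[abs_def])
qed

lemma implicit_family_position:
  assumes W: "small_lip 0 W"
    and S: "\<forall>\<^sub>F h in at_right 0. \<forall>a y. S h a y \<longleftrightarrow> fst a = y + h *\<^sub>R fst (W h (y, snd a))"
  shows "implicit_family (position W) (\<lambda>h w. (local_solution S (\<lambda>(q, p). q) h w, snd w))"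
proof -
  have embed: "a + (y - fst a, 0) = (y, snd a)" for a :: "'q \<times> 'q" and y by (simp add: prod_eq_iff)
  have "implicit_family (\<lambda>h z. (fst (W h z), 0)) (\<lambda>h w. w + (local_solution S fst h w - fst w, 0))"
    by (rule implicit_family_local_solution[where E = "\<lambda>u. (u, 0)" and P = fst])
      (use S in \<open>auto simp: embed norm_Pair norm_fst_le_norm intro!: small_lip_bounded_linear[OF _ W]
        bounded_linear_fst bounded_linear_Pair bounded_linear_zero bounded_linear_ident\<close>)
  moreover have "(\<lambda>(q, p). q) = (fst :: 'q \<times> 'q \<Rightarrow> 'q)" by auto
  ultimately show ?thesis by (simp add: embed position_def[abs_def])
qed

lemma implicit_exact_p0: "implicit_family (momentum flow_incr) (\<lambda>h w. (fst w, exact_p0 H h w))"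
  unfolding exact_p0_def
  by (rule implicit_family_momentum[OF small_lip_incr(1)], rule eventually_mono[OF eventually_at_right_pos])
    (auto simp: scaleR_flow_incr simp flip: snd_scaleR)

lemma implicit_taylor_p0: "implicit_family (momentum (taylor_incr r)) (\<lambda>h w. (fst w, taylor_p0 H r h w))"
  unfolding taylor_p0_def
  by (rule implicit_family_momentum[OF small_lip_incr(2)]) (auto simp: taylor_step)

lemma implicit_exact_q0: "implicit_family (position flow_incr) (\<lambda>h w. (exact_q0 H h w, snd w))"
  unfolding exact_q0_def
  by (rule implicit_family_position[OF small_lip_incr(1)], rule eventually_mono[OF eventually_at_right_pos])
    (auto simp: scaleR_flow_incr simp flip: fst_scaleR)

lemma implicit_taylor_q0: "implicit_family (position (taylor_incr (r + 1))) (\<lambda>h w. (taylor_q0 H r h w, snd w))"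
  unfolding taylor_q0_def
  by (rule implicit_family_position[OF small_lip_incr(2)]) (auto simp: taylor_step simp del: One_nat_def)

lemma small_lip_momentum_difference:
  "small_lip r (\<lambda>h x. momentum (taylor_incr r) h x - momentum flow_incr h x)"
proof -
  have "small_lip r (momentum (\<lambda>h z. taylor_incr r h z - flow_incr h z))"
    by (intro small_lip_momentum small_lip_taylor_incr_minus_flow_incr X_C) simp
  then show ?thesis by (simp add: momentum_def[abs_def])
qed

lemma small_lip_position_difference:
  "small_lip r (\<lambda>h x. position (taylor_incr (r + 1)) h x - position flow_incr h x)"
proof -
  have "small_lip r (position (\<lambda>h z. taylor_incr (r + 1) h z - flow_incr h z))"
    by (intro small_lip_position small_lip_mono[OF small_lip_taylor_incr_minus_flow_incr[OF X_C]]) simp_all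
  then show ?thesis by (simp add: position_def[abs_def])
qed

lemmas core_plus = core_family[OF fam_C11_momentum[OF fam_C11_taylor_incr[OF X_C]]
  small_lip_momentum[OF small_lip_incr(1)] small_lip_momentum_difference implicit_taylor_p0 implicit_exact_p0]

lemmas core_minus = core_family[OF fam_C11_position[OF fam_C11_taylor_incr[OF X_C]]
  small_lip_position[OF small_lip_incr(1)] small_lip_position_difference implicit_taylor_q0 implicit_exact_q0]

text \<open>The factor \<open>1\<close> is the value of \<open>\<sigma>\<close> in
  \<open>discrete_map_order\<close>; Type III has \<open>- 1\<close> in its place.\<close>

lemma taylor_Hd_plus_eq:
  "taylor_Hd_plus H r m b c h (fst w) (snd w) = 1 * (snd w \<bullet> fst w) + h * taylor_core h (w, (fst w, taylor_p0 H r h w))"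
  by (simp add: taylor_Hd_plus_def Let_def taylor_step quadrature_action_eq taylor_core_def inner_add_right algebra_simps
     del: One_nat_def)

lemma action_flow: "0 < h \<Longrightarrow> action H h (flow X z) = h * exact_mean h z"
  by (simp add: action_eq exact_mean_def)

lemma exact_Hd_plus_eq:
  assumes "0 < h"
  shows "exact_Hd_plus H h (fst w) (snd w) = 1 * (snd w \<bullet> fst w) + h * exact_core h (w, (fst w, exact_p0 H h w))"
proof -
  have "fst (flow X z h) = fst z + h *\<^sub>R fst (flow_incr h z)" for z
    using scaleR_flow_incr[OF assms, of z] by (simp flip: fst_scaleR)
  then show ?thesis
    by (simp add: exact_Hd_plus_def Let_def action_flow[OF assms] exact_core_def inner_add_right algebra_simps)
qed

text \<open>Unlike in Type II, the increment is not visible in the boundary term; it appears by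
  solving the equation for the initial position. The identity therefore holds only where this
  equation is known to have a solution, on balls and for small \<open>h\<close>.\<close>

lemma taylor_Hd_minus_eq:
  "\<forall>\<^sub>F h in at_right 0. \<forall>w\<in>ball 0 R. taylor_Hd_minus H r m b c h (fst w) (snd w) =
    - 1 * (snd w \<bullet> fst w) + h * taylor_core h (w, (taylor_q0 H r h w, snd w))"
  using implicit_familyD[OF implicit_taylor_q0, of R]
proof eventually_elim
  case (elim h)
  show ?case
  proof
    fix w :: "'q \<times> 'q" assume "w \<in> ball 0 R"
    then have "taylor_q0 H r h w + h *\<^sub>R fst (taylor_incr (r + 1) h (taylor_q0 H r h w, snd w)) = fst w"
      using elim by (metis fst_add fst_conv fst_scaleR position_def)
    then have "taylor_q0 H r h w = fst w - h *\<^sub>R fst (taylor_incr (r + 1) h (taylor_q0 H r h w, snd w))"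
      by (simp add: eq_diff_eq)
    then have "snd w \<bullet> taylor_q0 H r h w =
        snd w \<bullet> fst w - h * (snd w \<bullet> fst (taylor_incr (r + 1) h (taylor_q0 H r h w, snd w)))"
      by (metis inner_diff_right inner_scaleR_right)
    then show "taylor_Hd_minus H r m b c h (fst w) (snd w) =
      - 1 * (snd w \<bullet> fst w) + h * taylor_core h (w, (taylor_q0 H r h w, snd w))"
      by (simp add: taylor_Hd_minus_def Let_def quadrature_action_eq taylor_core_def algebra_simps del: One_nat_def)
  qed
qed

lemma exact_Hd_minus_eq:
  "\<forall>\<^sub>F h in at_right 0. \<forall>w\<in>ball 0 R. exact_Hd_minus H h (fst w) (snd w) =
    - 1 * (snd w \<bullet> fst w) + h * exact_core h (w, (exact_q0 H h w, snd w))"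
  using implicit_familyD[OF implicit_exact_q0, of R] eventually_at_right_pos
proof eventually_elim
  case (elim h)
  show ?case
  proof
    fix w :: "'q \<times> 'q" assume "w \<in> ball 0 R"
    then have "exact_q0 H h w + h *\<^sub>R fst (flow_incr h (exact_q0 H h w, snd w)) = fst w"
      using elim(1) by (metis fst_add fst_conv fst_scaleR position_def)
    then have "exact_q0 H h w = fst w - h *\<^sub>R fst (flow_incr h (exact_q0 H h w, snd w))"
      by (simp add: eq_diff_eq)
    then have "snd w \<bullet> exact_q0 H h w =
        snd w \<bullet> fst w - h * (snd w \<bullet> fst (flow_incr h (exact_q0 H h w, snd w)))"
      by (metis inner_diff_right inner_scaleR_right)
    then show "exact_Hd_minus H h (fst w) (snd w) =
      - 1 * (snd w \<bullet> fst w) + h * exact_core h (w, (exact_q0 H h w, snd w))"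
      by (simp add: exact_Hd_minus_def Let_def action_flow[OF elim(2)] exact_core_def algebra_simps)
  qed
qed

lemma small_lip_Hd_plus:
  "small_lip (Suc (min (r + 1) s)) (\<lambda>h w. taylor_Hd_plus H r m b c h (fst w) (snd w) - exact_Hd_plus H h (fst w) (snd w))"
proof (rule small_lip_cong)
  show "small_lip (Suc (min (r + 1) s)) (\<lambda>h w. h *\<^sub>R (taylor_core h (w, (fst w, taylor_p0 H r h w)) -
      exact_core h (w, (fst w, exact_p0 H h w))))"
    by (rule small_lip_scale[OF core_plus(2)]) simp
  show "\<forall>\<^sub>F h in at_right 0. \<forall>w\<in>ball 0 R. h *\<^sub>R (taylor_core h (w, (fst w, taylor_p0 H r h w)) -
      exact_core h (w, (fst w, exact_p0 H h w))) =
      taylor_Hd_plus H r m b c h (fst w) (snd w) - exact_Hd_plus H h (fst w) (snd w)" for R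
    using eventually_at_right_pos
    by eventually_elim (simp add: taylor_Hd_plus_eq exact_Hd_plus_eq right_diff_distrib)
qed

lemma small_lip_Hd_minus:
  "small_lip (Suc (min (r + 1) s)) (\<lambda>h w. taylor_Hd_minus H r m b c h (fst w) (snd w) - exact_Hd_minus H h (fst w) (snd w))"
proof (rule small_lip_cong)
  show "small_lip (Suc (min (r + 1) s)) (\<lambda>h w. h *\<^sub>R (taylor_core h (w, (taylor_q0 H r h w, snd w)) -
      exact_core h (w, (exact_q0 H h w, snd w))))"
    by (rule small_lip_scale[OF core_minus(2)]) simp
  show "\<forall>\<^sub>F h in at_right 0. \<forall>w\<in>ball 0 R. h *\<^sub>R (taylor_core h (w, (taylor_q0 H r h w, snd w)) -
      exact_core h (w, (exact_q0 H h w, snd w))) =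
      taylor_Hd_minus H r m b c h (fst w) (snd w) - exact_Hd_minus H h (fst w) (snd w)" for R
    using taylor_Hd_minus_eq[of R] exact_Hd_minus_eq[of R]
    by eventually_elim (simp add: right_diff_distrib)
qed

section \<open>Gradients of the exact discrete Hamiltonians\<close>

lemma exact_quadratic_bounds:
  assumes V: "small_lip 0 V" and z: "implicit_family V z"
  shows "\<exists>C. \<forall>\<^sub>F h in at_right 0. 0 < h \<and> (\<forall>x\<in>ball 0 R. \<forall>y\<in>ball 0 R.
    norm (action_defect h (z h x) (z h y)) \<le> C * (norm (y - x))\<^sup>2 \<and>
    norm (z h y - z h x) \<le> C * norm (y - x) \<and> norm (flow X (z h y) h - flow X (z h x) h) \<le> C * norm (y - x))"
proof -
  obtain A where A: "\<And>h x y. 0 < h \<Longrightarrow> h \<le> 1 \<Longrightarrow> x \<in> ball 0 (R + 1) \<Longrightarrow> y \<in> ball 0 (R + 1) \<Longrightarrow>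
    norm (action_defect h x y) \<le> A * (norm (y - x))\<^sup>2"
    using exact_mean_variation[of "R + 1"] by meson
  obtain B where B: "0 \<le> B" "\<And>x y t. x \<in> cball 0 (R + 1) \<Longrightarrow> y \<in> cball 0 (R + 1) \<Longrightarrow> \<bar>t\<bar> \<le> 1 \<Longrightarrow>
    norm (flow X x t - flow X y t) \<le> B * norm (x - y)"
    using flow_lipschitz[of "R + 1" 1] by metis
  \<comment> \<open>Solutions of the near-identity equation have Lipschitz constant
    \<open>2\<close>: it enters squared in the quadratic bound, as it is for \<open>z\<close>, and
    multiplied by \<open>B\<close> after the flow.\<close>
  define C where "C = 4 * \<bar>A\<bar> + 2 + 2 * B"
  show ?thesis
  proof (rule exI[of _ C])
    show "\<forall>\<^sub>F h in at_right 0. 0 < h \<and> (\<forall>x\<in>ball 0 R. \<forall>y\<in>ball 0 R.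
      norm (action_defect h (z h x) (z h y)) \<le> C * (norm (y - x))\<^sup>2 \<and>
      norm (z h y - z h x) \<le> C * norm (y - x) \<and> norm (flow X (z h y) h - flow X (z h x) h) \<le> C * norm (y - x))"
      using implicit_familyD[OF z, of R] implicit_family_lipschitz[OF V z, of R] eventually_at_right_pos
        eventually_at_right_less_const[OF zero_less_one]
    proof eventually_elim
      case (elim h)
      show ?case
      proof (intro conjI ballI elim(3))
        fix x y :: "'q \<times> 'q" assume x: "x \<in> ball 0 R" and y: "y \<in> ball 0 R"
        have zb: "z h x \<in> ball 0 (R + 1)" "z h y \<in> ball 0 (R + 1)"
          using elim(1) x y implicit_family_in_ball by blast+
        have lip: "norm (z h y - z h x) \<le> 2 * norm (y - x)" using elim(2) x y by blast
        have "2 * norm (y - x) \<le> C * norm (y - x)" using B(1) by (intro mult_right_mono) (auto simp: C_def)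
        with lip show "norm (z h y - z h x) \<le> C * norm (y - x)" by linarith
        have "norm (flow X (z h y) h - flow X (z h x) h) \<le> B * norm (z h y - z h x)"
          using zb elim(3,4) by (intro B(2)) auto
        also have "\<dots> \<le> B * (2 * norm (y - x))" by (rule mult_left_mono[OF lip B(1)])
        also have "\<dots> = (2 * B) * norm (y - x)" by simp
        also have "\<dots> \<le> C * norm (y - x)" by (intro mult_right_mono) (auto simp: C_def)
        finally show "norm (flow X (z h y) h - flow X (z h x) h) \<le> C * norm (y - x)" .
        have "norm (action_defect h (z h x) (z h y)) \<le> A * (norm (z h y - z h x))\<^sup>2"
          using elim(3,4) by (intro A zb) auto
        also have "\<dots> \<le> \<bar>A\<bar> * (2 * norm (y - x))\<^sup>2"
          using lip by (intro mult_mono power_mono) auto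
        also have "\<dots> = (4 * \<bar>A\<bar>) * (norm (y - x))\<^sup>2" by (simp add: power_mult_distrib)
        also have "\<dots> \<le> C * (norm (y - x))\<^sup>2" using B(1) by (intro mult_right_mono) (auto simp: C_def)
        finally show "norm (action_defect h (z h x) (z h y)) \<le> C * (norm (y - x))\<^sup>2" .
      qed
    qed
  qed
qed

text \<open>Common part of both types: the linearization error is a product of two first-order
  differences minus the action defect, hence quadratic.\<close>

lemma has_derivative_of_action_defect:
  assumes V: "small_lip 0 V" and z: "implicit_family V z"
    and f: "\<forall>\<^sub>F h in at_right 0. \<forall>x\<in>ball 0 R. \<forall>y\<in>ball 0 R. \<exists>d. norm d \<le> norm (z h y - z h x) + norm (flow X (z h y) h - flow X (z h x) h) \<and>
      f h y - f h x - (y - x) \<bullet> g h x = (snd y - snd x) \<bullet> d - action_defect h (z h x) (z h y)"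
  shows "\<forall>\<^sub>F h in at_right 0. \<forall>w\<in>ball 0 R. (f h has_derivative (\<lambda>v. v \<bullet> g h w)) (at w)"
proof -
  obtain C where C: "\<forall>\<^sub>F h in at_right 0. 0 < h \<and> (\<forall>x\<in>ball 0 R. \<forall>y\<in>ball 0 R.
    norm (action_defect h (z h x) (z h y)) \<le> C * (norm (y - x))\<^sup>2 \<and>
    norm (z h y - z h x) \<le> C * norm (y - x) \<and> norm (flow X (z h y) h - flow X (z h x) h) \<le> C * norm (y - x))"
    using exact_quadratic_bounds[OF V z] by blast
  show ?thesis
    using C f
  proof eventually_elim
    case (elim h)
    show ?case
    proof
      fix x :: "'q \<times> 'q" assume x: "x \<in> ball 0 R"
      show "(f h has_derivative (\<lambda>v. v \<bullet> g h x)) (at x)"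
      proof (rule has_derivativeI_quadratic[OF open_ball x bounded_linear_inner_left])
        fix y :: "'q \<times> 'q" assume y: "y \<in> ball 0 R"
        obtain d where d: "norm d \<le> norm (z h y - z h x) + norm (flow X (z h y) h - flow X (z h x) h)"
          "f h y - f h x - (y - x) \<bullet> g h x = (snd y - snd x) \<bullet> d - action_defect h (z h x) (z h y)"
          using elim(2) x y by blast
        have C: "norm (action_defect h (z h x) (z h y)) \<le> C * (norm (y - x))\<^sup>2" "norm d \<le> 2 * (C * norm (y - x))"
          using elim(1)[THEN conjunct2, rule_format, OF x y] d(1) by auto
        have "norm (f h y - f h x - (y - x) \<bullet> g h x) \<le> norm ((snd y - snd x) \<bullet> d) + norm (action_defect h (z h x) (z h y))"
          unfolding d(2) by (rule norm_triangle_ineq4)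
        also have "norm ((snd y - snd x) \<bullet> d) \<le> norm (snd y - snd x) * norm d"
          by (simp add: Cauchy_Schwarz_ineq2)
        also have "\<dots> \<le> norm (y - x) * (2 * (C * norm (y - x)))"
          using norm_snd_le_norm[of "y - x"] C(2) by (intro mult_mono) auto
        finally show "norm (f h y - f h x - (y - x) \<bullet> g h x) \<le> (3 * C) * (norm (y - x))\<^sup>2"
          using C(1) by (simp add: power2_eq_square mult_ac)
      qed
    qed
  qed
qed

text \<open>The variation of the end position enters with factor \<open>p\<^sub>1\<close> from
  \<open>p\<^sub>1 \<bullet> q\<^sub>1\<close> and again, with opposite sign, from the action; the
  two cancel. What is left is the initial momentum paired with the variation of
  \<open>q\<^sub>0\<close> and the end position paired with that of
  \<open>p\<^sub>1\<close>.\<close>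

lemma exact_Hd_plus_gradient:
  "\<forall>\<^sub>F h in at_right 0. \<forall>w\<in>ball 0 R. ((\<lambda>w. exact_Hd_plus H h (fst w) (snd w)) has_derivative
    (\<lambda>v. v \<bullet> (exact_p0 H h w, fst (flow X (fst w, exact_p0 H h w) h)))) (at w)"
proof -
  define z where "z h w = (fst w, exact_p0 H h w)" for h and w :: "'q \<times> 'q"
  have z: "implicit_family (momentum flow_incr) z" using implicit_exact_p0 by (simp add: z_def[abs_def])
  show ?thesis
  proof (rule has_derivative_of_action_defect[OF small_lip_momentum[OF small_lip_incr(1)] z])
    show "\<forall>\<^sub>F h in at_right 0. \<forall>x\<in>ball 0 R. \<forall>y\<in>ball 0 R. \<exists>d. norm d \<le> norm (z h y - z h x) + norm (flow X (z h y) h - flow X (z h x) h) \<and>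
      exact_Hd_plus H h (fst y) (snd y) - exact_Hd_plus H h (fst x) (snd x) -
        (y - x) \<bullet> (exact_p0 H h x, fst (flow X (fst x, exact_p0 H h x) h)) =
      (snd y - snd x) \<bullet> d - action_defect h (z h x) (z h y)"
      using implicit_familyD[OF z, of R] eventually_at_right_pos
    proof eventually_elim
      case (elim h)
      \<comment> \<open>The momentum of the solution at time \<open>h\<close> is the prescribed one,
        which is what makes the boundary terms cancel.\<close>
      have P: "snd (flow X (z h w) h) = snd w" if "w \<in> ball 0 R" for w
      proof -
        have "snd (z h w) + h *\<^sub>R snd (flow_incr h (z h w)) = snd w"
          using elim(1) that by (metis momentum_def snd_add snd_conv snd_scaleR)
        then show ?thesis using scaleR_flow_incr[OF elim(2), of "z h w"] by (simp flip: snd_scaleR)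
      qed
      have Hd: "exact_Hd_plus H h (fst w) (snd w) = snd w \<bullet> fst (flow X (z h w) h) - h * exact_mean h (z h w)" for w
        by (simp add: exact_Hd_plus_def Let_def action_flow[OF elim(2)] z_def)
      show ?case
      proof (intro ballI exI conjI)
        fix x y :: "'q \<times> 'q" assume x: "x \<in> ball 0 R" and y: "y \<in> ball 0 R"
        show "norm (fst (flow X (z h y) h - flow X (z h x) h)) \<le> norm (z h y - z h x) + norm (flow X (z h y) h - flow X (z h x) h)"
          by (rule add_increasing[OF norm_ge_zero norm_fst_le_norm])
        show "exact_Hd_plus H h (fst y) (snd y) - exact_Hd_plus H h (fst x) (snd x) -
            (y - x) \<bullet> (exact_p0 H h x, fst (flow X (fst x, exact_p0 H h x) h)) =
          (snd y - snd x) \<bullet> fst (flow X (z h y) h - flow X (z h x) h) - action_defect h (z h x) (z h y)"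
          unfolding Hd action_defect_def P[OF x]
          by (simp add: z_def inner_prod_def inner_diff_left inner_diff_right inner_commute)
      qed
    qed
  qed
qed

text \<open>Mirror image of the previous case: now the boundary terms at the initial time cancel, up
  to a product of two differences, and the end position is prescribed.\<close>

lemma exact_Hd_minus_gradient:
  "\<forall>\<^sub>F h in at_right 0. \<forall>w\<in>ball 0 R. ((\<lambda>w. exact_Hd_minus H h (fst w) (snd w)) has_derivative
    (\<lambda>v. v \<bullet> (- snd (flow X (exact_q0 H h w, snd w) h), - exact_q0 H h w))) (at w)"
proof -
  define z where "z h w = (exact_q0 H h w, snd w)" for h and w :: "'q \<times> 'q"
  have z: "implicit_family (position flow_incr) z" using implicit_exact_q0 by (simp add: z_def[abs_def])
  show ?thesis
  proof (rule has_derivative_of_action_defect[OF small_lip_position[OF small_lip_incr(1)] z])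
    show "\<forall>\<^sub>F h in at_right 0. \<forall>x\<in>ball 0 R. \<forall>y\<in>ball 0 R. \<exists>d. norm d \<le> norm (z h y - z h x) + norm (flow X (z h y) h - flow X (z h x) h) \<and>
      exact_Hd_minus H h (fst y) (snd y) - exact_Hd_minus H h (fst x) (snd x) -
        (y - x) \<bullet> (- snd (flow X (exact_q0 H h x, snd x) h), - exact_q0 H h x) =
      (snd y - snd x) \<bullet> d - action_defect h (z h x) (z h y)"
      using implicit_familyD[OF z, of R] eventually_at_right_pos
    proof eventually_elim
      case (elim h)
      have Q: "fst (flow X (z h w) h) = fst w" if "w \<in> ball 0 R" for w
      proof -
        have "fst (z h w) + h *\<^sub>R fst (flow_incr h (z h w)) = fst w"
          using elim(1) that by (metis position_def fst_add fst_conv fst_scaleR)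
        then show ?thesis using scaleR_flow_incr[OF elim(2), of "z h w"] by (simp flip: fst_scaleR)
      qed
      have Hd: "exact_Hd_minus H h (fst w) (snd w) = - (snd w \<bullet> fst (z h w)) - h * exact_mean h (z h w)" for w
        by (simp add: exact_Hd_minus_def Let_def action_flow[OF elim(2)] z_def)
      show ?case
      proof (intro ballI exI conjI)
        fix x y :: "'q \<times> 'q" assume x: "x \<in> ball 0 R" and y: "y \<in> ball 0 R"
        show "norm (- fst (z h y - z h x)) \<le> norm (z h y - z h x) + norm (flow X (z h y) h - flow X (z h x) h)"
          unfolding norm_minus_cancel by (rule add_increasing2[OF norm_ge_zero norm_fst_le_norm])
        show "exact_Hd_minus H h (fst y) (snd y) - exact_Hd_minus H h (fst x) (snd x) -
            (y - x) \<bullet> (- snd (flow X (exact_q0 H h x, snd x) h), - exact_q0 H h x) =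
          (snd y - snd x) \<bullet> (- fst (z h y - z h x)) - action_defect h (z h x) (z h y)"
          unfolding Hd action_defect_def Q[OF x] Q[OF y]
          by (simp add: z_def inner_prod_def inner_diff_left inner_diff_right inner_commute)
      qed
    qed
  qed
qed

section \<open>Discrete Hamiltonian maps\<close>

text \<open>
  \<open>T (a, y)\<close> is the mixed data of the step \<open>a \<mapsto> y\<close> at which the generating function is
  differentiated and \<open>G (a, y)\<close> is the value that the defining equations prescribe for its gradient.
\<close>

lemma discrete_map_order:
  fixes T G :: "('q \<times> 'q) \<times> ('q \<times> 'q) \<Rightarrow> 'q \<times> 'q" and Hd HdE :: "real \<Rightarrow> 'q \<Rightarrow> 'q \<Rightarrow> real"
  assumes T: "bounded_linear T" and T_bound: "\<And>p. norm (T p) \<le> norm p"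
    and G: "\<And>a y. \<sigma> *\<^sub>R (snd (T (a, y)), fst (T (a, y))) - G (a, y) = (snd y - snd a, fst a - fst y)"
    and Hd: "\<And>R. \<forall>\<^sub>F h in at_right 0. \<forall>w\<in>ball 0 R. Hd h (fst w) (snd w) = \<sigma> * (snd w \<bullet> fst w) + h * K h w"
    and K: "fam_C11 K"
    and diff: "small_lip (Suc k) (\<lambda>h w. Hd h (fst w) (snd w) - HdE h (fst w) (snd w))"
    and exact: "\<And>R. \<forall>\<^sub>F h in at_right 0. \<forall>a\<in>ball 0 R. ((\<lambda>w. HdE h (fst w) (snd w)) has_derivative
      (\<lambda>v. v \<bullet> G (a, flow X a h))) (at (T (a, flow X a h)))"
    and S: "\<And>h a y. S h a y \<longleftrightarrow> GDERIV (\<lambda>q. Hd h q (snd (T (a, y)))) (fst (T (a, y))) :> fst (G (a, y)) \<and>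
      GDERIV (\<lambda>p. Hd h (fst (T (a, y))) p) (snd (T (a, y))) :> snd (G (a, y))"
  shows "one_step_order k (local_solution S (\<lambda>z. z)) X"
proof -
  define g where "g h w = gradient (K h) w" for h w
  \<comment> \<open>A quarter turn of the gradient of \<open>K\<close>: assumption \<open>G\<close>
    says that the leading pairing contributes the increments of the step, turned in the opposite
    way.\<close>
  define \<Phi> where "\<Phi> h p = (- snd (g h (T p)), fst (g h (T p)))" for h p
  define grad where "grad h w = \<sigma> *\<^sub>R (snd w, fst w) + h *\<^sub>R g h w" for h w
  have J: "bounded_linear (\<lambda>u :: 'q \<times> 'q. (- snd u, fst u))"
    by (intro bounded_linear_Pair bounded_linear_minus bounded_linear_fst bounded_linear_snd)
  have \<Phi>: "small_lip 0 \<Phi>"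
    unfolding \<Phi>_def[abs_def] g_def
    by (intro small_lip_bounded_linear[OF J] small_lip_compose[OF fam_C11_gradient(2)[OF K]] small_lip_linear T)
  have deriv: "\<forall>\<^sub>F h in at_right 0. \<forall>w\<in>ball 0 R.
      ((\<lambda>w. Hd h (fst w) (snd w)) has_derivative (\<lambda>v. v \<bullet> grad h w)) (at w)" for R
    using Hd[of R] fam_C11_gradient(1)[OF K, of R]
  proof eventually_elim
    case (elim h)
    note elim = elim[unfolded lip_bound_def]
    show ?case
    proof
      fix w :: "'q \<times> 'q" assume w: "w \<in> ball 0 R"
      have K': "(K h has_derivative (\<lambda>v. v \<bullet> g h w)) (at w)"
        using elim(2) w unfolding gderiv_def g_def by blast
      have "((\<lambda>w. \<sigma> * (snd w \<bullet> fst w) + h * K h w) has_derivative (\<lambda>v. v \<bullet> grad h w)) (at w)"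
        by (rule derivative_eq_intros K' refl)+
          (auto simp: grad_def inner_prod_def inner_add_right inner_commute algebra_simps)
      then show "((\<lambda>w. Hd h (fst w) (snd w)) has_derivative (\<lambda>v. v \<bullet> grad h w)) (at w)"
        by (rule has_derivative_transform_within_open[OF _ open_ball w]) (use elim(1) in simp)
    qed
  qed
  \<comment> \<open>The quarter turn is an isometry, so the residual of the fixed point equation and
    that of the defining equations have equal norm; in particular both equations have the same
    solutions.\<close>
  have residual: "norm (y - (a - h *\<^sub>R \<Phi> h (a, y))) = norm (grad h (T (a, y)) - G (a, y))" for h a y
  proof -
    define e where "e = grad h (T (a, y)) - G (a, y)"
    have "e = (snd y - snd a, fst a - fst y) + h *\<^sub>R g h (T (a, y))"
      unfolding e_def grad_def G[symmetric] by simp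
    then have "y - (a - h *\<^sub>R \<Phi> h (a, y)) = (- snd e, fst e)"
      by (simp add: \<Phi>_def prod_eq_iff)
    then have "norm (y - (a - h *\<^sub>R \<Phi> h (a, y))) = norm (- snd e, fst e)" by simp
    also have "\<dots> = norm (fst e, snd e)" by (simp add: norm_Pair add.commute del: prod.collapse)
    finally show ?thesis unfolding prod.collapse e_def .
  qed
  have T_ball: "T (a, y) \<in> ball 0 (2 * R + 2)" if "a \<in> ball 0 R" "dist y a < 1" for a y R
  proof -
    have "norm (T (a, y)) \<le> norm a + norm y" using T_bound norm_Pair_le order_trans by blast
    moreover have "norm y \<le> norm a + norm (y - a)" by (rule norm_triangle_sub)
    ultimately show ?thesis using that by (simp add: dist_norm)
  qed
  have solution: "\<forall>\<^sub>F h in at_right 0. \<forall>a\<in>ball 0 R. near_solution h \<Phi> (\<lambda>z. z) a (local_solution S (\<lambda>z. z) h a)" for R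
  proof (rule local_solution_near_identity[OF \<Phi>, of "\<lambda>z. z"])
    show "\<forall>\<^sub>F h in at_right 0. \<forall>a\<in>ball 0 R. \<forall>y. dist y a < 1 \<longrightarrow> (S h a y \<longleftrightarrow> y = a - h *\<^sub>R \<Phi> h (a, y))" for R
      using deriv[of "2 * R + 2"]
    proof eventually_elim
      case (elim h)
      show ?case
      proof (intro ballI allI impI)
        fix a y :: "'q \<times> 'q" assume a: "a \<in> ball 0 R" and y: "dist y a < 1"
        have D: "((\<lambda>w. Hd h (fst w) (snd w)) has_derivative (\<lambda>v. v \<bullet> grad h (T (a, y)))) (at (T (a, y)))"
          using elim T_ball[OF a y] by blast
        have "S h a y \<longleftrightarrow> grad h (T (a, y)) - G (a, y) = 0"
          unfolding S GDERIV_partials[OF D] by (auto simp: prod_eq_iff)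
        also have "\<dots> \<longleftrightarrow> y - (a - h *\<^sub>R \<Phi> h (a, y)) = 0"
          using residual[of y a h] by (metis norm_eq_zero)
        finally show "S h a y \<longleftrightarrow> y = a - h *\<^sub>R \<Phi> h (a, y)" by simp
      qed
    qed
  qed simp
  show ?thesis
    unfolding one_step_order_def
  proof
    fix a0 :: "'q \<times> 'q"
    define R where "R = norm a0 + 1"
    obtain C where C: "1 \<le> C" "\<forall>\<^sub>F h in at_right 0. lip_bound (C * h ^ Suc k) (ball 0 (2 * R + 2))
      (\<lambda>w. Hd h (fst w) (snd w) - HdE h (fst w) (snd w))"
      by (rule small_lipE[where R = "2 * R + 2", OF diff])
    \<comment> \<open>The flow moves a point by at most \<open>h * (2 * L)\<close>, so its value
      lies in the unit ball in which \<open>near_solution\<close> compares candidates.\<close>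
    have "\<forall>\<^sub>F h in at_right 0. h * (2 * L) < 1" by (rule eventually_at_right_mult_less) simp
    with C(2) exact[of R] deriv[of "2 * R + 2"] solution[of R] eventually_at_right_pos
    have "\<forall>\<^sub>F h in at_right 0. \<forall>a\<in>ball 0 R.
        norm (norm (local_solution S (\<lambda>z. z) h a - flow X a h)) \<le> (2 * C) * norm (h ^ (k + 1))"
    proof eventually_elim
      case (elim h)
      show ?case
      proof
        fix a :: "'q \<times> 'q" assume a: "a \<in> ball 0 R"
        define y where "y = flow X a h"
        define w where "w = T (a, y)"
        have y: "dist y a < 1"
          using flow_bound[of a h] elim(5,6) by (simp add: y_def dist_norm mult.commute)
        have w: "w \<in> ball 0 (2 * R + 2)" unfolding w_def by (rule T_ball[OF a y])
        have "((\<lambda>w. Hd h (fst w) (snd w) - HdE h (fst w) (snd w)) has_derivative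
            (\<lambda>v. v \<bullet> grad h w - v \<bullet> G (a, y))) (at w)"
          using elim(2,3) w a unfolding w_def y_def by (intro has_derivative_diff) blast+
        then have "norm (v \<bullet> grad h w - v \<bullet> G (a, y)) \<le> C * h ^ Suc k * norm v" for v
        proof (rule has_derivative_norm_le_lipschitz[OF _ open_ball w])
          show "norm (Hd h (fst v) (snd v) - HdE h (fst v) (snd v) - (Hd h (fst w) (snd w) - HdE h (fst w) (snd w)))
            \<le> C * h ^ Suc k * norm (v - w)" if "v \<in> ball 0 (2 * R + 2)" for v
            using elim(1) w that unfolding lip_bound_def by blast
        qed
        \<comment> \<open>Testing the linear form with the difference vector itself turns its bound
          into one on the vector.\<close>
        from this[of "grad h w - G (a, y)"]
        have "norm (grad h w - G (a, y)) * norm (grad h w - G (a, y)) \<le> C * h ^ Suc k * norm (grad h w - G (a, y))"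
          by (simp flip: inner_diff_right add: dot_square_norm power2_eq_square)
        moreover have "0 \<le> C * h ^ Suc k" using C(1) elim(5) by simp
        ultimately have "norm (grad h w - G (a, y)) \<le> C * h ^ Suc k"
          by (cases "grad h w - G (a, y) = 0") auto
        moreover have "norm (y - local_solution S (\<lambda>z. z) h a) \<le> 2 * norm (grad h w - G (a, y))"
          using elim(4) a y residual[of y a h] unfolding w_def near_solution_def by metis
        ultimately show "norm (norm (local_solution S (\<lambda>z. z) h a - flow X a h)) \<le> (2 * C) * norm (h ^ (k + 1))"
          using elim(5) by (simp add: y_def norm_minus_commute)
      qed
    qed
    from eventually_prod_at_right_nhdsI[OF this[unfolded R_def]]
    show "(\<lambda>(h, z). norm (local_solution S (\<lambda>z. z) h z - flow X z h)) \<in> O[at_right 0 \<times>\<^sub>F nhds a0](\<lambda>(h, _). h ^ (k + 1))"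
      by (intro bigoI[of _ "2 * C"]) (simp add: case_prod_unfold)
  qed
qed

text \<open>The state \<open>a\<close> solves the near-identity equation for the mixed data of its
  own trajectory and is within distance \<open>1\<close> of them, so uniqueness identifies it with
  the selected solution.\<close>

lemma exact_p0_flow:
  "\<forall>\<^sub>F h in at_right 0. \<forall>a\<in>ball 0 R. exact_p0 H h (fst a, snd (flow X a h)) = snd a"
proof -
  have "\<forall>\<^sub>F h in at_right 0. h * (2 * L) < 1" by (rule eventually_at_right_mult_less) simp
  with implicit_family_unique[OF small_lip_momentum[OF small_lip_incr(1)] implicit_exact_p0, of "2 * R + 2"]
    eventually_at_right_pos
  show ?thesis
  proof eventually_elim
    case (elim h)
    show ?case
    proof
      fix a :: "'q \<times> 'q" assume a: "a \<in> ball 0 R"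
      define w where "w = (fst a, snd (flow X a h))"
      have "a - w = (0, snd (a - flow X a h))" by (simp add: w_def prod_eq_iff)
      then have "norm (a - w) = norm (snd (a - flow X a h))" by (simp add: norm_Pair)
      also have "\<dots> \<le> norm (a - flow X a h)"
        by (rule norm_snd_le_norm)
      finally have aw: "norm (a - w) < 1"
        using flow_bound[of a h] elim(2,3) by (simp add: norm_minus_commute mult.commute)
      have "norm w \<le> norm a + norm (w - a)" by (rule norm_triangle_sub)
      moreover have "norm a < R" using a by simp
      ultimately have "norm w < 2 * R + 2"
        using aw norm_ge_zero[of a] unfolding norm_minus_commute[of w a] by linarith
      then have "w \<in> ball 0 (2 * R + 2)" by simp
      moreover have "a + h *\<^sub>R momentum flow_incr h a = w"
        using scaleR_flow_incr[OF elim(2), of a] by (simp add: momentum_def w_def prod_eq_iff flip: snd_scaleR)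
      ultimately have "(fst w, exact_p0 H h w) = a" using elim(1) aw by blast
      from arg_cong[OF this, of snd] show "exact_p0 H h (fst a, snd (flow X a h)) = snd a" by (simp add: w_def)
    qed
  qed
qed

lemma exact_q0_flow:
  "\<forall>\<^sub>F h in at_right 0. \<forall>a\<in>ball 0 R. exact_q0 H h (fst (flow X a h), snd a) = fst a"
proof -
  have "\<forall>\<^sub>F h in at_right 0. h * (2 * L) < 1" by (rule eventually_at_right_mult_less) simp
  with implicit_family_unique[OF small_lip_position[OF small_lip_incr(1)] implicit_exact_q0, of "2 * R + 2"]
    eventually_at_right_pos
  show ?thesis
  proof eventually_elim
    case (elim h)
    show ?case
    proof
      fix a :: "'q \<times> 'q" assume a: "a \<in> ball 0 R"
      define w where "w = (fst (flow X a h), snd a)"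
      have "a - w = (fst (a - flow X a h), 0)" by (simp add: w_def prod_eq_iff)
      then have "norm (a - w) = norm (fst (a - flow X a h))" by (simp add: norm_Pair)
      also have "\<dots> \<le> norm (a - flow X a h)"
        by (rule norm_fst_le_norm)
      finally have aw: "norm (a - w) < 1"
        using flow_bound[of a h] elim(2,3) by (simp add: norm_minus_commute mult.commute)
      have "norm w \<le> norm a + norm (w - a)" by (rule norm_triangle_sub)
      moreover have "norm a < R" using a by simp
      ultimately have "norm w < 2 * R + 2"
        using aw norm_ge_zero[of a] unfolding norm_minus_commute[of w a] by linarith
      then have "w \<in> ball 0 (2 * R + 2)" by simp
      moreover have "a + h *\<^sub>R position flow_incr h a = w"
        using scaleR_flow_incr[OF elim(2), of a] by (simp add: position_def w_def prod_eq_iff flip: fst_scaleR)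
      ultimately have "(exact_q0 H h w, snd w) = a" using elim(1) aw by blast
      from arg_cong[OF this, of fst] show "exact_q0 H h (fst (flow X a h), snd a) = fst a" by (simp add: w_def)
    qed
  qed
qed

section \<open>Accuracy of the Type II and Type III maps\<close>

lemma mixed_data_bounds:
  fixes p :: "('q \<times> 'q) \<times> ('q \<times> 'q)"
  shows "norm (fst (fst p), snd (snd p)) \<le> norm p" "norm (fst (snd p), snd (fst p)) \<le> norm p"
  by (auto simp: norm_prod_def intro!: real_sqrt_le_mono)

lemma mixed_data_in_ball:
  assumes "a \<in> ball 0 R" "0 < h" "h * (2 * L) < 1"
  shows "(fst a, snd (flow X a h)) \<in> ball 0 (2 * R + 2)" "(fst (flow X a h), snd a) \<in> ball 0 (2 * R + 2)"
proof -
  have "norm (flow X a h) \<le> norm a + norm (flow X a h - a)" by (rule norm_triangle_sub)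
  then have "norm a + norm (flow X a h) < 2 * R + 2"
    using assms flow_bound[of a h] by (simp add: mult.commute)
  then show "(fst a, snd (flow X a h)) \<in> ball 0 (2 * R + 2)" "(fst (flow X a h), snd a) \<in> ball 0 (2 * R + 2)"
    using mixed_data_bounds[of "(a, flow X a h)"] norm_Pair_le[of a "flow X a h"] by simp_all
qed

lemma discrete_map_plus_order:
  "one_step_order (min (r + 1) s) (discrete_map_plus (taylor_Hd_plus H r m b c)) X"
  unfolding discrete_map_plus_def
proof (rule discrete_map_order[where T = "\<lambda>p. (fst (fst p), snd (snd p))" and G = "\<lambda>p. (snd (fst p), fst (snd p))"
      and \<sigma> = 1 and K = "\<lambda>h w. taylor_core h (w, (fst w, taylor_p0 H r h w))" and HdE = "exact_Hd_plus H"])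
  show "bounded_linear (\<lambda>p :: ('q \<times> 'q) \<times> ('q \<times> 'q). (fst (fst p), snd (snd p)))"
    by (intro bounded_linear_Pair bounded_linear_compose[OF bounded_linear_fst bounded_linear_fst]
        bounded_linear_compose[OF bounded_linear_snd bounded_linear_snd])
  show "fam_C11 (\<lambda>h w. taylor_core h (w, (fst w, taylor_p0 H r h w)))" by (rule core_plus(1)) simp
  show "small_lip (Suc (min (r + 1) s)) (\<lambda>h w. taylor_Hd_plus H r m b c h (fst w) (snd w) - exact_Hd_plus H h (fst w) (snd w))"
    by (rule small_lip_Hd_plus)
  show "\<forall>\<^sub>F h in at_right 0. \<forall>a\<in>ball 0 R. ((\<lambda>w. exact_Hd_plus H h (fst w) (snd w)) has_derivative
      (\<lambda>v. v \<bullet> (snd (fst (a, flow X a h)), fst (snd (a, flow X a h)))))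
      (at (fst (fst (a, flow X a h)), snd (snd (a, flow X a h))))" for R
  proof -
    have "\<forall>\<^sub>F h in at_right 0. h * (2 * L) < 1" by (rule eventually_at_right_mult_less) simp
    with exact_Hd_plus_gradient[of "2 * R + 2"] exact_p0_flow[of R] eventually_at_right_pos show ?thesis
    proof eventually_elim
      case (elim h)
      show ?case
      proof
        fix a :: "'q \<times> 'q" assume a: "a \<in> ball 0 R"
        show "((\<lambda>w. exact_Hd_plus H h (fst w) (snd w)) has_derivative
          (\<lambda>v. v \<bullet> (snd (fst (a, flow X a h)), fst (snd (a, flow X a h)))))
          (at (fst (fst (a, flow X a h)), snd (snd (a, flow X a h))))"
          using elim(1)[rule_format, OF mixed_data_in_ball(1)[OF a elim(3,4)]] elim(2)[rule_format, OF a] by simp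
      qed
    qed
  qed
qed (auto simp: taylor_Hd_plus_eq mixed_data_bounds case_prod_unfold simp del: One_nat_def)

text \<open>The signs in \<open>G\<close> are those of the defining equations, and
  \<open>\<sigma> = - 1\<close> is the sign of the leading pairing; together they leave the same
  increments of position and momentum as in the Type II case.\<close>

lemma discrete_map_minus_order:
  "one_step_order (min (r + 1) s) (discrete_map_minus (taylor_Hd_minus H r m b c)) X"
  unfolding discrete_map_minus_def
proof (rule discrete_map_order[where T = "\<lambda>p. (fst (snd p), snd (fst p))" and G = "\<lambda>p. (- snd (snd p), - fst (fst p))"
      and \<sigma> = "- 1" and K = "\<lambda>h w. taylor_core h (w, (taylor_q0 H r h w, snd w))" and HdE = "exact_Hd_minus H"])
  show "bounded_linear (\<lambda>p :: ('q \<times> 'q) \<times> ('q \<times> 'q). (fst (snd p), snd (fst p)))"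
    by (intro bounded_linear_Pair bounded_linear_compose[OF bounded_linear_fst bounded_linear_snd]
        bounded_linear_compose[OF bounded_linear_snd bounded_linear_fst])
  show "fam_C11 (\<lambda>h w. taylor_core h (w, (taylor_q0 H r h w, snd w)))" by (rule core_minus(1)) simp
  show "\<forall>\<^sub>F h in at_right 0. \<forall>w\<in>ball 0 R. taylor_Hd_minus H r m b c h (fst w) (snd w) =
      - 1 * (snd w \<bullet> fst w) + h * taylor_core h (w, (taylor_q0 H r h w, snd w))" for R
    by (rule taylor_Hd_minus_eq)
  show "\<forall>\<^sub>F h in at_right 0. \<forall>a\<in>ball 0 R. ((\<lambda>w. exact_Hd_minus H h (fst w) (snd w)) has_derivative
      (\<lambda>v. v \<bullet> (- snd (snd (a, flow X a h)), - fst (fst (a, flow X a h)))))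
      (at (fst (snd (a, flow X a h)), snd (fst (a, flow X a h))))" for R
  proof -
    have "\<forall>\<^sub>F h in at_right 0. h * (2 * L) < 1" by (rule eventually_at_right_mult_less) simp
    with exact_Hd_minus_gradient[of "2 * R + 2"] exact_q0_flow[of R] eventually_at_right_pos show ?thesis
    proof eventually_elim
      case (elim h)
      show ?case
      proof
        fix a :: "'q \<times> 'q" assume a: "a \<in> ball 0 R"
        show "((\<lambda>w. exact_Hd_minus H h (fst w) (snd w)) has_derivative
          (\<lambda>v. v \<bullet> (- snd (snd (a, flow X a h)), - fst (fst (a, flow X a h)))))
          (at (fst (snd (a, flow X a h)), snd (fst (a, flow X a h))))"
          using elim(1)[rule_format, OF mixed_data_in_ball(2)[OF a elim(3,4)]] elim(2)[rule_format, OF a] by simp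
      qed
    qed
  qed
qed (auto simp: small_lip_Hd_minus mixed_data_bounds case_prod_unfold simp del: One_nat_def)

lemma taylor_discrete_hamiltonian_orders:
  "discrete_hamiltonian_order (min (r + 1) s) (taylor_Hd_plus H r m b c) (exact_Hd_plus H) \<and>
   discrete_hamiltonian_order (min (r + 1) s) (taylor_Hd_minus H r m b c) (exact_Hd_minus H) \<and>
   one_step_order (min (r + 1) s) (discrete_map_plus (taylor_Hd_plus H r m b c)) X \<and>
   one_step_order (min (r + 1) s) (discrete_map_minus (taylor_Hd_minus H r m b c)) X"
  by (intro conjI small_lip_imp_discrete_hamiltonian_order small_lip_Hd_plus small_lip_Hd_minus
      discrete_map_plus_order discrete_map_minus_order)

end

theorem theorem2p1:
  fixes r s :: nat
  shows "\<exists>k. \<forall>(H :: (real ^ 'n) \<times> (real ^ 'n) \<Rightarrow> real) m b c.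
    Ck k H \<longrightarrow>
    (\<exists>L. L-lipschitz_on UNIV H) \<longrightarrow>
    (\<exists>L. L-lipschitz_on UNIV (dH_dp H)) \<longrightarrow>
    quadrature_order m b c s \<longrightarrow>
      discrete_hamiltonian_order (min (r + 1) s) (taylor_Hd_plus H r m b c) (exact_Hd_plus H) \<and>
      discrete_hamiltonian_order (min (r + 1) s) (taylor_Hd_minus H r m b c) (exact_Hd_minus H) \<and>
      one_step_order (min (r + 1) s) (discrete_map_plus (taylor_Hd_plus H r m b c)) (ham_vf H) \<and>
      one_step_order (min (r + 1) s) (discrete_map_minus (taylor_Hd_minus H r m b c)) (ham_vf H)"
\<comment> \<open>The smoothness order is the one fixed in \<open>lipschitz_hamiltonian\<close>; it
  depends on \<open>r\<close> and \<open>s\<close> only and can be chosen before \<open>H\<close>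
  and the rule.\<close>
proof (intro exI[of _ "r + s + 5"] allI impI)
  fix H :: "(real ^ 'n) \<times> (real ^ 'n) \<Rightarrow> real" and m b c
  assume H: "Ck (r + s + 5) H" "\<exists>L. L-lipschitz_on UNIV H" and "quadrature_order m b c s"
  then obtain L where "L-lipschitz_on UNIV H" by blast
  then interpret lipschitz_hamiltonian H L r s m b c
    using H(1) \<open>quadrature_order m b c s\<close> by unfold_locales
  show "discrete_hamiltonian_order (min (r + 1) s) (taylor_Hd_plus H r m b c) (exact_Hd_plus H) \<and>
      discrete_hamiltonian_order (min (r + 1) s) (taylor_Hd_minus H r m b c) (exact_Hd_minus H) \<and>
      one_step_order (min (r + 1) s) (discrete_map_plus (taylor_Hd_plus H r m b c)) (ham_vf H) \<and>
      one_step_order (min (r + 1) s) (discrete_map_minus (taylor_Hd_minus H r m b c)) (ham_vf H)"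
    by (rule taylor_discrete_hamiltonian_orders)
qed

end
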